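(* Let $G$ be an infinite finitely generated abelian group and let $S$ be a finite symmetric generating set of $G$. Then the Cayley graph $\Gamma(G,S)$ has a Hamilton circle, unless $G=\mathbb{Z}$ and $S=\{1,-1\}$ (the case $\Gamma(\mathbb{Z},\{1\})$, which has no Hamilton circle).
   Context: Generating sets are always assumed symmetric ($s\in S\Rightarrow s^{-1}\in S$) and finite, so the Cayley graph $\Gamma(G,S)$ is locally finite. For a locally finite graph $\Gamma$, $|\Gamma|$ denotes its Freudenthal compactification (the graph together with its ends). A Hamilton circle of $\Gamma$ is a subspace of $|\Gamma|$ homeomorphic to the unit circle $S^1$ that contains every vertex of $\Gamma$.
   Formalization: The exceptional case is G isomorphic to Z with S, apart from a possible identity element, corresponding to {1,-1}; this also excludes S={0,1,-1}, where the Cayley graph is again the double ray and has no Hamilton circle. *)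

theory Defs
  imports "HOL-Analysis.Analysis" "HOL-Algebra.Generated_Groups" "HOL-Algebra.Elementary_Groups"
begin

record 'a ugraph =
  verts :: "'a set"
  edges :: "'a set set"

text \<open>The Cayley graph is taken as a simple graph: an identity element in \<open>S\<close> contributes no loops.\<close>

definition cayley_graph :: "('a, 'b) monoid_scheme \<Rightarrow> 'a set \<Rightarrow> 'a ugraph" where
  "cayley_graph G S =
     \<lparr>verts = carrier G,
      edges = {{g, g \<otimes>\<^bsub>G\<^esub> s} | g s. g \<in> carrier G \<and> s \<in> S \<and> s \<noteq> \<one>\<^bsub>G\<^esub>}\<rparr>"

definition component_of_avoiding :: "'a ugraph \<Rightarrow> 'a set \<Rightarrow> 'a \<Rightarrow> 'a set" where
  "component_of_avoiding \<Gamma> X v =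
     {w. (v, w) \<in> {(x, y). x \<in> verts \<Gamma> - X \<and> y \<in> verts \<Gamma> - X \<and> {x, y} \<in> edges \<Gamma>}\<^sup>*}"

definition components_avoiding :: "'a ugraph \<Rightarrow> 'a set \<Rightarrow> 'a set set" where
  "components_avoiding \<Gamma> X = component_of_avoiding \<Gamma> X ` (verts \<Gamma> - X)"

definition is_ray :: "'a ugraph \<Rightarrow> (nat \<Rightarrow> 'a) \<Rightarrow> bool" where
  "is_ray \<Gamma> r \<longleftrightarrow> inj r \<and> range r \<subseteq> verts \<Gamma> \<and> (\<forall>n. {r n, r (Suc n)} \<in> edges \<Gamma>)"

definition tail_in :: "(nat \<Rightarrow> 'a) \<Rightarrow> 'a set \<Rightarrow> bool" where
  "tail_in r C \<longleftrightarrow> (\<exists>m. \<forall>n\<ge>m. r n \<in> C)"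

definition ray_equiv :: "'a ugraph \<Rightarrow> ((nat \<Rightarrow> 'a) \<times> (nat \<Rightarrow> 'a)) set" where
  "ray_equiv \<Gamma> =
     {(r, r'). is_ray \<Gamma> r \<and> is_ray \<Gamma> r' \<and>
        (\<forall>X. finite X \<and> X \<subseteq> verts \<Gamma> \<longrightarrow>
           (\<exists>C\<in>components_avoiding \<Gamma> X. tail_in r C \<and> tail_in r' C))}"

definition graph_ends :: "'a ugraph \<Rightarrow> (nat \<Rightarrow> 'a) set set" where
  "graph_ends \<Gamma> = {r. is_ray \<Gamma> r} // ray_equiv \<Gamma>"

definition lives_in :: "(nat \<Rightarrow> 'a) set \<Rightarrow> 'a set \<Rightarrow> bool" where
  "lives_in \<omega> C \<longleftrightarrow> (\<forall>r\<in>\<omega>. tail_in r C)"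

text \<open>
  A point of the 1-complex of \<open>\<Gamma>\<close> is given by its barycentric coordinates: its support is a
  single vertex, or an edge \<open>{u, v}\<close>, in which case it is the inner point of that edge (of length 1)
  at distance \<open>1 - p u = p v\<close> from \<open>u\<close>.
\<close>

definition bary_support :: "('a \<Rightarrow> real) \<Rightarrow> 'a set" where
  "bary_support p = {v. p v \<noteq> 0}"

definition complex_points :: "'a ugraph \<Rightarrow> ('a \<Rightarrow> real) set" where
  "complex_points \<Gamma> =
     {p. (\<forall>v. 0 \<le> p v) \<and>
         ((\<exists>v\<in>verts \<Gamma>. bary_support p = {v}) \<or> bary_support p \<in> edges \<Gamma>) \<and>
         (\<Sum>v\<in>bary_support p. p v) = 1}"

datatype 'a fpoint = Complex_Point "'a \<Rightarrow> real" | End_Point "(nat \<Rightarrow> 'a) set"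

definition vertex_point :: "'a \<Rightarrow> 'a fpoint" where
  "vertex_point v = Complex_Point (indicat_real {v})"

definition vertex_nbhd :: "'a ugraph \<Rightarrow> 'a \<Rightarrow> real \<Rightarrow> 'a fpoint set" where
  "vertex_nbhd \<Gamma> v \<epsilon> = Complex_Point ` {p \<in> complex_points \<Gamma>. 1 - p v < \<epsilon>}"

definition edge_interval :: "'a ugraph \<Rightarrow> 'a \<Rightarrow> 'a \<Rightarrow> real \<Rightarrow> real \<Rightarrow> 'a fpoint set" where
  "edge_interval \<Gamma> u v a b =
     Complex_Point ` {p \<in> complex_points \<Gamma>. bary_support p = {u, v} \<and> a < p u \<and> p u < b}"

text \<open>
  For a component \<open>C\<close> of \<open>\<Gamma> - X\<close>: all points of the subgraph \<open>C\<close>, all ends living in \<open>C\<close>, and the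
  inner points of the edges between \<open>X\<close> and \<open>C\<close> at distance less than \<open>\<epsilon>\<close> from their endpoint in \<open>C\<close>.
\<close>

definition end_nbhd :: "'a ugraph \<Rightarrow> 'a set \<Rightarrow> 'a set \<Rightarrow> real \<Rightarrow> 'a fpoint set" where
  "end_nbhd \<Gamma> X C \<epsilon> =
     Complex_Point ` {p \<in> complex_points \<Gamma>. bary_support p \<subseteq> C} \<union>
     End_Point ` {\<omega> \<in> graph_ends \<Gamma>. lives_in \<omega> C} \<union>
     Complex_Point ` {p \<in> complex_points \<Gamma>.
        \<exists>x\<in>X. \<exists>c\<in>C. bary_support p = {x, c} \<and> 1 - p c < \<epsilon>}"

text \<open>
  Diestel's topology on the 1-complex together with the ends; it is the Freudenthal compactification
  when \<open>\<Gamma>\<close> is connected and locally finite.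
\<close>

definition freudenthal_compactification :: "'a ugraph \<Rightarrow> 'a fpoint topology" where
  "freudenthal_compactification \<Gamma> = topology_generated_by
     ({vertex_nbhd \<Gamma> v \<epsilon> | v \<epsilon>. v \<in> verts \<Gamma> \<and> 0 < \<epsilon> \<and> \<epsilon> \<le> 1} \<union>
      {edge_interval \<Gamma> u v a b | u v a b. {u, v} \<in> edges \<Gamma> \<and> 0 \<le> a \<and> a < b \<and> b \<le> 1} \<union>
      {end_nbhd \<Gamma> X C \<epsilon> | X C \<epsilon>. finite X \<and> X \<subseteq> verts \<Gamma> \<and> C \<in> components_avoiding \<Gamma> X \<and>
         (\<exists>\<omega>\<in>graph_ends \<Gamma>. lives_in \<omega> C) \<and> 0 < \<epsilon> \<and> \<epsilon> \<le> 1})"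

definition hamilton_circle :: "'a ugraph \<Rightarrow> 'a fpoint set \<Rightarrow> bool" where
  "hamilton_circle \<Gamma> H \<longleftrightarrow>
     H \<subseteq> topspace (freudenthal_compactification \<Gamma>) \<and>
     subtopology (freudenthal_compactification \<Gamma>) H homeomorphic_space
       top_of_set (sphere (0::complex) 1) \<and>
     vertex_point ` verts \<Gamma> \<subseteq> H"

end

theory Submission
  imports Defs
begin

text \<open>
  Some generator \<open>a\<close> has infinite order, and adding the other generators \<open>s\<close> one at a time turns a
  Hamiltonian double ray of a subgroup \<open>H\<close> into one of \<open>\<langle>H, s\<rangle>\<close>: the cosets \<open>H s\<^sup>j\<close> form a grid with
  finitely or infinitely many rows, and such grids have Hamiltonian double rays. If some generator has
  no positive power in \<open>\<langle>a\<rangle>\<close>, the Cayley graph has one end, which closes a spanning double ray up to a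
  circle. Otherwise it has two ends. If moreover \<open>\<langle>a\<rangle> \<noteq> G\<close>, then in the last step the row \<open>H\<close> and the
  remaining rows carry two disjoint double rays joining these ends, which together form a circle.
  What is left is that every generator of infinite order generates \<open>G\<close>, so \<open>G\<close> is infinite cyclic
  with generators \<open>\<plusminus>1\<close>. There the removal of a vertex disconnects the compactification, but the
  removal of a point does not disconnect a circle.
\<close>

section \<open>Circles made of two lines\<close>

text \<open>The two cases ask for different control over the double rays. With one end, every
  spanning double ray closes up, however it runs, so a grid with infinitely many rows may be filled
  in any way. With two ends, each half of both double rays has to converge to the right end. There
  every new generator contributes only finitely many rows, and a snake sweeping column by column
  keeps its positive half on the side of the positive powers of \<open>a\<close>; this is the
  invariant \<open>sided\<close>. The pair of disjoint double rays is not extended from step to step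
  but made anew from a single spanning one of \<open>H\<close>, so the induction has to supply both.
  One end comes from two independent generators, two ends are told apart by a homomorphism to the
  integers that is positive on \<open>a\<close>. On the topological side, a continuous injection of
  the compact circle into a Hausdorff space is an embedding, so the main facts needed are that the
  compactification is Hausdorff and that the line along a double ray converges to the ends of its
  halves.\<close>

lemma half_circle_coordinates:
  fixes z :: complex
  assumes "norm z = 1" "Im z \<noteq> 0"
  shows "Im z = sgn (Im z) / sqrt (1 + (Re z / \<bar>Im z\<bar>)\<^sup>2)"
    and "Re z = (Re z / \<bar>Im z\<bar>) / sqrt (1 + (Re z / \<bar>Im z\<bar>)\<^sup>2)"
proof -
  have n: "(Re z)\<^sup>2 + (Im z)\<^sup>2 = 1"
    using assms(1) cmod_power2[of z] by simp
  have "1 + (Re z / \<bar>Im z\<bar>)\<^sup>2 = (1 / \<bar>Im z\<bar>)\<^sup>2"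
    using assms(2) n by (simp add: field_simps)
  then have r: "sqrt (1 + (Re z / \<bar>Im z\<bar>)\<^sup>2) = 1 / \<bar>Im z\<bar>"
    by simp
  show "Im z = sgn (Im z) / sqrt (1 + (Re z / \<bar>Im z\<bar>)\<^sup>2)"
    unfolding r by (simp add: sgn_mult_abs)
  show "Re z = (Re z / \<bar>Im z\<bar>) / sqrt (1 + (Re z / \<bar>Im z\<bar>)\<^sup>2)"
    unfolding r using assms(2) by simp
qed

text \<open>Central projection from 0 onto the lines \<open>Im = 1\<close> and
  \<open>Im = - 1\<close> sends each open half circle to a real line, with coordinate
  \<open>Re z / \<bar>Im z\<bar>\<close>. Its inverse takes \<open>t\<close> to
  \<open>(t, e) / sqrt (1 + t^2)\<close>; by \<open>half_circle_coordinates\<close> this recovers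
  \<open>z\<close>, which gives injectivity, and the present lemma gives surjectivity.\<close>

lemma half_circle_point:
  fixes t e :: real
  assumes "e = 1 \<or> e = -1"
  shows "\<exists>z::complex. norm z = 1 \<and> Im z * e > 0 \<and> Re z / \<bar>Im z\<bar> = t"
proof -
  have p: "sqrt (1 + t\<^sup>2) > 0" "(sqrt (1 + t\<^sup>2))\<^sup>2 = 1 + t\<^sup>2"
    using sum_power2_gt_zero_iff[of 1 t] by (simp_all add: add_pos_nonneg)
  let ?z = "Complex (t / sqrt (1 + t\<^sup>2)) (e / sqrt (1 + t\<^sup>2))"
  have e2: "e\<^sup>2 = 1" "e * e = 1" "\<bar>e\<bar> = 1" using assms by auto
  have "(t / sqrt (1 + t\<^sup>2))\<^sup>2 + (e / sqrt (1 + t\<^sup>2))\<^sup>2 = (t\<^sup>2 + 1) / (1 + t\<^sup>2)"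
    unfolding power_divide p(2) e2 by (simp add: add_divide_distrib)
  also have "\<dots> = 1" using p(1) by (simp add: field_simps)
  finally have "norm ?z = 1" by (simp add: cmod_def)
  moreover have "Im ?z * e > 0" using p(1) e2 by (simp add: field_simps)
  moreover have "Re ?z / \<bar>Im ?z\<bar> = t" using p(1) e2 by (simp add: abs_div)
  ultimately show ?thesis by blast
qed

text \<open>The points 1 and -1 go to \<open>P\<close> and \<open>Q\<close>, the upper and lower
  open half circles to the two lines by the projection followed by \<open>g True\<close> and
  \<open>g False\<close>. A continuous bijection from the compact circle onto a Hausdorff subspace
  is a homeomorphism, so only continuity takes work; at 1 and -1 it comes from the limit
  assumptions.\<close>

lemma circle_from_two_lines:
  fixes X :: "'x topology" and g :: "bool \<Rightarrow> real \<Rightarrow> 'x"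
  assumes haus: "Hausdorff_space X"
    and cont: "\<And>b. continuous_map euclideanreal X (g b)"
    and inj: "\<And>b. inj (g b)"
    and disj: "range (g True) \<inter> range (g False) = {}"
    and top: "\<And>b. limitin X (g b) P at_top"
    and bot: "\<And>b. limitin X (g b) Q at_bot"
    and PQ: "P \<noteq> Q" "\<And>b. P \<notin> range (g b)" "\<And>b. Q \<notin> range (g b)"
  shows "subtopology X (range (g True) \<union> range (g False) \<union> {P, Q}) homeomorphic_space
           top_of_set (sphere (0::complex) 1)"
proof -
  define F where "F z = (if Im z \<noteq> 0 then g (Im z > 0) (Re z / \<bar>Im z\<bar>)
      else if Re z > 0 then P else Q)" for z :: complex
  define H where "H = range (g True) \<union> range (g False) \<union> {P, Q}"
  let ?S = "sphere (0::complex) 1"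
  have HX: "H \<subseteq> topspace X"
    using cont top bot unfolding H_def limitin_def continuous_map_def by fastforce
  have img: "F ` ?S = H"
  proof
    show "F ` ?S \<subseteq> H" by (auto simp: F_def H_def) (metis (full_types) rangeI)
    have "g b t \<in> F ` ?S" for b t
    proof -
      obtain z :: complex where z: "norm z = 1" "Im z * (if b then 1 else -1) > 0" "Re z / \<bar>Im z\<bar> = t"
        using half_circle_point[of "if b then 1 else -1" t] by (metis (full_types))
      then have "F z = g b t" by (cases b) (auto simp: F_def)
      then show ?thesis using z(1) by (metis imageI mem_sphere_0)
    qed
    moreover have "F 1 = P" "F (-1) = Q" by (auto simp: F_def)
    then have "P \<in> F ` ?S" "Q \<in> F ` ?S"
      by (metis imageI mem_sphere_0 norm_one, metis imageI mem_sphere_0 norm_one norm_minus_cancel)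
    ultimately show "H \<subseteq> F ` ?S" by (auto simp: H_def)
  qed
  have real: "Re z = 1 \<or> Re z = -1" if "norm z = 1" "Im z = 0" for z
    using that cmod_eq_Re[of z] by auto
  have off: "g b t \<noteq> P" "g b t \<noteq> Q" for b t
    using PQ(2,3)[of b] by (metis rangeI)+
  have injF: "inj_on F ?S"
  proof (rule inj_onI)
    fix z w assume zw: "z \<in> ?S" "w \<in> ?S" "F z = F w"
    consider "Im z \<noteq> 0" "Im w \<noteq> 0" | "Im z = 0" "Im w = 0" | "Im z \<noteq> 0" "Im w = 0" | "Im z = 0" "Im w \<noteq> 0"
      by blast
    then show "z = w"
    proof cases
      case 1
      then have eq: "g (Im z > 0) (Re z / \<bar>Im z\<bar>) = g (Im w > 0) (Re w / \<bar>Im w\<bar>)"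
        using zw by (simp add: F_def)
      then have s: "(Im z > 0) = (Im w > 0)"
        using disj by (metis (full_types) disjoint_iff rangeI)
      then have t: "Re z / \<bar>Im z\<bar> = Re w / \<bar>Im w\<bar>"
        using eq inj[of "Im w > 0"] by (simp add: inj_eq)
      have "sgn (Im z) = sgn (Im w)" using s 1 by (auto simp: sgn_if)
      then have "Im z = Im w" "Re z = Re w"
        using half_circle_coordinates[of z] half_circle_coordinates[of w] 1 zw t
        by (metis mem_sphere_0)+
      then show ?thesis by (simp add: complex_eq_iff)
    next
      case 2
      then have "Re z = Re w"
        using zw PQ(1) real[of z] real[of w] by (auto simp: F_def split: if_splits)
      then show ?thesis using 2 by (simp add: complex_eq_iff)
    next
      case 3
      then show ?thesis using zw(3) off by (simp add: F_def split: if_splits)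
    next
      case 4
      then show ?thesis using zw(3) off[of "Im w > 0" "Re w / \<bar>Im w\<bar>"] by (simp add: F_def split: if_splits)
    qed
  qed
  have "continuous_map (top_of_set ?S) X F"
    unfolding continuous_map_eq_topcontinuous_at topcontinuous_at_def
  proof (intro ballI conjI allI impI)
    fix z assume z: "z \<in> topspace (top_of_set ?S)"
    then show "z \<in> topspace (top_of_set ?S)" .
    show "F \<in> topspace (top_of_set ?S) \<rightarrow> topspace X" using img HX by auto
    fix U assume U: "openin X U \<and> F z \<in> U"
    have "\<exists>V. open V \<and> z \<in> V \<and> (\<forall>w\<in>V \<inter> ?S. F w \<in> U)"
    proof (cases "Im z = 0")
      case False
      define e :: real where "e = sgn (Im z)"
      have W: "open {t. g (Im z > 0) t \<in> U}"
        using cont[of "Im z > 0"] U by (simp add: continuous_map_def)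
      have c: "continuous_on {w. Im w * e > 0} (\<lambda>w. Re w / \<bar>Im w\<bar>)"
        by (intro continuous_intros) auto
      have o: "open {w. Im w * e > 0}"
        by (intro open_Collect_less continuous_intros)
      have "open ({w. Im w * e > 0} \<inter> (\<lambda>w. Re w / \<bar>Im w\<bar>) -` {t. g (Im z > 0) t \<in> U})"
        by (rule continuous_open_preimage[OF c o W])
      moreover have "z \<in> {w. Im w * e > 0} \<inter> (\<lambda>w. Re w / \<bar>Im w\<bar>) -` {t. g (Im z > 0) t \<in> U}"
        using False U by (auto simp: F_def e_def sgn_if)
      moreover have "F w \<in> U"
        if "w \<in> {w. Im w * e > 0} \<inter> (\<lambda>w. Re w / \<bar>Im w\<bar>) -` {t. g (Im z > 0) t \<in> U}" for w
      proof -
        have "Im w \<noteq> 0" "(Im w > 0) = (Im z > 0)"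
          using that False by (auto simp: e_def sgn_if split: if_splits)
        then show ?thesis using that by (simp add: F_def)
      qed
      ultimately show ?thesis by blast
    next
      case True
      with real[of z] z consider "Re z = 1" | "Re z = -1" by auto
      then show ?thesis
      proof cases
        case 1
        then have "P \<in> U" using U True by (simp add: F_def)
        then have "\<forall>\<^sub>F t in at_top. g b t \<in> U" for b
          using top[of b] U by (simp add: limitin_def)
        then have "\<forall>\<^sub>F t in at_top. g True t \<in> U \<and> g False t \<in> U"
          by (simp add: eventually_conj)
        then obtain B where B: "\<And>t b. t \<ge> B \<Longrightarrow> g b t \<in> U"
          unfolding eventually_at_top_linorder by (metis (full_types))
        \<comment> \<open>An open sector around the positive real axis: off the axis it says that
          the parameter \<open>Re w / \<bar>Im w\<bar>\<close> exceeds \<open>\<bar>B\<bar>\<close>,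
          on the axis it leaves \<open>Re w > 0\<close>, where \<open>F\<close> is
          \<open>P\<close>.\<close>
        let ?V = "{w. Re w > \<bar>B\<bar> * \<bar>Im w\<bar>}"
        have "open ?V" by (intro open_Collect_less continuous_intros)
        moreover have "z \<in> ?V" using True 1 by simp
        moreover have "F w \<in> U" if "w \<in> ?V" for w
        proof (cases "Im w = 0")
          case True
          then show ?thesis using that \<open>P \<in> U\<close> by (simp add: F_def)
        next
          case False
          then have "Re w / \<bar>Im w\<bar> \<ge> \<bar>B\<bar>" using that by (simp add: field_simps)
          then show ?thesis using False B by (simp add: F_def)
        qed
        ultimately show ?thesis by blast
      next
        case 2
        then have "Q \<in> U" using U True by (simp add: F_def)
        then have "\<forall>\<^sub>F t in at_bot. g b t \<in> U" for b
          using bot[of b] U by (simp add: limitin_def)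
        then have "\<forall>\<^sub>F t in at_bot. g True t \<in> U \<and> g False t \<in> U"
          by (simp add: eventually_conj)
        then obtain B where B: "\<And>t b. t \<le> B \<Longrightarrow> g b t \<in> U"
          unfolding eventually_at_bot_linorder by (metis (full_types))
        let ?V = "{w. - Re w > \<bar>B\<bar> * \<bar>Im w\<bar>}"
        have "open ?V" by (intro open_Collect_less continuous_intros)
        moreover have "z \<in> ?V" using True 2 by simp
        moreover have "F w \<in> U" if "w \<in> ?V" for w
        proof (cases "Im w = 0")
          case True
          then show ?thesis using that \<open>Q \<in> U\<close> by (simp add: F_def)
        next
          case False
          then have "- Re w / \<bar>Im w\<bar> \<ge> \<bar>B\<bar>" using that by (simp add: field_simps)
          then have "Re w / \<bar>Im w\<bar> \<le> B" by simp
          then show ?thesis using False B by (simp add: F_def)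
        qed
        ultimately show ?thesis by blast
      qed
    qed
    then obtain V where V: "open V" "z \<in> V" "\<forall>w\<in>V \<inter> ?S. F w \<in> U" by blast
    show "\<exists>V. openin (top_of_set ?S) V \<and> z \<in> V \<and> (\<forall>y\<in>V. F y \<in> U)"
      by (rule exI[of _ "?S \<inter> V"]) (use V z in \<open>auto simp: openin_open_Int\<close>)
  qed
  then have "continuous_map (top_of_set ?S) (subtopology X H) F"
    using img by (auto simp: continuous_map_in_subtopology)
  then have "homeomorphic_map (top_of_set ?S) (subtopology X H) F"
    using haus img injF HX
    by (intro continuous_imp_homeomorphic_map)
      (auto simp: compact_space_subtopology Hausdorff_space_subtopology Int_absorb1)
  then show ?thesis
    unfolding H_def[symmetric]
    using homeomorphic_map_imp_homeomorphic_space homeomorphic_space_sym by blast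
qed

section \<open>Ends and the topology of the Freudenthal compactification\<close>

lemma eventually_avoids:
  fixes r :: "nat \<Rightarrow> 'b"
  assumes "inj r" "finite X" shows "\<forall>\<^sub>F n in sequentially. r n \<notin> X"
proof -
  have "finite (r -` X)" using assms by (simp add: finite_vimageI)
  then have "\<forall>\<^sub>F n in cofinite. r n \<notin> X" by (simp add: eventually_cofinite vimage_def)
  then show ?thesis by (simp add: cofinite_eq_sequentially)
qed

locale simple_graph =
  fixes \<Gamma> :: "'a ugraph"
  assumes edge_pair: "e \<in> edges \<Gamma> \<Longrightarrow> \<exists>u v. u \<noteq> v \<and> u \<in> verts \<Gamma> \<and> v \<in> verts \<Gamma> \<and> e = {u, v}"
begin

abbreviation "T \<equiv> freudenthal_compactification \<Gamma>"

lemma edge_verts: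
  assumes "{u, v} \<in> edges \<Gamma>" shows "u \<in> verts \<Gamma>" "v \<in> verts \<Gamma>" "u \<noteq> v"
  using edge_pair[OF assms] by (auto simp: doubleton_eq_iff)

section \<open>Components after removal of a vertex set\<close>

lemma component_subset:
  assumes "C \<in> components_avoiding \<Gamma> X" shows "C \<subseteq> verts \<Gamma> - X"
proof -
  obtain v where v: "v \<in> verts \<Gamma> - X" "C = component_of_avoiding \<Gamma> X v"
    using assms by (auto simp: components_avoiding_def)
  have "w \<in> verts \<Gamma> - X" if "w \<in> C" for w
    using that unfolding v component_of_avoiding_def mem_Collect_eq
    by (induction rule: rtrancl_induct) (use v in auto)
  then show ?thesis by blast
qed

lemma component_closed:
  assumes "C \<in> components_avoiding \<Gamma> X" "c \<in> C" "{c, y} \<in> edges \<Gamma>" "y \<notin> X"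
  shows "y \<in> C"
proof -
  obtain v where v: "C = component_of_avoiding \<Gamma> X v"
    using assms by (auto simp: components_avoiding_def)
  have "(c, y) \<in> {(x, y). x \<in> verts \<Gamma> - X \<and> y \<in> verts \<Gamma> - X \<and> {x, y} \<in> edges \<Gamma>}"
    using component_subset[OF assms(1)] assms edge_verts by auto
  then show ?thesis using assms(2) unfolding v component_of_avoiding_def
    by (auto intro: rtrancl_into_rtrancl)
qed

lemma component_of_sym:
  assumes "w \<in> component_of_avoiding \<Gamma> X v" shows "v \<in> component_of_avoiding \<Gamma> X w"
proof -
  let ?R = "{(x, y). x \<in> verts \<Gamma> - X \<and> y \<in> verts \<Gamma> - X \<and> {x, y} \<in> edges \<Gamma>}"
  have "sym ?R" by (auto simp: sym_def insert_commute)
  then show ?thesis using assms unfolding component_of_avoiding_def mem_Collect_eq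
    by (meson sym_rtrancl symD)
qed

lemma component_of_trans:
  "\<lbrakk>w \<in> component_of_avoiding \<Gamma> X v; u \<in> component_of_avoiding \<Gamma> X w\<rbrakk>
    \<Longrightarrow> u \<in> component_of_avoiding \<Gamma> X v"
  unfolding component_of_avoiding_def mem_Collect_eq by (rule rtrancl_trans)

lemma component_of_refl [simp]: "v \<in> component_of_avoiding \<Gamma> X v"
  by (simp add: component_of_avoiding_def)

lemma component_of_eq:
  "w \<in> component_of_avoiding \<Gamma> X v \<Longrightarrow> component_of_avoiding \<Gamma> X w = component_of_avoiding \<Gamma> X v"
  using component_of_sym component_of_trans by blast

lemma component_of_edge:
  assumes "{v, w} \<in> edges \<Gamma>" "v \<notin> X" "w \<notin> X"
  shows "w \<in> component_of_avoiding \<Gamma> X v"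
  using assms edge_verts[OF assms(1)] by (auto simp: component_of_avoiding_def)

lemma component_of_in: "v \<in> verts \<Gamma> - X \<Longrightarrow> component_of_avoiding \<Gamma> X v \<in> components_avoiding \<Gamma> X"
  by (simp add: components_avoiding_def)

lemma component_eq_component_of:
  "\<lbrakk>C \<in> components_avoiding \<Gamma> X; v \<in> C\<rbrakk> \<Longrightarrow> C = component_of_avoiding \<Gamma> X v"
  unfolding components_avoiding_def by (auto simp: component_of_eq)

lemma component_nonempty: "C \<in> components_avoiding \<Gamma> X \<Longrightarrow> C \<noteq> {}"
  unfolding components_avoiding_def using component_of_refl by blast

lemma component_unique:
  assumes "C \<in> components_avoiding \<Gamma> X" "D \<in> components_avoiding \<Gamma> X" "v \<in> C" "v \<in> D"
  shows "C = D"
  using assms component_eq_component_of by metis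

section \<open>Rays and ends\<close>

lemma tail_component_unique:
  assumes "C \<in> components_avoiding \<Gamma> X" "D \<in> components_avoiding \<Gamma> X" "tail_in r C" "tail_in r D"
  shows "C = D"
proof -
  obtain m n where "\<forall>k\<ge>m. r k \<in> C" "\<forall>k\<ge>n. r k \<in> D"
    using assms by (auto simp: tail_in_def)
  then have "r (max m n) \<in> C" "r (max m n) \<in> D" by auto
  then show ?thesis using component_unique assms by blast
qed

lemma ray_tail_component:
  assumes "is_ray \<Gamma> r" "finite X"
  shows "\<exists>C\<in>components_avoiding \<Gamma> X. tail_in r C"
proof -
  obtain m where m: "\<And>n. n \<ge> m \<Longrightarrow> r n \<notin> X"
    using eventually_avoids[of r X] assms by (auto simp: is_ray_def eventually_sequentially)
  have "r n \<in> component_of_avoiding \<Gamma> X (r m)" if "n \<ge> m" for n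
    using that
  proof (induction rule: dec_induct)
    case (step n)
    have "r (Suc n) \<in> component_of_avoiding \<Gamma> X (r n)"
      using component_of_edge[of "r n" "r (Suc n)" X] m[of n] m[of "Suc n"] step assms
      by (auto simp: is_ray_def)
    then show ?case using step component_of_trans by blast
  qed simp
  moreover have "r m \<in> verts \<Gamma> - X" using m assms by (auto simp: is_ray_def)
  ultimately show ?thesis unfolding tail_in_def using component_of_in by blast
qed

lemma equiv_ray_equiv: "equiv {r. is_ray \<Gamma> r} (ray_equiv \<Gamma>)"
proof (rule equivI)
  show "ray_equiv \<Gamma> \<subseteq> {r. is_ray \<Gamma> r} \<times> {r. is_ray \<Gamma> r}" by (auto simp: ray_equiv_def)
  show "refl_on {r. is_ray \<Gamma> r} (ray_equiv \<Gamma>)"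
    using ray_tail_component by (auto simp: refl_on_def ray_equiv_def)
  show "sym (ray_equiv \<Gamma>)" by (fastforce simp: sym_def ray_equiv_def)
  show "trans (ray_equiv \<Gamma>)"
  proof (rule transI)
    fix r s t assume rs: "(r, s) \<in> ray_equiv \<Gamma>" and st: "(s, t) \<in> ray_equiv \<Gamma>"
    have "\<exists>C\<in>components_avoiding \<Gamma> X. tail_in r C \<and> tail_in t C" if X: "finite X" "X \<subseteq> verts \<Gamma>" for X
    proof -
      obtain C where C: "C \<in> components_avoiding \<Gamma> X" "tail_in r C" "tail_in s C"
        using rs X unfolding ray_equiv_def by blast
      obtain D where D: "D \<in> components_avoiding \<Gamma> X" "tail_in s D" "tail_in t D"
        using st X unfolding ray_equiv_def by blast
      have "C = D" using tail_component_unique C D by blast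
      then show ?thesis using C D by blast
    qed
    then show "(r, t) \<in> ray_equiv \<Gamma>" using rs st by (simp add: ray_equiv_def)
  qed
qed

abbreviation "end_of r \<equiv> ray_equiv \<Gamma> `` {r}"

lemma end_of_in: "is_ray \<Gamma> r \<Longrightarrow> end_of r \<in> graph_ends \<Gamma>"
  by (simp add: graph_ends_def quotientI)

lemma graph_endE:
  assumes "\<omega> \<in> graph_ends \<Gamma>" obtains r where "is_ray \<Gamma> r" "\<omega> = end_of r"
  using assms unfolding graph_ends_def by (auto elim: quotientE)

lemma end_of_eq_iff:
  "\<lbrakk>is_ray \<Gamma> r; is_ray \<Gamma> s\<rbrakk> \<Longrightarrow> end_of r = end_of s \<longleftrightarrow> (r, s) \<in> ray_equiv \<Gamma>"
  using eq_equiv_class_iff[OF equiv_ray_equiv] by simp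

text \<open>Equivalent rays have tails in the same component, and a ray has its tail in only one; so
  a single representative decides where the whole end lives.\<close>

lemma lives_in_end_of:
  assumes r: "is_ray \<Gamma> r" and X: "finite X" "X \<subseteq> verts \<Gamma>" and C: "C \<in> components_avoiding \<Gamma> X"
  shows "lives_in (end_of r) C \<longleftrightarrow> tail_in r C"
proof
  assume "lives_in (end_of r) C"
  moreover have "r \<in> end_of r" using equiv_class_self[OF equiv_ray_equiv] r by simp
  ultimately show "tail_in r C" unfolding lives_in_def by blast
next
  assume t: "tail_in r C"
  show "lives_in (end_of r) C"
    unfolding lives_in_def
  proof
    fix s assume "s \<in> end_of r"
    then obtain D where "D \<in> components_avoiding \<Gamma> X" "tail_in r D" "tail_in s D"
      using X by (auto simp: ray_equiv_def)
    then show "tail_in s C" using tail_component_unique C t by blast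
  qed
qed

lemma end_component:
  assumes "\<omega> \<in> graph_ends \<Gamma>" "finite X" "X \<subseteq> verts \<Gamma>"
  shows "\<exists>C\<in>components_avoiding \<Gamma> X. lives_in \<omega> C"
proof -
  obtain r where r: "is_ray \<Gamma> r" "\<omega> = end_of r" using assms(1) by (rule graph_endE)
  then obtain C where "C \<in> components_avoiding \<Gamma> X" "tail_in r C"
    using ray_tail_component assms(2) by blast
  then show ?thesis using lives_in_end_of[OF r(1) assms(2,3)] r(2) by blast
qed

section \<open>Generating open sets and barycentric coordinates\<close>

lemma openin_vertex_nbhd:
  "\<lbrakk>v \<in> verts \<Gamma>; 0 < \<epsilon>; \<epsilon> \<le> 1\<rbrakk> \<Longrightarrow> openin T (vertex_nbhd \<Gamma> v \<epsilon>)"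
  unfolding freudenthal_compactification_def
  by (rule topology_generated_by_Basis, rule UnI1, rule UnI1, rule CollectI, blast)

lemma openin_edge_interval:
  "\<lbrakk>{u, v} \<in> edges \<Gamma>; 0 \<le> a; a < b; b \<le> 1\<rbrakk> \<Longrightarrow> openin T (edge_interval \<Gamma> u v a b)"
  unfolding freudenthal_compactification_def
  by (rule topology_generated_by_Basis, rule UnI1, rule UnI2, rule CollectI, blast)

lemma openin_end_nbhd:
  "\<lbrakk>finite X; X \<subseteq> verts \<Gamma>; C \<in> components_avoiding \<Gamma> X; \<omega> \<in> graph_ends \<Gamma>; lives_in \<omega> C; 0 < \<epsilon>; \<epsilon> \<le> 1\<rbrakk>
    \<Longrightarrow> openin T (end_nbhd \<Gamma> X C \<epsilon>)"
  unfolding freudenthal_compactification_def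
  by (rule topology_generated_by_Basis, rule UnI2, rule CollectI, blast)

lemma complex_point_cases:
  assumes "p \<in> complex_points \<Gamma>"
  obtains (vertex) v where "v \<in> verts \<Gamma>" "bary_support p = {v}" "p = indicat_real {v}"
  | (edge) u v where "{u, v} \<in> edges \<Gamma>" "u \<noteq> v" "bary_support p = {u, v}" "p u + p v = 1" "p u > 0" "p v > 0"
proof -
  have p: "\<And>v. 0 \<le> p v" "(\<exists>v\<in>verts \<Gamma>. bary_support p = {v}) \<or> bary_support p \<in> edges \<Gamma>"
    "(\<Sum>v\<in>bary_support p. p v) = 1"
    using assms by (auto simp: complex_points_def)
  from p(2) show ?thesis
  proof
    assume "\<exists>v\<in>verts \<Gamma>. bary_support p = {v}"
    then obtain v where v: "v \<in> verts \<Gamma>" "bary_support p = {v}" by blast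
    then have "p v = 1" "\<And>w. w \<noteq> v \<Longrightarrow> p w = 0" using p(3) by (auto simp: bary_support_def)
    then have "p = indicat_real {v}" by (auto simp: indicator_def)
    then show ?thesis using v vertex by blast
  next
    assume e: "bary_support p \<in> edges \<Gamma>"
    then obtain u v where uv: "u \<noteq> v" "bary_support p = {u, v}" using edge_pair by blast
    then have "p u \<noteq> 0" "p v \<noteq> 0" by (auto simp: bary_support_def)
    then have "p u > 0" "p v > 0" using p(1) by (simp_all add: order_le_neq_trans)
    then show ?thesis using e uv p(3) edge[of u v] by simp
  qed
qed

lemma complex_point_bounds:
  assumes "p \<in> complex_points \<Gamma>"
  shows "0 \<le> p v" "p v \<le> 1" "v \<noteq> w \<Longrightarrow> p v + p w \<le> 1"
proof -
  show 0: "0 \<le> p v" for v using assms by (auto simp: complex_points_def)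
  have z: "p w = 0 \<longleftrightarrow> w \<notin> bary_support p" for w by (simp add: bary_support_def)
  show 1: "p v + p w \<le> 1" if "v \<noteq> w" for v w
    using assms
  proof (cases rule: complex_point_cases)
    case vertex then show ?thesis using that by (auto simp: indicator_def)
  next
    case (edge a b)
    have "p x = 0" if "x \<noteq> a" "x \<noteq> b" for x using that z[of x] edge(3) by blast
    then show ?thesis using that edge(4-6) by (cases "v = a"; cases "v = b"; cases "w = a"; cases "w = b") simp_all
  qed
  show "p v \<le> 1"
    using assms
  proof (cases rule: complex_point_cases)
    case vertex then show ?thesis by (auto simp: indicator_def)
  next
    case (edge a b)
    have "p v = 0" if "v \<noteq> a" "v \<noteq> b" using that z[of v] edge(3) by blast
    then show ?thesis using edge(4-6) by (cases "v = a"; cases "v = b") simp_all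
  qed
qed

lemma vertex_indicator_in: "v \<in> verts \<Gamma> \<Longrightarrow> indicat_real {v} \<in> complex_points \<Gamma>"
proof -
  have s: "bary_support (indicat_real {v}) = {v}" by (auto simp: bary_support_def indicator_def)
  assume "v \<in> verts \<Gamma>"
  then show ?thesis unfolding complex_points_def mem_Collect_eq s by simp
qed

lemma topspace_T: "topspace T = Complex_Point ` complex_points \<Gamma> \<union> End_Point ` graph_ends \<Gamma>" (is "_ = ?R")
proof
  show "topspace T \<subseteq> ?R"
    unfolding freudenthal_compactification_def topology_generated_by_topspace
    by (auto simp: vertex_nbhd_def edge_interval_def end_nbhd_def)
  have "Complex_Point p \<in> topspace T" if "p \<in> complex_points \<Gamma>" for p
    using that
  proof (cases rule: complex_point_cases)
    case (vertex v)
    then have "Complex_Point p \<in> vertex_nbhd \<Gamma> v 1" using that by (auto simp: vertex_nbhd_def)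
    then show ?thesis using openin_vertex_nbhd[of v 1] vertex openin_subset by fastforce
  next
    case (edge u v)
    then have "Complex_Point p \<in> edge_interval \<Gamma> u v 0 1" using that by (auto simp: edge_interval_def)
    then show ?thesis using openin_edge_interval[of u v 0 1] edge openin_subset by fastforce
  qed
  moreover have "End_Point \<omega> \<in> topspace T" if w: "\<omega> \<in> graph_ends \<Gamma>" for \<omega>
  proof -
    obtain C where C: "C \<in> components_avoiding \<Gamma> {}" "lives_in \<omega> C"
      using end_component[OF w, of "{}"] by blast
    then have "End_Point \<omega> \<in> end_nbhd \<Gamma> {} C 1" using w by (auto simp: end_nbhd_def)
    then show ?thesis using openin_end_nbhd[of "{}" C \<omega> 1] C w openin_subset by fastforce
  qed
  ultimately show "?R \<subseteq> topspace T" by blast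
qed

text \<open>Ends get coordinate 0 because they have neighbourhoods on which the weight of
  \<open>v\<close> is arbitrarily small. With this value the coordinates are continuous on
  \<open>T\<close>, and they separate any two points of which at least one is not an end.\<close>

definition coord :: "'a \<Rightarrow> 'a fpoint \<Rightarrow> real" where
  "coord v x = (case x of Complex_Point p \<Rightarrow> p v | End_Point _ \<Rightarrow> 0)"

lemma coord_simps [simp]: "coord v (Complex_Point p) = p v" "coord v (End_Point \<omega>) = 0"
  by (simp_all add: coord_def)

text \<open>An edge at a vertex \<open>c\<close> of \<open>C\<close> ends in \<open>C\<close> or in
  \<open>X\<close>; in the latter case the weight at \<open>x\<close> is \<open>1 - p c\<close>.
  This turns end neighbourhoods into strict inequalities for coordinates, the form in which openness
  and disjointness are checked later.\<close>

lemma complex_point_in_end_nbhd_iff: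
  assumes C: "C \<in> components_avoiding \<Gamma> X" and e: "0 < \<epsilon>" "\<epsilon> \<le> 1" and p: "p \<in> complex_points \<Gamma>"
  shows "Complex_Point p \<in> end_nbhd \<Gamma> X C \<epsilon> \<longleftrightarrow> (\<exists>c\<in>C. p c > 0) \<and> (\<forall>x\<in>X. p x < \<epsilon>)"
proof -
  have z: "p w = 0 \<longleftrightarrow> w \<notin> bary_support p" for w by (simp add: bary_support_def)
  have CX: "C \<inter> X = {}" using component_subset[OF C] by blast
  have iff: "Complex_Point p \<in> end_nbhd \<Gamma> X C \<epsilon> \<longleftrightarrow>
     bary_support p \<subseteq> C \<or> (\<exists>x\<in>X. \<exists>c\<in>C. bary_support p = {x, c} \<and> 1 - p c < \<epsilon>)"
    using p unfolding end_nbhd_def by (simp add: image_iff)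
  show ?thesis
    using p
  proof (cases rule: complex_point_cases)
    case (vertex v)
    have "\<not> (\<exists>x\<in>X. \<exists>c\<in>C. bary_support p = {x, c} \<and> 1 - p c < \<epsilon>)"
      using vertex CX by auto
    then show ?thesis unfolding iff using vertex CX e by (auto simp: indicator_def)
  next
    case (edge u v)
    have cl: "\<lbrakk>u \<in> C; v \<notin> X\<rbrakk> \<Longrightarrow> v \<in> C" "\<lbrakk>v \<in> C; u \<notin> X\<rbrakk> \<Longrightarrow> u \<in> C"
      using component_closed[OF C] edge(1) by (auto simp: insert_commute)
    have zero: "p w = 0" if "w \<noteq> u" "w \<noteq> v" for w using z[of w] edge(3) that by blast
    then have pos: "p w > 0 \<longleftrightarrow> w = u \<or> w = v" for w
      using edge(5,6) by (cases "w = u"; cases "w = v") simp_all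
    show ?thesis
    proof
      assume "Complex_Point p \<in> end_nbhd \<Gamma> X C \<epsilon>"
      then consider "bary_support p \<subseteq> C" | x c where "x \<in> X" "c \<in> C" "bary_support p = {x, c}" "1 - p c < \<epsilon>"
        unfolding iff by blast
      then show "(\<exists>c\<in>C. p c > 0) \<and> (\<forall>x\<in>X. p x < \<epsilon>)"
      proof cases
        case 1
        then show ?thesis using edge(3,5) CX e(1) zero by (metis disjoint_iff insert_subset)
      next
        case 2
        then have "(x = u \<and> c = v) \<or> (x = v \<and> c = u)" using edge by (auto simp: doubleton_eq_iff)
        moreover have "p y < \<epsilon>" if "y \<in> X" for y
        proof (cases "y = x")
          case True
          then show ?thesis using 2 edge(4) calculation by auto
        next
          case False
          then have "p y = 0" using that 2 CX zero[of y] calculation by auto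
          then show ?thesis using e by simp
        qed
        ultimately show ?thesis using 2 edge by auto
      qed
    next
      assume R: "(\<exists>c\<in>C. p c > 0) \<and> (\<forall>x\<in>X. p x < \<epsilon>)"
      then have "u \<in> C \<or> v \<in> C" using pos by auto
      moreover have "u \<in> C \<Longrightarrow> v \<in> C \<or> (v \<in> X \<and> 1 - p u < \<epsilon>)" "v \<in> C \<Longrightarrow> u \<in> C \<or> (u \<in> X \<and> 1 - p v < \<epsilon>)"
        using cl R edge(4) by force+
      ultimately show "Complex_Point p \<in> end_nbhd \<Gamma> X C \<epsilon>"
        unfolding iff edge(3) by (auto simp: insert_commute)
    qed
  qed
qed

text \<open>For \<open>0 \<le> a < 1\<close> and a vertex \<open>v\<close> this is the generating
  set \<open>vertex_nbhd \<Gamma> v (1 - a)\<close>; otherwise it is everything or empty.\<close>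

lemma openin_coord_gt: "openin T {x \<in> topspace T. coord v x > a}"
proof -
  consider "a < 0" | "0 \<le> a" "a < 1" "v \<in> verts \<Gamma>" | "0 \<le> a" "1 \<le> a \<or> v \<notin> verts \<Gamma>" by linarith
  then show ?thesis
  proof cases
    case 1
    have "coord v x > a" if "x \<in> topspace T" for x
      using that 1 complex_point_bounds(1)[of _ v] unfolding topspace_T by force
    then have "{x \<in> topspace T. coord v x > a} = topspace T" by blast
    then show ?thesis by (metis openin_topspace)
  next
    case 2
    have "{x \<in> topspace T. coord v x > a} = vertex_nbhd \<Gamma> v (1 - a)"
      unfolding topspace_T vertex_nbhd_def using 2 by auto
    then show ?thesis using openin_vertex_nbhd[of v "1 - a"] 2 by simp
  next
    case 3
    have "coord v x \<le> a" if "x \<in> topspace T" for x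
    proof (cases x)
      case (Complex_Point p)
      then have p: "p \<in> complex_points \<Gamma>" using that unfolding topspace_T by auto
      have "p v \<le> 1" using complex_point_bounds[OF p] by blast
      moreover have "p v = 0" if "v \<notin> verts \<Gamma>"
        using p
      proof (cases rule: complex_point_cases)
        case (vertex u) then show ?thesis using that by (auto simp: indicator_def)
      next
        case (edge u w)
        then have "v \<notin> bary_support p" using that edge_verts[OF edge(1)] by auto
        then show ?thesis by (simp add: bary_support_def)
      qed
      ultimately show ?thesis using 3 Complex_Point by auto
    qed (use 3 in simp)
    then have "{x \<in> topspace T. coord v x > a} = {}" by force
    then show ?thesis by (metis openin_empty)
  qed
qed

text \<open>Unlike the superlevel sets, these are not generating sets, so a neighbourhood is found
  for each point: a ball of radius \<open>b\<close> at a vertex other than \<open>v\<close> (the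
  weights sum to 1), an interval on an open edge, and at an end a component avoiding
  \<open>v\<close>.\<close>

lemma openin_coord_lt:
  assumes "0 < b" "b \<le> 1" shows "openin T {x \<in> topspace T. coord v x < b}"
proof (subst openin_subopen, intro ballI)
  fix x assume x: "x \<in> {x \<in> topspace T. coord v x < b}"
  show "\<exists>U. openin T U \<and> x \<in> U \<and> U \<subseteq> {x \<in> topspace T. coord v x < b}"
  proof (cases x)
    case (Complex_Point p)
    then have p: "p \<in> complex_points \<Gamma>" "p v < b" using x by (auto simp: topspace_T)
    show ?thesis using p(1)
    proof (cases rule: complex_point_cases)
      case (vertex w)
      then have "w \<noteq> v" using p(2) assms by auto
      have "openin T (vertex_nbhd \<Gamma> w b)" using openin_vertex_nbhd vertex assms by blast
      moreover have "x \<in> vertex_nbhd \<Gamma> w b"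
        using vertex p Complex_Point assms by (auto simp: vertex_nbhd_def)
      moreover have "q v < b" if "q \<in> complex_points \<Gamma>" "1 - q w < b" for q
        using complex_point_bounds(3)[OF that(1) \<open>w \<noteq> v\<close>] that(2) by simp
      then have "vertex_nbhd \<Gamma> w b \<subseteq> {x \<in> topspace T. coord v x < b}"
        unfolding vertex_nbhd_def topspace_T by auto
      ultimately show ?thesis by blast
    next
      case (edge u w)
      have *: ?thesis if e: "{u, w} \<in> edges \<Gamma>" "bary_support p = {u, w}" "p u + p w = 1" "p u > 0" "p w > 0"
        "v \<noteq> w" for u w
      proof -
        \<comment> \<open>An interval bounds only the coordinate of its first endpoint, which
          matters if that endpoint is \<open>v\<close>. The case \<open>v = w\<close> is reduced to
          this one by swapping the endpoints.\<close>
        let ?c = "if v = u then b else 1"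
        have 1: "openin T (edge_interval \<Gamma> u w 0 ?c)"
          using openin_edge_interval[OF e(1)] assms by auto
        have 2: "x \<in> edge_interval \<Gamma> u w 0 ?c"
          using e Complex_Point p by (auto simp: edge_interval_def)
        have "q v < b" if "q \<in> complex_points \<Gamma>" "bary_support q = {u, w}" "q u < ?c" for q
        proof (cases "v = u")
          case False
          then have "v \<notin> bary_support q" using e(6) that(2) by simp
          then show ?thesis using assms by (simp add: bary_support_def)
        qed (use that in simp)
        then have "edge_interval \<Gamma> u w 0 ?c \<subseteq> {x \<in> topspace T. coord v x < b}"
          unfolding edge_interval_def topspace_T by auto
        then show ?thesis using 1 2 by blast
      qed
      show ?thesis
      proof (cases "v = w")
        case True
        then show ?thesis using *[of w u] edge by (simp add: insert_commute add.commute)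
      next
        case False
        then show ?thesis using *[of u w] edge by simp
      qed
    qed
  next
    case (End_Point \<omega>)
    then have w: "\<omega> \<in> graph_ends \<Gamma>" using x by (auto simp: topspace_T)
    \<comment> \<open>\<open>v\<close> is an arbitrary element of the type, so the deleted set is
      empty if \<open>v\<close> is not a vertex.\<close>
    let ?X = "{v} \<inter> verts \<Gamma>"
    obtain C where C: "C \<in> components_avoiding \<Gamma> ?X" "lives_in \<omega> C"
      using end_component[OF w, of ?X] by auto
    have o: "openin T (end_nbhd \<Gamma> ?X C b)" using openin_end_nbhd[OF _ _ C(1) w C(2)] assms by auto
    have "x \<in> end_nbhd \<Gamma> ?X C b" using End_Point w C by (auto simp: end_nbhd_def)
    moreover have "coord v y < b" if y: "y \<in> end_nbhd \<Gamma> ?X C b" for y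
    proof (cases y)
      case (Complex_Point q)
      have yT: "y \<in> topspace T" using openin_subset[OF o] y by blast
      then have q: "q \<in> complex_points \<Gamma>" using Complex_Point by (auto simp: topspace_T)
      show ?thesis
      proof (cases "v \<in> verts \<Gamma>")
        case True
        then show ?thesis using complex_point_in_end_nbhd_iff[OF C(1) assms q] y Complex_Point by auto
      next
        case False
        have "\<not> coord v y > 0"
        proof
          assume "coord v y > 0"
          have "bary_support q \<subseteq> verts \<Gamma>"
            using q by (cases rule: complex_point_cases) (auto dest: edge_verts)
          then show False using False \<open>coord v y > 0\<close> Complex_Point by (auto simp: bary_support_def subset_iff)
        qed
        then show ?thesis using assms by simp
      qed
    qed (use assms in simp)
    then have "end_nbhd \<Gamma> ?X C b \<subseteq> {x \<in> topspace T. coord v x < b}"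
      using openin_subset[OF o] by blast
    ultimately show ?thesis using o by blast
  qed
qed

section \<open>The compactification is Hausdorff\<close>

lemma end_neq_separated:
  assumes "\<omega> \<in> graph_ends \<Gamma>" "\<omega>' \<in> graph_ends \<Gamma>" "\<omega> \<noteq> \<omega>'"
  obtains X C D where "finite X" "X \<subseteq> verts \<Gamma>" "C \<in> components_avoiding \<Gamma> X"
    "D \<in> components_avoiding \<Gamma> X" "lives_in \<omega> C" "lives_in \<omega>' D" "C \<inter> D = {}"
proof -
  obtain r s where r: "is_ray \<Gamma> r" "\<omega> = end_of r" and s: "is_ray \<Gamma> s" "\<omega>' = end_of s"
    using assms by (metis graph_endE)
  then have "(r, s) \<notin> ray_equiv \<Gamma>" using assms(3) end_of_eq_iff by blast
  then obtain X where X: "finite X" "X \<subseteq> verts \<Gamma>"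
    "\<And>C. C \<in> components_avoiding \<Gamma> X \<Longrightarrow> \<not> (tail_in r C \<and> tail_in s C)"
    using r s unfolding ray_equiv_def by blast
  obtain C where C: "C \<in> components_avoiding \<Gamma> X" "tail_in r C" using ray_tail_component r X by blast
  obtain D where D: "D \<in> components_avoiding \<Gamma> X" "tail_in s D" using ray_tail_component s X by blast
  have "C \<noteq> D" using X(3) C D by blast
  then have "C \<inter> D = {}" using component_unique C D by blast
  moreover have "lives_in \<omega> C" "lives_in \<omega>' D"
    using lives_in_end_of[OF r(1) X(1,2) C(1)] lives_in_end_of[OF s(1) X(1,2) D(1)] C D r s by auto
  ultimately show ?thesis using that X C D by blast
qed

text \<open>A point of the complex in both sets would have positive weight on some \<open>c\<close>
  in \<open>C\<close> and some \<open>d\<close> in \<open>D\<close>, hence lie inside an edge from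
  \<open>C\<close> to \<open>D\<close>, which would merge the two components. An end cannot live in
  two different components.\<close>

lemma end_nbhds_disjoint:
  assumes C: "C \<in> components_avoiding \<Gamma> X" and D: "D \<in> components_avoiding \<Gamma> X" and CD: "C \<inter> D = {}"
    and X: "finite X" "X \<subseteq> verts \<Gamma>"
  shows "end_nbhd \<Gamma> X C 1 \<inter> end_nbhd \<Gamma> X D 1 = {}"
proof -
  have "y \<notin> end_nbhd \<Gamma> X D 1" if y: "y \<in> end_nbhd \<Gamma> X C 1" for y
  proof (cases y)
    case (Complex_Point p)
    then have p: "p \<in> complex_points \<Gamma>" using y by (auto simp: end_nbhd_def)
    show ?thesis
    proof
      assume "y \<in> end_nbhd \<Gamma> X D 1"
      then obtain c d where cd: "c \<in> C" "d \<in> D" "p c > 0" "p d > 0" "\<And>x. x \<in> X \<Longrightarrow> p x < 1"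
        using y Complex_Point complex_point_in_end_nbhd_iff[OF C _ _ p, of 1]
          complex_point_in_end_nbhd_iff[OF D _ _ p, of 1] by auto
      then have "c \<noteq> d" using CD by blast
      have cd': "c \<in> bary_support p" "d \<in> bary_support p" using cd(3,4) by (simp_all add: bary_support_def)
      from p show False
      proof (cases rule: complex_point_cases)
        case (vertex v)
        then show ?thesis using cd' \<open>c \<noteq> d\<close> by simp
      next
        case (edge u v)
        have "c \<in> {u, v}" "d \<in> {u, v}" using cd' edge(3) by simp_all
        then have "{c, d} = {u, v}" using \<open>c \<noteq> d\<close> by blast
        then have "{c, d} \<in> edges \<Gamma>" using edge(1) by simp
        moreover have "d \<notin> X" using component_subset[OF D] cd by blast
        ultimately have "d \<in> C" using component_closed[OF C cd(1)] by blast
        then show ?thesis using CD cd(2) by blast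
      qed
    qed
  next
    case (End_Point \<eta>)
    then have e: "\<eta> \<in> graph_ends \<Gamma>" "lives_in \<eta> C" using y by (auto simp: end_nbhd_def)
    obtain r where r: "is_ray \<Gamma> r" "\<eta> = end_of r" using e(1) by (rule graph_endE)
    have "\<not> lives_in \<eta> D"
    proof
      assume "lives_in \<eta> D"
      then have "tail_in r C" "tail_in r D" using e r lives_in_end_of[OF r(1) X] C D by auto
      then have "C = D" using tail_component_unique C D by blast
      then have "C = {}" using CD by blast
      then show False using \<open>tail_in r C\<close> by (auto simp: tail_in_def)
    qed
    then show ?thesis using End_Point by (auto simp: end_nbhd_def)
  qed
  then show ?thesis by blast
qed

text \<open>A point of the complex has a positive coordinate somewhere while ends have none, so some
  coordinate separates every pair except two ends; for these, \<open>end_neq_separated\<close>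
  supplies disjoint components.\<close>

lemma Hausdorff_T: "Hausdorff_space T"
  unfolding Hausdorff_space_def disjnt_def
proof (intro allI impI)
  fix x y assume xy: "x \<in> topspace T \<and> y \<in> topspace T \<and> x \<noteq> y"
  show "\<exists>U V. openin T U \<and> openin T V \<and> x \<in> U \<and> y \<in> V \<and> U \<inter> V = {}"
  proof (cases "\<exists>v. coord v x \<noteq> coord v y")
    case True
    have *: "\<exists>U V. openin T U \<and> openin T V \<and> x \<in> U \<and> y \<in> V \<and> U \<inter> V = {}"
      if "coord v x < coord v y" "x \<in> topspace T" "y \<in> topspace T" for v x y
    proof -
      define m where "m = (coord v x + coord v y) / 2"
      have b: "0 \<le> coord v z \<and> coord v z \<le> 1" if "z \<in> topspace T" for z
        using that complex_point_bounds(1,2)[of _ v] unfolding topspace_T by auto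
      have m: "0 < m" "m \<le> 1" "coord v x < m" "m < coord v y"
        using that b[of x] b[of y] by (auto simp: m_def)
      show ?thesis
        using openin_coord_lt[OF m(1,2), of v] openin_coord_gt[of m v] m that by force
    qed
    from True obtain v where "coord v x < coord v y \<or> coord v y < coord v x" by (meson linorder_neqE)
    then show ?thesis using *[of v x y] *[of v y x] xy by (metis Int_commute)
  next
    case False
    show ?thesis
    proof (cases x; cases y)
      fix p q assume "x = Complex_Point p" "y = Complex_Point q"
      then show ?thesis using False xy by (auto simp: fun_eq_iff)
    next
      have *: "\<exists>v. p v > 0" if "p \<in> complex_points \<Gamma>" for p
        using that by (cases rule: complex_point_cases) (auto simp: indicator_def)
      { fix p \<omega> assume "x = Complex_Point p" "y = End_Point \<omega>"
        then show ?thesis using False xy *[of p] by (auto simp: topspace_T)  }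
      { fix p \<omega> assume "y = Complex_Point p" "x = End_Point \<omega>"
        then show ?thesis using False xy *[of p] by (auto simp: topspace_T)  }
    next
      fix \<omega> \<eta> assume e: "x = End_Point \<omega>" "y = End_Point \<eta>"
      then have w: "\<omega> \<in> graph_ends \<Gamma>" "\<eta> \<in> graph_ends \<Gamma>" "\<omega> \<noteq> \<eta>" using xy by (auto simp: topspace_T)
      obtain X C D where X: "finite X" "X \<subseteq> verts \<Gamma>" and C: "C \<in> components_avoiding \<Gamma> X"
        and D: "D \<in> components_avoiding \<Gamma> X" and l: "lives_in \<omega> C" "lives_in \<eta> D" and CD: "C \<inter> D = {}"
        using end_neq_separated[OF w] by blast
      have "openin T (end_nbhd \<Gamma> X C 1)" "openin T (end_nbhd \<Gamma> X D 1)"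
        using openin_end_nbhd[OF X] C D l w by auto
      moreover have "x \<in> end_nbhd \<Gamma> X C 1" "y \<in> end_nbhd \<Gamma> X D 1"
        using e w l by (auto simp: end_nbhd_def)
      ultimately show ?thesis using end_nbhds_disjoint[OF C D CD X] by blast
    qed
  qed
qed

text \<open>On the complex every generating set is cut out by finitely many strict coordinate
  inequalities, up to a union over the vertices of \<open>C\<close> for \<open>end_nbhd\<close>; so
  continuity of each coordinate suffices.\<close>

lemma continuous_map_into_complex:
  fixes f :: "'x::topological_space \<Rightarrow> 'a \<Rightarrow> real"
  assumes cp: "\<And>t. f t \<in> complex_points \<Gamma>" and cont: "\<And>v. continuous_on UNIV (\<lambda>t. f t v)"
  shows "continuous_map euclidean T (\<lambda>t. Complex_Point (f t))"
  unfolding freudenthal_compactification_def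
proof (rule continuous_on_generated_topo)
  have gt: "open {t. f t v > a}" and lt: "open {t. f t v < a}" for v a
    by (intro open_Collect_less cont continuous_on_const)+
  fix U assume "U \<in> {vertex_nbhd \<Gamma> v \<epsilon> | v \<epsilon>. v \<in> verts \<Gamma> \<and> 0 < \<epsilon> \<and> \<epsilon> \<le> 1} \<union>
      {edge_interval \<Gamma> u v a b | u v a b. {u, v} \<in> edges \<Gamma> \<and> 0 \<le> a \<and> a < b \<and> b \<le> 1} \<union>
      {end_nbhd \<Gamma> X C \<epsilon> | X C \<epsilon>. finite X \<and> X \<subseteq> verts \<Gamma> \<and> C \<in> components_avoiding \<Gamma> X \<and>
         (\<exists>\<omega>\<in>graph_ends \<Gamma>. lives_in \<omega> C) \<and> 0 < \<epsilon> \<and> \<epsilon> \<le> 1}"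
  then consider (v) v \<epsilon> where "U = vertex_nbhd \<Gamma> v \<epsilon>"
    | (e) u v a b where "U = edge_interval \<Gamma> u v a b" "{u, v} \<in> edges \<Gamma>" "0 \<le> a" "a < b" "b \<le> 1"
    | (w) X C \<epsilon> where "U = end_nbhd \<Gamma> X C \<epsilon>" "finite X" "C \<in> components_avoiding \<Gamma> X" "0 < \<epsilon>" "\<epsilon> \<le> 1"
    by blast
  then have "open {t. Complex_Point (f t) \<in> U}"
  proof cases
    case v
    have "{t. Complex_Point (f t) \<in> U} = {t. f t v > 1 - \<epsilon>}"
      using cp by (auto simp: v vertex_nbhd_def)
    then show ?thesis using gt by simp
  next
    case e
    have s: "bary_support (f t) = {u, v} \<longleftrightarrow> f t u > 0 \<and> f t v > 0" for t
    proof
      assume "bary_support (f t) = {u, v}"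
      then have "f t u \<noteq> 0" "f t v \<noteq> 0" by (auto simp: bary_support_def)
      then show "f t u > 0 \<and> f t v > 0" using complex_point_bounds(1)[OF cp[of t]] by (simp add: less_le)
    next
      assume p: "f t u > 0 \<and> f t v > 0"
      have "u \<in> bary_support (f t)" "v \<in> bary_support (f t)" using p by (auto simp: bary_support_def)
      with cp[of t] show "bary_support (f t) = {u, v}"
        using edge_verts(3)[OF e(2)] by (cases rule: complex_point_cases) auto
    qed
    have "{t. Complex_Point (f t) \<in> U} = {t. f t u > 0} \<inter> {t. f t v > 0} \<inter> {t. f t u > a} \<inter> {t. f t u < b}"
      using cp s by (auto simp: e(1) edge_interval_def)
    then show ?thesis using gt lt by (simp add: open_Int)
  next
    case w
    have "{t. Complex_Point (f t) \<in> U} = (\<Union>c\<in>C. {t. f t c > 0}) \<inter> (\<Inter>x\<in>X. {t. f t x < \<epsilon>})"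
      using complex_point_in_end_nbhd_iff[OF w(3-5) cp] by (auto simp: w(1))
    then show ?thesis using gt lt w(2) by (simp add: open_Int open_UN open_INT)
  qed
  then show "openin euclidean ((\<lambda>t. Complex_Point (f t)) -` U \<inter> topspace euclidean)"
    by (simp add: vimage_def)
next
  have "range (\<lambda>t. Complex_Point (f t)) \<subseteq> topspace T" using cp by (auto simp: topspace_T)
  then show "(\<lambda>t. Complex_Point (f t)) ` topspace euclidean \<subseteq> \<Union> ({vertex_nbhd \<Gamma> v \<epsilon> | v \<epsilon>. v \<in> verts \<Gamma> \<and> 0 < \<epsilon> \<and> \<epsilon> \<le> 1} \<union>
      {edge_interval \<Gamma> u v a b | u v a b. {u, v} \<in> edges \<Gamma> \<and> 0 \<le> a \<and> a < b \<and> b \<le> 1} \<union>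
      {end_nbhd \<Gamma> X C \<epsilon> | X C \<epsilon>. finite X \<and> X \<subseteq> verts \<Gamma> \<and> C \<in> components_avoiding \<Gamma> X \<and>
         (\<exists>\<omega>\<in>graph_ends \<Gamma>. lives_in \<omega> C) \<and> 0 < \<epsilon> \<and> \<epsilon> \<le> 1})"
    unfolding freudenthal_compactification_def topology_generated_by_topspace by simp
qed

end

section \<open>Hamilton circles from double rays\<close>

text \<open>Tent functions centred at the integers: \<open>hat h t\<close> gives the barycentric
  coordinates of the point at time \<open>t\<close> when the double ray \<open>h\<close> is
  traversed at unit speed, passing \<open>h i\<close> at time \<open>i\<close>.\<close>

definition hat :: "(int \<Rightarrow> 'a) \<Rightarrow> real \<Rightarrow> 'a \<Rightarrow> real" where
  "hat h t v = (if v \<in> range h then max 0 (1 - \<bar>t - of_int (inv_into UNIV h v)\<bar>) else 0)"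

lemma hat_apply [simp]: "inj h \<Longrightarrow> hat h t (h i) = max 0 (1 - \<bar>t - of_int i\<bar>)"
  by (simp add: hat_def)

lemma hat_outside: "v \<notin> range h \<Longrightarrow> hat h t v = 0"
  by (simp add: hat_def)

lemma hat_of_int:
  assumes "inj h" shows "hat h (of_int i) = indicat_real {h i}"
proof
  fix v show "hat h (of_int i) v = indicat_real {h i} v"
  proof (cases "v \<in> range h")
    case True
    then obtain j where j: "v = h j" by blast
    have "\<bar>real_of_int i - real_of_int j\<bar> \<ge> 1" if "i \<noteq> j"
      using that by linarith
    then show ?thesis using assms j by (auto simp: indicator_def inj_eq)
  qed (auto simp: hat_outside indicator_def)
qed

lemma hat_inj:
  assumes "inj h" shows "inj (hat h)"
proof (rule injI)
  fix s t assume "hat h s = hat h t"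
  then have "hat h s (h i) = hat h t (h i)" for i by simp
  then have e: "max 0 (1 - \<bar>s - of_int i\<bar>) = max 0 (1 - \<bar>t - of_int i\<bar>)" for i
    using assms by simp
  show "s = t"
    \<comment> \<open>The coordinate at the floor of \<open>s\<close> leaves only \<open>s\<close>
      and its mirror image in that integer; the coordinate at the next integer rules out the mirror
      image.\<close>
    using e[of "\<lfloor>s\<rfloor>"] e[of "\<lfloor>s\<rfloor> + 1"] floor_correct[of s] by (auto simp: max_def split: if_splits)
qed

lemma hat_support:
  assumes "inj h"
  shows "bary_support (hat h t) = (if t = of_int \<lfloor>t\<rfloor> then {h \<lfloor>t\<rfloor>} else {h \<lfloor>t\<rfloor>, h (\<lfloor>t\<rfloor> + 1)})"
proof -
  have k: "(1 - \<bar>t - of_int j\<bar> > 0) \<longleftrightarrow> j = \<lfloor>t\<rfloor> \<or> (j = \<lfloor>t\<rfloor> + 1 \<and> t \<noteq> of_int \<lfloor>t\<rfloor>)" for j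
  proof
    assume "1 - \<bar>t - of_int j\<bar> > 0"
    then have "of_int (j - 1) < t" "t < of_int (j + 1)" by auto
    then have "j - 1 \<le> \<lfloor>t\<rfloor>" "\<lfloor>t\<rfloor> < j + 1" by linarith+
    then have "j = \<lfloor>t\<rfloor> \<or> j = \<lfloor>t\<rfloor> + 1" by linarith
    moreover have "t \<noteq> of_int \<lfloor>t\<rfloor>" if "j = \<lfloor>t\<rfloor> + 1" using \<open>of_int (j - 1) < t\<close> that by simp
    ultimately show "j = \<lfloor>t\<rfloor> \<or> (j = \<lfloor>t\<rfloor> + 1 \<and> t \<noteq> of_int \<lfloor>t\<rfloor>)" by blast
  next
    assume "j = \<lfloor>t\<rfloor> \<or> (j = \<lfloor>t\<rfloor> + 1 \<and> t \<noteq> of_int \<lfloor>t\<rfloor>)"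
    moreover have "of_int \<lfloor>t\<rfloor> \<le> t" "t < of_int \<lfloor>t\<rfloor> + 1" by linarith+
    ultimately show "1 - \<bar>t - of_int j\<bar> > 0"
      by (elim disjE conjE; simp only: of_int_add of_int_1; linarith)
  qed
  have "v \<in> bary_support (hat h t) \<longleftrightarrow> (\<exists>j. v = h j \<and> 1 - \<bar>t - of_int j\<bar> > 0)" for v
    using assms by (cases "v \<in> range h") (auto simp: bary_support_def hat_outside inj_eq)
  then show ?thesis unfolding k by auto
qed

lemma hat_continuous: "continuous_on UNIV (\<lambda>t. hat h t v)"
  unfolding hat_def by (cases "v \<in> range h") (auto intro!: continuous_intros)

lemma inj_reverse:
  fixes h :: "int \<Rightarrow> 'a"
  shows "inj h \<Longrightarrow> inj (\<lambda>i. h (- i))"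
  unfolding inj_def by (metis neg_equal_iff_equal)

section \<open>Double rays as lines in the compactification\<close>

context simple_graph
begin

definition double_ray :: "(int \<Rightarrow> 'a) \<Rightarrow> bool" where
  "double_ray h \<longleftrightarrow> inj h \<and> (\<forall>i. {h i, h (i + 1)} \<in> edges \<Gamma>)"

lemma double_ray_vert: "double_ray h \<Longrightarrow> h i \<in> verts \<Gamma>"
  unfolding double_ray_def by (meson edge_verts(1))

lemma hat_in_complex:
  assumes "double_ray h" shows "hat h t \<in> complex_points \<Gamma>"
proof -
  have h: "inj h" "\<And>i. {h i, h (i + 1)} \<in> edges \<Gamma>" using assms by (auto simp: double_ray_def)
  have "0 \<le> hat h t v" for v by (simp add: hat_def)
  moreover have "(\<exists>v\<in>verts \<Gamma>. bary_support (hat h t) = {v}) \<or> bary_support (hat h t) \<in> edges \<Gamma>"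
    using hat_support[OF h(1), of t] h(2) double_ray_vert[OF assms] by auto
  moreover have "(\<Sum>v\<in>bary_support (hat h t). hat h t v) = 1"
  proof (cases "t = of_int \<lfloor>t\<rfloor>")
    case True
    then show ?thesis using hat_support[OF h(1), of t] h(1) by simp
  next
    case False
    define i where "i = \<lfloor>t\<rfloor>"
    have i: "of_int i \<le> t" "t \<le> of_int i + 1" unfolding i_def by linarith+
    have "h i \<noteq> h (i + 1)" using h(1) by (simp add: inj_eq)
    then show ?thesis using hat_support[OF h(1), of t] h(1) False i by (simp flip: i_def)
  qed
  ultimately show ?thesis by (simp add: complex_points_def)
qed

definition line :: "(int \<Rightarrow> 'a) \<Rightarrow> real \<Rightarrow> 'a fpoint" where
  "line h t = Complex_Point (hat h t)"

lemma line_continuous: "double_ray h \<Longrightarrow> continuous_map euclideanreal T (line h)"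
  unfolding line_def
  by (rule continuous_map_into_complex) (auto simp: hat_in_complex hat_continuous)

lemma line_inj: "double_ray h \<Longrightarrow> inj (line h)"
  using hat_inj[of h] by (auto simp: double_ray_def line_def inj_def)

lemma line_of_int: "double_ray h \<Longrightarrow> line h (of_int i) = vertex_point (h i)"
  by (simp add: double_ray_def line_def hat_of_int vertex_point_def)

lemma line_disjoint:
  assumes "double_ray h" "double_ray k" "range h \<inter> range k = {}"
  shows "range (line h) \<inter> range (line k) = {}"
proof -
  have "hat h s \<noteq> hat k t" for s t
  proof
    assume "hat h s = hat k t"
    then have "bary_support (hat h s) = bary_support (hat k t)" by simp
    moreover have "h \<lfloor>s\<rfloor> \<in> bary_support (hat h s)" "bary_support (hat k t) \<subseteq> range k"
      using assms hat_support[of h s] hat_support[of k t] by (auto simp: double_ray_def)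
    ultimately show False using assms(3) by blast
  qed
  then show ?thesis by (auto simp: line_def)
qed

abbreviation "pos_ray h \<equiv> \<lambda>n::nat. h (int n)"
abbreviation "neg_ray h \<equiv> \<lambda>n::nat. h (- int n)"

lemma is_ray_pos:
  assumes "double_ray h" shows "is_ray \<Gamma> (pos_ray h)"
  unfolding is_ray_def
proof (intro conjI allI)
  show "inj (pos_ray h)" using assms unfolding double_ray_def by (metis (mono_tags, lifting) injI inj_eq of_nat_eq_iff)
  show "range (pos_ray h) \<subseteq> verts \<Gamma>" using double_ray_vert[OF assms] by blast
  fix n
  have "{h (int n), h (int n + 1)} \<in> edges \<Gamma>" using assms by (simp add: double_ray_def)
  then show "{h (int n), h (int (Suc n))} \<in> edges \<Gamma>" by (simp add: add.commute)
qed

lemma double_ray_reverse: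
  assumes "double_ray h" shows "double_ray (\<lambda>i. h (- i))"
  unfolding double_ray_def
proof (intro conjI allI)
  show "inj (\<lambda>i. h (- i))" using assms by (simp add: double_ray_def inj_reverse)
  fix i
  have "{h (- (i + 1)), h (- (i + 1) + 1)} \<in> edges \<Gamma>" using assms unfolding double_ray_def by blast
  moreover have "- (i + 1) + 1 = - i" by simp
  ultimately show "{h (- i), h (- (i + 1))} \<in> edges \<Gamma>" by (metis insert_commute)
qed

lemma is_ray_neg: "double_ray h \<Longrightarrow> is_ray \<Gamma> (neg_ray h)"
  using is_ray_pos[OF double_ray_reverse] .

text \<open>Once \<open>h\<close> stays in \<open>C\<close> from index \<open>m\<close> on, so do
  both endpoints of each edge traversed after time \<open>m\<close>. Only the sets
  \<open>end_nbhd\<close> contain an end, so this treats all generating sets; finite intersections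
  and unions follow by induction over the generated topology.\<close>

lemma line_limit_top:
  assumes "double_ray h"
  shows "limitin T (line h) (End_Point (end_of (pos_ray h))) at_top"
proof -
  let ?w = "end_of (pos_ray h)" and ?r = "pos_ray h"
  have inj: "inj h" using assms by (simp add: double_ray_def)
  have r: "is_ray \<Gamma> ?r" by (rule is_ray_pos[OF assms])
  have w: "?w \<in> graph_ends \<Gamma>" by (rule end_of_in[OF r])
  define \<B> where "\<B> = {vertex_nbhd \<Gamma> v \<epsilon> | v \<epsilon>. v \<in> verts \<Gamma> \<and> 0 < \<epsilon> \<and> \<epsilon> \<le> 1} \<union>
      {edge_interval \<Gamma> u v a b | u v a b. {u, v} \<in> edges \<Gamma> \<and> 0 \<le> a \<and> a < b \<and> b \<le> 1} \<union>
      {end_nbhd \<Gamma> X C \<epsilon> | X C \<epsilon>. finite X \<and> X \<subseteq> verts \<Gamma> \<and> C \<in> components_avoiding \<Gamma> X \<and>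
         (\<exists>\<omega>\<in>graph_ends \<Gamma>. lives_in \<omega> C) \<and> 0 < \<epsilon> \<and> \<epsilon> \<le> 1}"
  have T: "T = topology_generated_by \<B>" by (simp add: freudenthal_compactification_def \<B>_def)
  have basic: "\<forall>\<^sub>F t in at_top. line h t \<in> U" if UB: "U \<in> \<B>" "End_Point ?w \<in> U" for U
  proof -
    obtain X C \<epsilon> where U: "U = end_nbhd \<Gamma> X C \<epsilon>" "finite X" "X \<subseteq> verts \<Gamma>" "C \<in> components_avoiding \<Gamma> X"
    proof (atomize_elim)
      from UB(1) consider v \<epsilon> where "U = vertex_nbhd \<Gamma> v \<epsilon>" | u v a b where "U = edge_interval \<Gamma> u v a b"
        | X C \<epsilon> where "U = end_nbhd \<Gamma> X C \<epsilon>" "finite X" "X \<subseteq> verts \<Gamma>" "C \<in> components_avoiding \<Gamma> X"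
        unfolding \<B>_def by blast
      then show "\<exists>X C \<epsilon>. U = end_nbhd \<Gamma> X C \<epsilon> \<and> finite X \<and> X \<subseteq> verts \<Gamma> \<and> C \<in> components_avoiding \<Gamma> X"
        using UB(2) by cases (auto simp: vertex_nbhd_def edge_interval_def)
    qed
    then have "lives_in ?w C" using UB(2) by (auto simp: end_nbhd_def)
    then obtain m where m: "\<And>n. n \<ge> m \<Longrightarrow> h (int n) \<in> C"
      using lives_in_end_of[OF r U(2-4)] by (auto simp: tail_in_def)
    have "line h t \<in> U" if "t \<ge> real m" for t
    proof -
      have f: "\<lfloor>t\<rfloor> \<ge> int m" using that by (simp add: le_floor_iff)
      have "h \<lfloor>t\<rfloor> \<in> C" "h (\<lfloor>t\<rfloor> + 1) \<in> C"
      proof -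
        have "int (nat \<lfloor>t\<rfloor>) = \<lfloor>t\<rfloor>" "int (nat (\<lfloor>t\<rfloor> + 1)) = \<lfloor>t\<rfloor> + 1" "nat \<lfloor>t\<rfloor> \<ge> m" "nat (\<lfloor>t\<rfloor> + 1) \<ge> m"
          using f by linarith+
        then show "h \<lfloor>t\<rfloor> \<in> C" "h (\<lfloor>t\<rfloor> + 1) \<in> C" by (metis m)+
      qed
      then have "bary_support (hat h t) \<subseteq> C" using hat_support[OF inj, of t] by auto
      then show ?thesis using hat_in_complex[OF assms, of t] unfolding U(1) line_def end_nbhd_def by blast
    qed
    then show ?thesis unfolding eventually_at_top_linorder by blast
  qed
  have "End_Point ?w \<in> U \<longrightarrow> (\<forall>\<^sub>F t in at_top. line h t \<in> U)" if "generate_topology_on \<B> U" for U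
    using that
  proof induction
    case (Int a b)
    then show ?case by (auto simp: eventually_conj_iff)
  next
    case (UN K)
    show ?case
    proof
      assume "End_Point ?w \<in> \<Union>K"
      then obtain k where k: "k \<in> K" "End_Point ?w \<in> k" by blast
      then have "\<forall>\<^sub>F t in at_top. line h t \<in> k" using UN by blast
      then show "\<forall>\<^sub>F t in at_top. line h t \<in> \<Union>K" by (rule eventually_mono) (use k in blast)
    qed
  qed (use basic in auto)
  moreover have "End_Point ?w \<in> topspace T" using w by (simp add: topspace_T)
  ultimately show ?thesis unfolding limitin_def T openin_topology_generated_by_iff by blast
qed

lemma line_reverse: "inj h \<Longrightarrow> line (\<lambda>i. h (- i)) t = line h (- t)"
proof -
  assume h: "inj h"
  then have h': "inj (\<lambda>i. h (- i))" by (rule inj_reverse)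
  have "hat (\<lambda>i. h (- i)) t v = hat h (- t) v" for v
  proof (cases "v \<in> range h")
    case True
    then obtain i where i: "v = h i" by blast
    have "\<bar>t - of_int (- i)\<bar> = \<bar>- t - of_int i\<bar>" by simp
    then show ?thesis using hat_apply[OF h', of t "- i"] hat_apply[OF h, of "- t" i] unfolding i by simp
  next
    case False
    then have "v \<notin> range (\<lambda>i. h (- i))" by auto
    then show ?thesis using False by (simp add: hat_outside)
  qed
  then show ?thesis by (auto simp: line_def)
qed

lemma line_limit_bot:
  assumes "double_ray h"
  shows "limitin T (line h) (End_Point (end_of (neg_ray h))) at_bot"
proof -
  have "limitin T (line (\<lambda>i. h (- i))) (End_Point (end_of (neg_ray h))) at_top"
    using line_limit_top[OF double_ray_reverse[OF assms]] .
  moreover have "line (\<lambda>i. h (- i)) = (\<lambda>t. line h (- t))"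
    using line_reverse assms by (auto simp: double_ray_def)
  ultimately have "limitin T (\<lambda>t. line h (- t)) (End_Point (end_of (neg_ray h))) at_top"
    by simp
  then show ?thesis
    unfolding limitin_def at_bot_mirror eventually_filtermap by simp
qed

lemma line_not_end [simp]: "line h t \<noteq> End_Point \<omega>" "End_Point \<omega> \<noteq> line h t"
  by (simp_all add: line_def)

text \<open>Both lines run from the common end of the negative halves to the common end of the
  positive halves, and disjoint vertex sets make disjoint lines; the two ends become
  \<open>P\<close> and \<open>Q\<close> of \<open>circle_from_two_lines\<close>.\<close>

theorem two_double_rays_circle:
  assumes h: "double_ray h" and k: "double_ray k"
    and disj: "range h \<inter> range k = {}" and span: "range h \<union> range k = verts \<Gamma>"
    and pos: "(pos_ray h, pos_ray k) \<in> ray_equiv \<Gamma>" and neg: "(neg_ray h, neg_ray k) \<in> ray_equiv \<Gamma>"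
    and ne: "(pos_ray h, neg_ray h) \<notin> ray_equiv \<Gamma>"
  shows "\<exists>H. hamilton_circle \<Gamma> H"
proof -
  let ?P = "End_Point (end_of (pos_ray h))" and ?Q = "End_Point (end_of (neg_ray h))"
  define g where "g b = (if b then line h else line k)" for b
  have P: "end_of (pos_ray h) = end_of (pos_ray k)" and Q: "end_of (neg_ray h) = end_of (neg_ray k)"
    and PQ: "end_of (pos_ray h) \<noteq> end_of (neg_ray h)"
    using end_of_eq_iff is_ray_pos is_ray_neg h k pos neg ne by simp_all
  let ?H = "range (g True) \<union> range (g False) \<union> {?P, ?Q}"
  have lim: "limitin T (g b) ?P at_top" "limitin T (g b) ?Q at_bot" for b
    using line_limit_top[OF h] line_limit_top[OF k] line_limit_bot[OF h] line_limit_bot[OF k] P Q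
    by (auto simp: g_def)
  have hom: "subtopology T ?H homeomorphic_space top_of_set (sphere (0::complex) 1)"
  proof (rule circle_from_two_lines[OF Hausdorff_T])
    show "continuous_map euclideanreal T (g b)" for b using line_continuous h k by (simp add: g_def)
    show "inj (g b)" for b using line_inj h k by (simp add: g_def)
    show "range (g True) \<inter> range (g False) = {}" using line_disjoint[OF h k disj] by (simp add: g_def)
    show "?P \<noteq> ?Q" using PQ by simp
    show "?P \<notin> range (g b)" "?Q \<notin> range (g b)" for b by (auto simp: g_def)
  qed (use lim in auto)
  have "?H \<subseteq> topspace T"
    using lim[of True] hat_in_complex[OF h] hat_in_complex[OF k]
    by (auto simp: limitin_def g_def line_def topspace_T)
  moreover have "vertex_point v \<in> ?H" if v: "v \<in> verts \<Gamma>" for v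
  proof -
    from v span obtain i where "v = h i \<or> v = k i" by blast
    then have "vertex_point v = g True (of_int i) \<or> vertex_point v = g False (of_int i)"
      using line_of_int[OF h] line_of_int[OF k] by (auto simp: g_def)
    then show ?thesis by blast
  qed
  then have "vertex_point ` verts \<Gamma> \<subseteq> ?H" by blast
  ultimately show ?thesis using hom unfolding hamilton_circle_def by (intro exI[of _ ?H] conjI)
qed

text \<open>To reuse the two-line lemma, the line is cut at time 0. Both open halves are traversed
  away from \<open>line h 0\<close>, so they tend to it at \<open>at_bot\<close> and to the common
  end of the two halves at \<open>at_top\<close>.\<close>

theorem one_double_ray_circle:
  assumes h: "double_ray h" and span: "range h = verts \<Gamma>"
    and eq: "(pos_ray h, neg_ray h) \<in> ray_equiv \<Gamma>"
  shows "\<exists>H. hamilton_circle \<Gamma> H"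
proof -
  let ?P = "End_Point (end_of (pos_ray h))" and ?Q = "line h 0"
  \<comment> \<open>\<open>exp\<close> and \<open>- exp\<close> stretch the two open half lines to
    full lines.\<close>
  define e where "e b x = (if b then exp x else - exp x :: real)" for b x
  define g where "g b x = line h (e b x)" for b x
  have P: "end_of (pos_ray h) = end_of (neg_ray h)"
    using end_of_eq_iff is_ray_pos is_ray_neg h eq by simp_all
  let ?H = "range (g True) \<union> range (g False) \<union> {?P, ?Q}"
  have inj: "line h s = line h t \<longleftrightarrow> s = t" for s t
    using line_inj[OF h] by (simp add: inj_eq)
  have ec: "continuous_on UNIV (e b)" for b
    unfolding e_def by (cases b) (auto intro!: continuous_intros)
  have top: "limitin T (g b) ?P at_top" for b
  proof (cases b)
    case True
    have "filterlim (e b) at_top at_top" using True by (simp add: e_def[abs_def] exp_at_top)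
    then show ?thesis using line_limit_top[OF h] unfolding limitin_def g_def filterlim_iff by blast
  next
    case False
    have "filterlim (e b) at_bot at_top"
      using False exp_at_top by (simp add: e_def[abs_def] filterlim_uminus_at_bot)
    then show ?thesis using line_limit_bot[OF h] unfolding P limitin_def g_def filterlim_iff by blast
  qed
  have bot: "limitin T (g b) ?Q at_bot" for b
  proof -
    have "(e b \<longlongrightarrow> 0) at_bot"
      using exp_at_bot tendsto_minus[OF exp_at_bot] by (cases b) (auto simp: e_def[abs_def])
    then have "limitin euclideanreal (e b) 0 at_bot" by simp
    from continuous_map_limit[OF line_continuous[OF h] this]
    show ?thesis by (simp add: g_def[abs_def] o_def)
  qed
  have hom: "subtopology T ?H homeomorphic_space top_of_set (sphere (0::complex) 1)"
  proof (rule circle_from_two_lines[OF Hausdorff_T])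
    show "continuous_map euclideanreal T (g b)" for b
      using continuous_map_compose[OF _ line_continuous[OF h], of euclideanreal "e b"] ec[of b]
      by (simp add: g_def[abs_def] o_def)
    show "inj (g b)" for b unfolding g_def inj_def inj by (auto simp: e_def)
    show "range (g True) \<inter> range (g False) = {}"
      unfolding g_def by (auto simp: inj e_def) (smt (verit) exp_gt_zero)
    show "?P \<noteq> ?Q" by simp
    show "?P \<notin> range (g b)" for b by (auto simp: g_def)
    show "?Q \<notin> range (g b)" for b by (auto simp: g_def inj e_def split: if_splits)
  qed (use top bot in auto)
  have "?H \<subseteq> topspace T"
    using top[of True] hat_in_complex[OF h] by (auto simp: limitin_def g_def line_def topspace_T)
  moreover have "line h t \<in> ?H" for t
  proof -
    consider "t > 0" | "t = 0" | "t < 0" by linarith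
    then show ?thesis
    proof cases
      case 1
      then have "line h t = g True (ln t)" by (simp add: g_def e_def)
      then show ?thesis by blast
    next
      case 3
      then have "line h t = g False (ln (- t))" by (simp add: g_def e_def)
      then show ?thesis by blast
    qed simp
  qed
  then have "vertex_point ` verts \<Gamma> \<subseteq> ?H"
    using line_of_int[OF h, symmetric] unfolding span[symmetric] by fastforce
  ultimately show ?thesis using hom unfolding hamilton_circle_def by (intro exI[of _ ?H] conjI)
qed

end

section \<open>The two-way infinite path has no Hamilton circle\<close>

lemma connected_circle_minus_point:
  fixes z :: complex assumes "z \<in> sphere 0 1"
  shows "connected (sphere 0 1 - {z})"
proof -
  have "(sphere 0 1 - {z}) homeomorphic {x. (1::complex) \<bullet> x = 0}"
    using homeomorphic_punctured_sphere_hyperplane[of 1 z 0 "1::complex" 0] assms by simp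
  moreover have "connected {x. (1::complex) \<bullet> x = 0}"
    by (rule convex_connected[OF convex_hyperplane])
  ultimately show ?thesis by (simp add: homeomorphic_connectedness)
qed

lemma circle_minus_point_connectedin:
  assumes hom: "subtopology X H homeomorphic_space top_of_set (sphere (0::complex) 1)"
    and H: "H \<subseteq> topspace X" and x: "x \<in> H"
  shows "connectedin X (H - {x})"
proof -
  obtain f g where fg: "homeomorphic_maps (subtopology X H) (top_of_set (sphere (0::complex) 1)) f g"
    using hom by (auto simp: homeomorphic_space_def)
  then have g: "continuous_map (top_of_set (sphere 0 1)) (subtopology X H) g"
    and gf: "\<And>y. y \<in> H \<Longrightarrow> g (f y) = y" and fg': "\<And>z. z \<in> sphere 0 1 \<Longrightarrow> f (g z) = z"
    and f: "\<And>y. y \<in> H \<Longrightarrow> f y \<in> sphere 0 1" and g': "\<And>z. z \<in> sphere 0 1 \<Longrightarrow> g z \<in> H"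
    using H by (auto simp: homeomorphic_maps_def continuous_map_def Pi_iff)
  have "connectedin (top_of_set (sphere (0::complex) 1)) (sphere 0 1 - {f x})"
    using connected_circle_minus_point[OF f[OF x]] by (auto simp: connectedin_subtopology)
  then have "connectedin (subtopology X H) (g ` (sphere 0 1 - {f x}))"
    by (rule connectedin_continuous_map_image[OF g])
  moreover have "g ` (sphere 0 1 - {f x}) = H - {x}"
  proof
    show "g ` (sphere 0 1 - {f x}) \<subseteq> H - {x}" using g' fg' by fastforce
    show "H - {x} \<subseteq> g ` (sphere 0 1 - {f x})"
    proof
      fix y assume y: "y \<in> H - {x}"
      then have "f y \<in> sphere 0 1 - {f x}" using f gf x by (metis Diff_iff singletonD singletonI)
      then show "y \<in> g ` (sphere 0 1 - {f x})" using gf y by (metis DiffD1 imageI)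
    qed
  qed
  ultimately show ?thesis by (simp add: connectedin_subtopology)
qed

context simple_graph
begin

text \<open>A circle stays connected when a point is removed, whereas removing the vertex \<open>v\<close> separates
  the whole compactification.\<close>

lemma no_hamilton_circle_cut_vertex:
  assumes v: "v \<in> verts \<Gamma>"
    and C: "C \<in> components_avoiding \<Gamma> {v}" and D: "D \<in> components_avoiding \<Gamma> {v}" and CD: "C \<inter> D = {}"
    and cover: "verts \<Gamma> - {v} \<subseteq> C \<union> D"
    and r: "is_ray \<Gamma> r" "tail_in r C" and s: "is_ray \<Gamma> s" "tail_in s D"
  shows "\<not> hamilton_circle \<Gamma> H"
proof
  assume "hamilton_circle \<Gamma> H"
  then have H: "H \<subseteq> topspace T" "subtopology T H homeomorphic_space top_of_set (sphere (0::complex) 1)"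
    "vertex_point ` verts \<Gamma> \<subseteq> H"
    by (auto simp: hamilton_circle_def)
  let ?v = "vertex_point v" and ?U = "end_nbhd \<Gamma> {v} C 1" and ?V = "end_nbhd \<Gamma> {v} D 1"
  have con: "connectedin T (H - {?v})"
    by (rule circle_minus_point_connectedin[OF H(2,1)]) (use H(3) v in blast)
  \<comment> \<open>\<open>end_nbhd\<close> is a generating set only for a component in which some
    end lives; the ends of \<open>r\<close> and \<open>s\<close> provide one on each side.\<close>
  have lr: "lives_in (end_of r) C" and ls: "lives_in (end_of s) D"
    using lives_in_end_of[OF r(1) _ _ C] lives_in_end_of[OF s(1) _ _ D] r s v by auto
  have o: "openin T ?U" "openin T ?V"
    using openin_end_nbhd[OF _ _ C end_of_in[OF r(1)] lr] openin_end_nbhd[OF _ _ D end_of_in[OF s(1)] ls] v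
    by auto
  have disj: "?U \<inter> ?V = {}"
    using end_nbhds_disjoint[OF C D CD] v by simp
  have in_nbhd: "vertex_point u \<in> end_nbhd \<Gamma> {v} B 1"
    if "u \<in> B" "B \<in> components_avoiding \<Gamma> {v}" for u B
  proof -
    have u: "u \<in> verts \<Gamma> - {v}" using component_subset that by blast
    then show ?thesis unfolding vertex_point_def
      using complex_point_in_end_nbhd_iff[OF that(2) _ _ vertex_indicator_in, of 1 u] that(1)
      by (auto simp: indicator_def)
  qed
  have ne: "(H - {?v}) \<inter> end_nbhd \<Gamma> {v} B 1 \<noteq> {}" if B: "B \<in> components_avoiding \<Gamma> {v}" for B
  proof -
    obtain u where u: "u \<in> B" using B component_nonempty by blast
    then have "u \<in> verts \<Gamma> - {v}" using component_subset B by blast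
    then have "vertex_point u \<in> H - {?v}"
      using H(3) by (auto simp: vertex_point_def indicator_def fun_eq_iff)
    then show ?thesis using in_nbhd[OF u B] by blast
  qed
  \<comment> \<open>The two open sets miss only \<open>?v\<close>: any other point of the complex
    has positive weight on a vertex of \<open>C\<close> or \<open>D\<close>, and an end lives in a
    component of the graph without \<open>v\<close>, which must be \<open>C\<close> or
    \<open>D\<close>.\<close>
  have "x \<in> ?U \<union> ?V" if x: "x \<in> topspace T" "x \<noteq> ?v" for x
  proof (cases x)
    case (Complex_Point p)
    then have p: "p \<in> complex_points \<Gamma>" "p \<noteq> indicat_real {v}"
      using x by (auto simp: topspace_T vertex_point_def)
    have "\<exists>u. u \<in> C \<union> D \<and> p u > 0 \<and> p v < 1"
      using p(1)
    proof (cases rule: complex_point_cases)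
      case (vertex u)
      then have "u \<noteq> v" using p by blast
      then show ?thesis using vertex cover by (intro exI[of _ u]) (auto simp: indicator_def)
    next
      case (edge a b)
      have "p v < 1"
        using edge(3-6) complex_point_bounds(2)[OF p(1)] complex_point_bounds(3)[OF p(1), of v a]
          complex_point_bounds(3)[OF p(1), of v b] by (cases "v = a"; cases "v = b") auto
      then show ?thesis using edge_verts[OF edge(1)] cover edge(5,6) by (cases "a = v") auto
    qed
    then show ?thesis
      using complex_point_in_end_nbhd_iff[OF C _ _ p(1), of 1] complex_point_in_end_nbhd_iff[OF D _ _ p(1), of 1]
        Complex_Point by auto
  next
    case (End_Point \<omega>)
    then have w: "\<omega> \<in> graph_ends \<Gamma>" using x by (auto simp: topspace_T)
    obtain B where B: "B \<in> components_avoiding \<Gamma> {v}" "lives_in \<omega> B"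
      using end_component[OF w, of "{v}"] v by auto
    obtain u where u: "u \<in> B" using B component_nonempty by blast
    then have "u \<in> C \<union> D" using component_subset[OF B(1)] cover by blast
    then have "B = C \<or> B = D" using component_unique B C D u by blast
    then show ?thesis using B w End_Point by (auto simp: end_nbhd_def)
  qed
  then have "H - {?v} \<subseteq> ?U \<union> ?V" using H(1) by blast
  then show False
    using con o disj ne[OF C] ne[OF D] unfolding connectedin by blast
qed

text \<open>Each edge changes the index by one, so a walk starting at \<open>h 1\<close> cannot get
  past the removed vertex \<open>h 0\<close>.\<close>

lemma path_half_component:
  assumes h: "double_ray h" and e: "\<And>e. e \<in> edges \<Gamma> \<Longrightarrow> \<exists>i. e = {h i, h (i + 1)}"
  shows "component_of_avoiding \<Gamma> {h 0} (h 1) = h ` {1..}"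
proof
  have inj: "h i = h j \<longleftrightarrow> i = j" for i j using h by (simp add: double_ray_def inj_eq)
  have he: "{h i, h (i + 1)} \<in> edges \<Gamma>" for i using h by (simp add: double_ray_def)
  show "component_of_avoiding \<Gamma> {h 0} (h 1) \<subseteq> h ` {1..}"
  proof
    fix x assume "x \<in> component_of_avoiding \<Gamma> {h 0} (h 1)"
    then show "x \<in> h ` {1..}"
      unfolding component_of_avoiding_def mem_Collect_eq
    proof (induction rule: rtrancl_induct)
      case (step y z)
      then obtain i where i: "y = h i" "i \<ge> 1" by auto
      have yz: "{y, z} \<in> edges \<Gamma>" "z \<noteq> h 0" using step by auto
      obtain j where "{h i, z} = {h j, h (j + 1)}" using e[OF yz(1)] i by auto
      then have "z = h (i + 1) \<or> z = h (i - 1)" by (auto simp: doubleton_eq_iff inj)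
      moreover have "z = h (i - 1) \<Longrightarrow> i - 1 \<ge> 1" using yz(2) i(2) by (cases "i = 1") auto
      ultimately show ?case using i(2) by fastforce
    qed auto
  qed
  show "h ` {1..} \<subseteq> component_of_avoiding \<Gamma> {h 0} (h 1)"
  proof (rule image_subsetI)
    fix i :: int assume "i \<in> {1..}"
    then have "1 \<le> i" by simp
    then show "h i \<in> component_of_avoiding \<Gamma> {h 0} (h 1)"
    proof (induction i rule: int_ge_induct)
      case (step i)
      have "h (i + 1) \<in> component_of_avoiding \<Gamma> {h 0} (h i)"
        using component_of_edge[OF he[of i]] step.hyps inj by auto
      then show ?case using component_of_trans step.IH by blast
    qed simp
  qed
qed

lemma no_hamilton_circle_path:
  assumes h: "double_ray h" "range h = verts \<Gamma>" and e: "\<And>e. e \<in> edges \<Gamma> \<Longrightarrow> \<exists>i. e = {h i, h (i + 1)}"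
  shows "\<not> hamilton_circle \<Gamma> H"
proof -
  let ?k = "\<lambda>i. h (- i)"
  have inj: "h i = h j \<longleftrightarrow> i = j" for i j using h by (simp add: double_ray_def inj_eq)
  have k: "double_ray ?k" by (rule double_ray_reverse[OF h(1)])
  have ek: "\<exists>i. e = {?k i, ?k (i + 1)}" if ee: "e \<in> edges \<Gamma>" for e
  proof -
    obtain i where "e = {h i, h (i + 1)}" using e[OF ee] by blast
    \<comment> \<open>Reversal exchanges the endpoints, so the edge starting at index
      \<open>i\<close> becomes the one starting at \<open>- i - 1\<close>.\<close>
    then have "e = {?k (- i - 1), ?k (- i - 1 + 1)}" by (auto simp: add.commute)
    then show ?thesis by blast
  qed
  let ?C = "component_of_avoiding \<Gamma> {h 0} (h 1)" and ?D = "component_of_avoiding \<Gamma> {h 0} (h (- 1))"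
  have C: "?C = h ` {1..}" by (rule path_half_component[OF h(1) e])
  have D: "?D = ?k ` {1..}" using path_half_component[OF k ek] by simp
  have v: "h i \<in> verts \<Gamma>" for i using h(2) by blast
  show ?thesis
  proof (rule no_hamilton_circle_cut_vertex)
    show "h 0 \<in> verts \<Gamma>" by (rule v)
    show "?C \<in> components_avoiding \<Gamma> {h 0}" "?D \<in> components_avoiding \<Gamma> {h 0}"
      using v inj by (auto intro!: component_of_in)
    show "?C \<inter> ?D = {}" unfolding C D using inj by auto
    show "verts \<Gamma> - {h 0} \<subseteq> ?C \<union> ?D"
    proof
      fix x assume "x \<in> verts \<Gamma> - {h 0}"
      then obtain i where i: "x = h i" "i \<noteq> 0" using h(2) by auto
      show "x \<in> ?C \<union> ?D"
      proof (cases "i > 0")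
        case True
        then show ?thesis unfolding C using i by auto
      next
        case False
        then have "x = ?k (- i)" "- i \<in> {1..}" using i by auto
        then show ?thesis unfolding D by blast
      qed
    qed
    show "is_ray \<Gamma> (pos_ray h)" "is_ray \<Gamma> (neg_ray h)" using is_ray_pos is_ray_neg h by auto
    show "tail_in (pos_ray h) ?C" "tail_in (neg_ray h) ?D"
      unfolding tail_in_def C D by (intro exI[of _ 1]; auto)+
  qed
qed

end

section \<open>Hamiltonian double rays of grids\<close>

definition grid_adj :: "int \<times> int \<Rightarrow> int \<times> int \<Rightarrow> bool" where
  "grid_adj p q \<longleftrightarrow> fst p = fst q \<and> \<bar>snd p - snd q\<bar> = 1 \<or> snd p = snd q \<and> \<bar>fst p - fst q\<bar> = 1"

lemma grid_adj_sym: "grid_adj p q \<longleftrightarrow> grid_adj q p"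
  by (auto simp: grid_adj_def)

text \<open>The column is \<open>k div m\<close>, and the row runs upwards in even columns and
  downwards in odd ones, so a column starts in the row where the previous one stopped. Filling
  column after column ties the sign of the column to the sign of \<open>k\<close>; this later
  decides to which end each half of the double ray converges.\<close>

lemma snake_exists:
  fixes l m :: int
  assumes "m \<ge> 1"
  shows "\<exists>q :: int \<Rightarrow> int \<times> int. inj q \<and> range q = UNIV \<times> {l..<l + m} \<and>
    (\<forall>k. grid_adj (q k) (q (k + 1))) \<and> (\<forall>k. fst (q k) \<ge> 0 \<longleftrightarrow> k \<ge> 0)"
proof -
  define c where "c a r = (if even a then l + r else l + m - 1 - r)" for a r :: int
  define q where "q k = (k div m, c (k div m) (k mod m))" for k
  have m: "0 \<le> k mod m" "k mod m < m" for k using assms by simp_all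
  have qa: "q (m * a + r) = (a, c a r)" if "0 \<le> r" "r < m" for a r
    using int_div_pos_eq[OF refl that, of a] int_mod_pos_eq[OF refl that, of a] by (simp only: q_def)
  have split: "k = m * (k div m) + k mod m" for k by simp
  have "inj q"
  proof (rule injI)
    fix j k assume e: "q j = q k"
    then have d: "j div m = k div m" by (simp add: q_def)
    then have "j mod m = k mod m" using e by (auto simp: q_def c_def split: if_splits)
    with d show "j = k" by (metis split)
  qed
  moreover have "range q = UNIV \<times> {l..<l + m}"
  proof
    show "range q \<subseteq> UNIV \<times> {l..<l + m}" using m by (auto simp: q_def c_def algebra_simps)
        (smt (verit) m)+
    show "UNIV \<times> {l..<l + m} \<subseteq> range q"
    proof clarify
      fix a b :: int assume b: "b \<in> {l..<l + m}"
      define r where "r = (if even a then b - l else l + m - 1 - b)"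
      have "q (m * a + r) = (a, b)" using qa[of r a] b by (auto simp: r_def c_def)
      then show "(a, b) \<in> range q" by (metis rangeI)
    qed
  qed
  moreover have "grid_adj (q k) (q (k + 1))" for k
  proof -
    let ?a = "k div m" and ?r = "k mod m"
    show ?thesis
    proof (cases "?r + 1 < m")
      case True
      have "q (k + 1) = q (m * ?a + (?r + 1))" using split[of k] by (simp add: add.assoc)
      also have "\<dots> = (?a, c ?a (?r + 1))" using qa[of "?r + 1" ?a] m[of k] True by simp
      finally show ?thesis by (auto simp: q_def c_def grid_adj_def)
    next
      case False
      then have r: "?r = m - 1" using m[of k] by simp
      have "m * ?a + ?r + 1 = m * (?a + 1) + 0" unfolding r by (simp add: algebra_simps)
      then have "k + 1 = m * (?a + 1) + 0" by simp
      then have "q (k + 1) = q (m * (?a + 1) + 0)" by (rule arg_cong)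
      also have "\<dots> = (?a + 1, c (?a + 1) 0)" by (rule qa) (use assms in simp_all)
      finally have "q (k + 1) = (?a + 1, c (?a + 1) 0)" .
      then show ?thesis using r by (auto simp: q_def c_def grid_adj_def)
    qed
  qed
  moreover have "fst (q k) \<ge> 0 \<longleftrightarrow> k \<ge> 0" for k
    using assms by (simp add: q_def pos_imp_zdiv_nonneg_iff)
  ultimately show ?thesis by blast
qed

text \<open>A Hamiltonian ray of the half-plane grid \<open>y \<ge> 0\<close>: it runs through the layers
  \<open>max \<bar>x\<bar> y = n\<close> one after the other, from left to right for even \<open>n\<close> and from right to left
  for odd \<open>n\<close>. The position inside a layer is \<open>layer_pos\<close>, and \<open>layer_rank\<close> adds the
  \<open>2 n\<^sup>2 - n\<close> points of the preceding layers.\<close>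

definition layer :: "int \<times> int \<Rightarrow> int" where "layer p = max \<bar>fst p\<bar> (snd p)"

definition layer_sgn :: "int \<Rightarrow> int" where "layer_sgn n = (if even n then 1 else - 1)"

text \<open>Here \<open>u\<close> is the abscissa, reflected for odd \<open>n\<close>, so that every
  layer runs from \<open>u = - n\<close> to \<open>u = n\<close>: up the left side (positions 0 to
  n), along the top (n to 3n) and down the right side (3n to 4n). A layer thus has 4n + 1
  points.\<close>

definition layer_pos :: "int \<Rightarrow> int \<Rightarrow> int \<Rightarrow> int" where
  "layer_pos n u y = (if u = - n then y else if y = n then 2 * n + u else 4 * n - y)"

definition layer_rank :: "int \<times> int \<Rightarrow> int" where
  "layer_rank p = (let n = layer p in 2 * n * n - n + layer_pos n (layer_sgn n * fst p) (snd p))"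

definition layer_succ :: "int \<times> int \<Rightarrow> int \<times> int" where
  "layer_succ p = (let n = layer p; e = layer_sgn n; u = e * fst p; y = snd p in
     if u = n \<and> y = 0 then (e * (n + 1), 0)
     else if u = - n \<and> y < n then (fst p, y + 1)
     else if y = n \<and> u < n then (e * (u + 1), y)
     else (fst p, y - 1))"

lemma layer_sgn_cases: "layer_sgn n = 1 \<and> layer_sgn (n + 1) = - 1 \<or> layer_sgn n = - 1 \<and> layer_sgn (n + 1) = 1"
  by (simp add: layer_sgn_def)

text \<open>The rank is a step counter: growing by one along \<open>layer_succ\<close> it makes the
  iterates distinct, and together with injectivity of the rank it makes them reach every point of
  the half-plane.\<close>

lemma layer_succ_props:
  assumes "snd p \<ge> 0"
  shows "snd (layer_succ p) \<ge> 0" "grid_adj p (layer_succ p)" "layer_rank (layer_succ p) = layer_rank p + 1"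
proof -
  obtain x y where p: "p = (x, y)" by fastforce
  define n e u where "n = layer p" and "e = layer_sgn n" and "u = e * x"
  have e: "e = 1 \<or> e = - 1" using layer_sgn_cases[of n] by (auto simp: e_def)
  have n: "max \<bar>u\<bar> y = n" using e by (auto simp: n_def layer_def p u_def)
  have x: "x = e * u" using e by (auto simp: u_def)
  have y: "y \<ge> 0" using assms p by simp
  have rp: "layer_rank p = 2 * n * n - n + layer_pos n u y"
    by (simp add: layer_rank_def Let_def p u_def e_def flip: n_def)
      (simp add: n_def p)
  have same: "layer_rank (e * u', y') = 2 * n * n - n + layer_pos n u' y'" if "max \<bar>u'\<bar> y' = n" for u' y'
  proof -
    have "layer (e * u', y') = n" using that e by (auto simp: layer_def)
    moreover have "e * (e * u') = u'" using e by auto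
    ultimately show ?thesis by (simp only: layer_rank_def Let_def fst_conv snd_conv e_def[symmetric])
  qed
  have succ: "layer_succ p = (if u = n \<and> y = 0 then (e * (n + 1), 0)
     else if u = - n \<and> y < n then (e * u, y + 1)
     else if y = n \<and> u < n then (e * (u + 1), y)
     else (e * u, y - 1))"
  proof -
    have f: "e * fst p = u" "fst p = e * u" "snd p = y" using x by (simp_all add: p u_def)
    show ?thesis
      unfolding layer_succ_def Let_def n_def[symmetric] e_def[symmetric] f(1) f(3)
      by (simp only: f(2))
  qed
  have n0: "n \<ge> 0" using n y by linarith
  consider (1) "u = n" "y = 0" | (2) "\<not> (u = n \<and> y = 0)" "u = - n" "y < n"
    | (3) "\<not> (u = n \<and> y = 0)" "\<not> (u = - n \<and> y < n)" "y = n" "u < n"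
    | (4) "\<not> (u = n \<and> y = 0)" "u = n" "y > 0" "y \<le> n"
    using n y by linarith
  then have "snd (layer_succ p) \<ge> 0 \<and> grid_adj p (layer_succ p) \<and> layer_rank (layer_succ p) = layer_rank p + 1"
  proof cases
    case 1
    then have s: "layer_succ p = (e * (n + 1), 0)" by (simp add: succ)
    have "layer (e * (n + 1), 0) = n + 1" using e n0 by (auto simp: layer_def)
    \<comment> \<open>The sign alternates, so the last point of layer \<open>n\<close> is next to
      the first point of layer \<open>n + 1\<close>, whose reflected abscissa is
      \<open>- (n + 1)\<close>.\<close>
    moreover have "layer_sgn (n + 1) * (e * (n + 1)) = - (n + 1)"
      using layer_sgn_cases[of n] unfolding e_def by auto
    ultimately have "layer_rank (layer_succ p) = 2 * (n + 1) * (n + 1) - (n + 1)"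
      by (simp add: s layer_rank_def layer_pos_def Let_def)
    moreover have "layer_rank p = 2 * n * n - n + 4 * n" using 1 n0 by (auto simp: rp layer_pos_def)
    ultimately have "layer_rank (layer_succ p) = layer_rank p + 1" by (simp add: algebra_simps)
    moreover have "grid_adj p (layer_succ p)" unfolding s using e 1 x by (auto simp: p grid_adj_def)
    ultimately show ?thesis by (simp add: s)
  next
    case 2
    then have s: "layer_succ p = (e * u, y + 1)" unfolding succ by (simp only: if_False if_True HOL.simp_thms)
    have "layer_rank (layer_succ p) = layer_rank p + 1"
      unfolding s rp using 2 y same[of u "y + 1"] by (auto simp: layer_pos_def)
    moreover have "grid_adj p (layer_succ p)" unfolding s using x by (simp add: p grid_adj_def)
    ultimately show ?thesis using y by (simp add: s)
  next
    case 3
    then have s: "layer_succ p = (e * (u + 1), y)" unfolding succ by (simp only: if_False if_True HOL.simp_thms)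
    have "layer_rank (layer_succ p) = layer_rank p + 1"
      unfolding s rp using 3 n y same[of "u + 1" y] by (auto simp: layer_pos_def)
    moreover have "grid_adj p (layer_succ p)" unfolding s using e x by (auto simp: p grid_adj_def)
    ultimately show ?thesis using y by (simp add: s)
  next
    case 4
    then have s: "layer_succ p = (e * u, y - 1)" unfolding succ using n by auto
    have "layer_rank (layer_succ p) = layer_rank p + 1"
      unfolding s rp using 4 same[of u "y - 1"] by (auto simp: layer_pos_def)
    moreover have "grid_adj p (layer_succ p)" unfolding s using x by (simp add: p grid_adj_def)
    ultimately show ?thesis using 4 by (simp add: s)
  qed
  then show "snd (layer_succ p) \<ge> 0" "grid_adj p (layer_succ p)" "layer_rank (layer_succ p) = layer_rank p + 1"
    by blast+
qed

lemma layer_rank_bounds: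
  assumes "snd p \<ge> 0" "n = layer p"
  shows "2 * n * n - n \<le> layer_rank p" "layer_rank p \<le> 2 * n * n - n + 4 * n"
proof -
  have "0 \<le> layer_pos n (layer_sgn n * fst p) (snd p)" "layer_pos n (layer_sgn n * fst p) (snd p) \<le> 4 * n"
    using assms layer_sgn_cases[of n] by (auto simp: layer_pos_def layer_def)
  then show "2 * n * n - n \<le> layer_rank p" "layer_rank p \<le> 2 * n * n - n + 4 * n"
    using assms(2) by (simp_all add: layer_rank_def Let_def)
qed

text \<open>The ranks of layer \<open>n\<close> lie between 2n^2 - n and 2n^2 + 3n, and those of
  layer \<open>n + 1\<close> start right after; inside a layer, \<open>layer_pos\<close> tells the
  points apart.\<close>

lemma layer_rank_inj: "inj_on layer_rank {p. snd p \<ge> 0}"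
proof (rule inj_onI)
  fix p q assume pq: "p \<in> {p. snd p \<ge> 0}" "q \<in> {p. snd p \<ge> 0}" "layer_rank p = layer_rank q"
  have lt: "layer_rank p < layer_rank q" if "snd p \<ge> 0" "snd q \<ge> 0" "layer p < layer q" for p q
  proof -
    let ?n = "layer p" and ?m = "layer q"
    have n: "?n \<ge> 0" by (simp add: layer_def)
    \<comment> \<open>The bound 2m^2 - m splits as m * m + m * (m - 1), and each product is compared
      separately.\<close>
    have "(?n + 1) * (?n + 1) \<le> ?m * ?m" by (rule mult_mono) (use that n in auto)
    moreover have "?m * (?m - 1) \<ge> (?n + 1) * ?n" by (rule mult_mono) (use that n in auto)
    ultimately have "2 * ?n * ?n - ?n + 4 * ?n < 2 * ?m * ?m - ?m" by (simp add: algebra_simps)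
    then show ?thesis using layer_rank_bounds[OF that(1) refl] layer_rank_bounds[OF that(2) refl] by linarith
  qed
  have n: "layer p = layer q" using lt[of p q] lt[of q p] pq by (cases "layer p" "layer q" rule: linorder_cases) auto
  define n e where "n = layer p" and "e = layer_sgn n"
  have e: "e = 1 \<or> e = - 1" using layer_sgn_cases[of n] by (auto simp: e_def)
  have "layer_pos n (e * fst p) (snd p) = layer_pos n (e * fst q) (snd q)"
    using pq(3) n by (simp add: layer_rank_def Let_def n_def e_def)
  moreover have "max \<bar>e * fst p\<bar> (snd p) = n" "max \<bar>e * fst q\<bar> (snd q) = n"
    using e n by (auto simp: n_def layer_def)
  ultimately have "e * fst p = e * fst q \<and> snd p = snd q"
    using pq(1,2) unfolding layer_pos_def mem_Collect_eq by (smt (verit))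
  then show "p = q" using e by (auto simp: prod_eq_iff)
qed

text \<open>The layer walk fills the upper half-plane and its mirror image the lower one. The
  reflection \<open>f\<close> in the line \<open>y = - 1/2\<close> takes the start (0, 0) to its
  neighbour (0, -1), so the two rays join; the shift in \<open>- k - 1\<close> puts the mirrored
  start at index -1.\<close>

lemma plane_double_ray_exists:
  obtains q :: "int \<Rightarrow> int \<times> int" where "bij q" "\<And>k. grid_adj (q k) (q (k + 1))"
proof -
  define r where "r k = (layer_succ ^^ k) (0, 0)" for k
  have r0: "r 0 = (0, 0)" by (simp add: r_def)
  have r: "snd (r k) \<ge> 0 \<and> layer_rank (r k) = int k" for k
  proof (induction k)
    case 0
    then show ?case by (simp add: r_def layer_rank_def layer_def layer_pos_def)
  next
    case (Suc k)
    then show ?case using layer_succ_props[of "r k"] by (simp add: r_def)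
  qed
  have adj: "grid_adj (r k) (r (Suc k))" for k
    using layer_succ_props(2)[of "r k"] r[of k] by (simp add: r_def)
  have rinj: "r j = r k \<Longrightarrow> j = k" for j k using r by (metis of_nat_eq_iff)
  have rsurj: "\<exists>k. r k = p" if "snd p \<ge> 0" for p
  proof -
    have n: "layer p \<ge> 0" by (simp add: layer_def)
    have "0 \<le> 2 * layer p * layer p - layer p" using n by (cases "layer p = 0") (auto simp: mult_le_cancel_right1)
    then have "layer_rank p \<ge> 0" using layer_rank_bounds(1)[OF that refl] by linarith
    then have "layer_rank (r (nat (layer_rank p))) = layer_rank p" using r by simp
    then show ?thesis using layer_rank_inj r that unfolding inj_on_def by blast
  qed
  define f where "f p = (fst p, - 1 - snd p)" for p :: "int \<times> int"
  have fadj: "grid_adj (f a) (f b) \<longleftrightarrow> grid_adj a b" for a b by (auto simp: f_def grid_adj_def)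
  define q where "q k = (if k \<ge> 0 then r (nat k) else f (r (nat (- k - 1))))" for k :: int
  have "inj q"
  proof (rule injI)
    fix j k assume e: "q j = q k"
    have s: "snd (q k) \<ge> 0 \<longleftrightarrow> k \<ge> 0" for k using r[of "nat k"] r[of "nat (- k - 1)"] by (auto simp: q_def f_def)
    have jk: "j \<ge> 0 \<longleftrightarrow> k \<ge> 0" using s[of j] s[of k] e by simp
    show "j = k"
    proof (cases "j \<ge> 0")
      case True
      then have "r (nat j) = r (nat k)" using e jk by (simp add: q_def)
      then show ?thesis using rinj True jk by (metis eq_nat_nat_iff)
    next
      case False
      then have "r (nat (- j - 1)) = r (nat (- k - 1))" using e jk by (simp add: q_def f_def prod_eq_iff)
      then have "nat (- j - 1) = nat (- k - 1)" by (rule rinj)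
      then show ?thesis using False jk by linarith
    qed
  qed
  moreover have "p \<in> range q" for p
  proof (cases "snd p \<ge> 0")
    case True
    then obtain k where "r k = p" using rsurj by blast
    then have "q (int k) = p" by (simp add: q_def)
    then show ?thesis by (metis rangeI)
  next
    case False
    then obtain k where "r k = f p" using rsurj[of "f p"] by (auto simp: f_def)
    then have "q (- int k - 1) = p" by (simp add: q_def f_def)
    then show ?thesis by (metis rangeI)
  qed
  ultimately have "bij q" by (auto simp: bij_def)
  moreover have "grid_adj (q k) (q (k + 1))" for k
  proof -
    consider "k \<ge> 0" | "k = - 1" | "k < - 1" by linarith
    then show ?thesis
    proof cases
      case 1
      then have "nat (k + 1) = Suc (nat k)" by linarith
      then show ?thesis using 1 adj[of "nat k"] by (simp add: q_def)
    next
      case 2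
      then show ?thesis by (simp add: q_def r0 f_def grid_adj_def)
    next
      case 3
      then have "nat (- k - 1) = Suc (nat (- (k + 1) - 1))" by linarith
      then show ?thesis using 3 adj[of "nat (- (k + 1) - 1)"] fadj grid_adj_sym by (simp add: q_def)
    qed
  qed
  ultimately show ?thesis using that by blast
qed

section \<open>Spanning double rays in Cayley graphs\<close>

context comm_group
begin

section \<open>Cosets of a subgroup along the powers of one element\<close>

lemma generate_insert:
  assumes "s \<in> carrier G" "F \<subseteq> carrier G"
  shows "generate G (insert s F) = {x \<otimes> s [^] (k::int) | x k. x \<in> generate G F}" (is "?L = ?R")
proof
  have gF: "x \<in> carrier G" if "x \<in> generate G F" for x using generate_in_carrier[OF assms(2) that] .
  have 1: "x \<otimes> s [^] (0::int) \<in> ?R" if "x \<in> generate G F" for x using that by blast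
  show "?L \<subseteq> ?R"
  proof
    fix x assume "x \<in> ?L"
    then show "x \<in> ?R"
    proof induction
      case one
      then show ?case using 1[OF generate.one] by simp
    next
      case (incl h)
      then consider "h = s" | "h \<in> F" by blast
      then show ?case
      proof cases
        case 1
        then have "h = \<one> \<otimes> s [^] (1::int)" using assms by simp
        then show ?thesis using generate.one by blast
      next
        case 2
        then have "h \<in> generate G F" "h \<in> carrier G" using generate.incl assms by auto
        then show ?thesis using 1[of h] by simp
      qed
    next
      case (inv h)
      then consider "h = s" | "h \<in> F" by blast
      then show ?case
      proof cases
        case 1
        then have "inv h = \<one> \<otimes> s [^] (- 1::int)" using assms by (simp add: int_pow_neg)
        then show ?thesis using generate.one by blast
      next
        case 2
        then have "inv h \<in> generate G F" "inv h \<in> carrier G" using generate.inv assms by auto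
        then show ?thesis using 1[of "inv h"] by simp
      qed
    next
      case (eng h1 h2)
      then obtain x k y l where e: "h1 = x \<otimes> s [^] (k::int)" "h2 = y \<otimes> s [^] (l::int)"
        and xy: "x \<in> generate G F" "y \<in> generate G F" by blast
      have "h1 \<otimes> h2 = (x \<otimes> y) \<otimes> s [^] (k + l)"
        using gF[OF xy(1)] gF[OF xy(2)] assms by (simp add: e int_pow_mult m_ac)
      then show ?case using generate.eng[OF xy] by blast
    qed
  qed
  show "?R \<subseteq> ?L"
  proof
    fix z assume "z \<in> ?R"
    then obtain x k where z: "z = x \<otimes> s [^] (k::int)" "x \<in> generate G F" by blast
    have sub: "subgroup ?L G" using generate_is_subgroup[of "insert s F"] assms by simp
    have "x \<in> ?L" using z(2) mono_generate[of F "insert s F"] by blast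
    moreover have "s [^] k \<in> ?L" using subgroup_int_pow_closed[OF sub] generate.incl[of s "insert s F"] by blast
    ultimately show "z \<in> ?L" using subgroup.m_closed[OF sub] z by simp
  qed
qed

text \<open>The case \<open>m = 0\<close> means that only the trivial power of \<open>s\<close> lies in \<open>H\<close>.\<close>

lemma power_index:
  assumes H: "subgroup H G" and s: "s \<in> carrier G"
  obtains m :: nat where "\<And>k::int. s [^] k \<in> H \<longleftrightarrow> int m dvd k"
proof -
  have add: "s [^] (i + j) \<in> H" if "s [^] i \<in> H" "s [^] j \<in> H" for i j :: int
    using that subgroup.m_closed[OF H] s by (simp add: int_pow_mult)
  have mult: "s [^] (i * j) \<in> H" if "s [^] i \<in> H" for i j :: int
    using that subgroup_int_pow_closed[OF H, of "s [^] i" j] s by (simp add: int_pow_pow)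
  have neg: "s [^] (- i) \<in> H" if "s [^] i \<in> H" for i :: int using mult[OF that, of "- 1"] by simp
  show ?thesis
  proof (cases "\<exists>n::nat. n > 0 \<and> s [^] int n \<in> H")
    case True
    define m where "m = (LEAST n::nat. n > 0 \<and> s [^] int n \<in> H)"
    have m: "m > 0" "s [^] int m \<in> H" using LeastI_ex[OF True] by (auto simp: m_def)
    have least: "m \<le> n" if "n > 0" "s [^] int n \<in> H" for n unfolding m_def using that by (intro Least_le) simp
    have "int m dvd k" if k: "s [^] k \<in> H" for k
    proof -
      have "s [^] (k + - (int m * (k div int m))) \<in> H" by (intro add neg mult k m(2))
      moreover have "k + - (int m * (k div int m)) = k mod int m" by (simp add: minus_mult_div_eq_mod)
      ultimately have r: "s [^] (k mod int m) \<in> H" by simp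
      have b: "0 \<le> k mod int m" "k mod int m < int m" using m(1) by simp_all
      have "k mod int m = 0"
      proof (rule ccontr)
        assume "k mod int m \<noteq> 0"
        then have "m \<le> nat (k mod int m)" using least[of "nat (k mod int m)"] r b by simp
        then show False using b by linarith
      qed
      then show ?thesis by (simp add: dvd_eq_mod_eq_0)
    qed
    moreover have "s [^] k \<in> H" if "int m dvd k" for k using that mult[OF m(2)] by (auto elim!: dvdE)
    ultimately show ?thesis using that[of m] by blast
  next
    case False
    have "k = 0" if "s [^] k \<in> H" for k :: int
    proof (rule ccontr)
      assume "k \<noteq> 0"
      have "s [^] int (nat \<bar>k\<bar>) \<in> H" using that neg[OF that] by (cases "k \<ge> 0") simp_all
      then show False using False \<open>k \<noteq> 0\<close> by (metis zero_less_abs_iff zero_less_nat_eq)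
    qed
    moreover have "s [^] (0::int) \<in> H" using subgroup.one_closed[OF H] by simp
    ultimately have "s [^] k \<in> H \<longleftrightarrow> int 0 dvd k" for k :: int by auto
    then show ?thesis by (rule that)
  qed
qed

text \<open>Equal products put \<open>s [^] (i - j)\<close> into \<open>H\<close>, so
  \<open>m\<close> divides \<open>i - j\<close>. Hence rows whose exponents are less than
  \<open>m\<close> apart (all rows if \<open>m = 0\<close>) are distinct cosets, and grid
  coordinates are unambiguous.\<close>

lemma coset_power_unique:
  fixes i j :: int
  assumes H: "subgroup H G" and s: "s \<in> carrier G" and m: "\<And>k::int. s [^] k \<in> H \<longleftrightarrow> int m dvd k"
    and xy: "x \<in> H" "y \<in> H" "x \<otimes> s [^] i = y \<otimes> s [^] j" and b: "m = 0 \<or> \<bar>i - j\<bar> < int m"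
  shows "i = j \<and> x = y"
proof -
  have c: "x \<in> carrier G" "y \<in> carrier G" using subgroup.mem_carrier[OF H] xy by auto
  have "s [^] i = inv x \<otimes> (y \<otimes> s [^] j)" using c s xy(3) inv_solve_left by simp
  then have "s [^] (i - j) = inv x \<otimes> y" using c s by (simp add: int_pow_diff m_assoc)
  moreover have "inv x \<otimes> y \<in> H" using H xy by (simp add: subgroup.m_closed subgroup.m_inv_closed)
  ultimately have "int m dvd (i - j)" using m[of "i - j"] by simp
  then have "i = j" using b zdvd_not_zless[of "\<bar>i - j\<bar>" "int m"] by (cases "i = j") auto
  then show ?thesis using xy c s by simp
qed

lemma generate_insert_finite_index:
  assumes s: "s \<in> carrier G" and F: "F \<subseteq> carrier G" and m: "m > 0" "s [^] int m \<in> generate G F"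
  shows "generate G (insert s F) = {x \<otimes> s [^] j | x j. x \<in> generate G F \<and> j \<in> {0..<int m}}" (is "_ = ?R")
proof
  have sub: "subgroup (generate G F) G" by (rule generate_is_subgroup[OF F])
  show "generate G (insert s F) \<subseteq> ?R"
  proof
    fix z assume "z \<in> generate G (insert s F)"
    then obtain x k where z: "z = x \<otimes> s [^] (k::int)" "x \<in> generate G F"
      using generate_insert[OF s F] by blast
    have x: "x \<in> carrier G" using generate_in_carrier[OF F z(2)] .
    have "s [^] k = (s [^] int m) [^] (k div int m) \<otimes> s [^] (k mod int m)"
      using s by (simp add: int_pow_pow flip: int_pow_mult)
    then have "z = (x \<otimes> (s [^] int m) [^] (k div int m)) \<otimes> s [^] (k mod int m)"
      using x s z by (simp add: m_assoc)
    moreover have "x \<otimes> (s [^] int m) [^] (k div int m) \<in> generate G F"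
      using subgroup.m_closed[OF sub z(2)] subgroup_int_pow_closed[OF sub m(2)] by blast
    moreover have "k mod int m \<in> {0..<int m}" using m(1) by simp
    ultimately show "z \<in> ?R" by blast
  qed
  show "?R \<subseteq> generate G (insert s F)" using generate_insert[OF s F] by blast
qed

text \<open>A generator of finite order adds only finitely many cosets. Applied to an infinite
  group, this yields a generator of infinite order.\<close>

lemma finite_generate_torsion:
  assumes "finite F" "F \<subseteq> carrier G" and tor: "\<And>s. s \<in> F \<Longrightarrow> \<exists>k::int. k \<noteq> 0 \<and> s [^] k = \<one>"
  shows "finite (generate G F)"
  using assms
proof (induction F rule: finite_induct)
  case empty
  then show ?case by (simp add: generate_empty)
next
  case (insert s F)
  have s: "s \<in> carrier G" and F: "F \<subseteq> carrier G" using insert by auto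
  obtain k :: int where k: "k \<noteq> 0" "s [^] k = \<one>" using insert.prems(2)[of s] by blast
  have "s [^] int (nat \<bar>k\<bar>) = \<one>" using k s by (cases "k \<ge> 0") (simp_all add: int_pow_neg)
  then have "s [^] int (nat \<bar>k\<bar>) \<in> generate G F" using generate.one by metis
  then have "generate G (insert s F) \<subseteq> (\<lambda>(x, j). x \<otimes> s [^] j) ` (generate G F \<times> {0..<int (nat \<bar>k\<bar>)})"
    using generate_insert_finite_index[OF s F, of "nat \<bar>k\<bar>"] k(1) by auto
  moreover have "finite (generate G F)" using insert by auto
  ultimately show ?case by (simp add: finite_subset)
qed

lemma generate_insert_absorb:
  assumes "s \<in> generate G F" "F \<subseteq> carrier G" shows "generate G (insert s F) = generate G F"
proof -
  have "insert s F \<subseteq> generate G F" using assms(1) by (auto intro: generate.incl)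
  then have "generate G (insert s F) \<subseteq> generate G F"
    using generate_subgroup_incl[OF _ generate_is_subgroup[OF assms(2)]] by blast
  moreover have "generate G F \<subseteq> generate G (insert s F)" by (rule mono_generate) blast
  ultimately show ?thesis by blast
qed

section \<open>Powers and lines escaping finite sets\<close>

lemma inj_nat_pow:
  assumes a: "a \<in> carrier G" "\<And>k::int. a [^] k = \<one> \<Longrightarrow> k = 0" and g: "g \<in> carrier G"
  shows "inj (\<lambda>n::nat. g \<otimes> a [^] n)"
proof (rule injI)
  fix i j :: nat assume "g \<otimes> a [^] i = g \<otimes> a [^] j"
  then have "a [^] i = a [^] j" using a g by simp
  then have "a [^] (int i - int j) = \<one>" using a(1) by (simp add: int_pow_diff int_pow_int)
  then show "i = j" using a(2)[of "int i - int j"] by simp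
qed

text \<open>The lines in direction \<open>d\<close> through \<open>g \<otimes> c [^] n\<close> are
  disjoint for different \<open>n\<close>, so each of the finitely many points of \<open>X\<close>
  lies on at most one of them.\<close>

lemma eventually_line_avoids:
  assumes cd: "c \<in> carrier G" "d \<in> carrier G" and X: "finite X" and g: "g \<in> carrier G"
    and indep: "\<And>(i::int) (j::int). c [^] i \<otimes> d [^] j = \<one> \<Longrightarrow> i = 0"
  shows "\<forall>\<^sub>F n::nat in sequentially. \<forall>k::int. g \<otimes> c [^] n \<otimes> d [^] k \<notin> X"
proof -
  have "\<forall>\<^sub>F n::nat in sequentially. \<forall>k::int. g \<otimes> c [^] n \<otimes> d [^] k \<noteq> x" for x
  proof (cases "\<exists>n k. g \<otimes> c [^] (n::nat) \<otimes> d [^] (k::int) = x")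
    case True
    then obtain n0 k0 where x: "g \<otimes> c [^] (n0::nat) \<otimes> d [^] (k0::int) = x" by blast
    have "n = n0" if "g \<otimes> c [^] (n::nat) \<otimes> d [^] (k::int) = x" for n k
    proof -
      have "g \<otimes> (c [^] n \<otimes> d [^] k) = g \<otimes> (c [^] n0 \<otimes> d [^] k0)"
        using that x cd g by (simp add: m_assoc)
      then have e: "c [^] n \<otimes> d [^] k = c [^] n0 \<otimes> d [^] k0" using cd g by simp
      have "c [^] (int n - int n0) \<otimes> d [^] (k - k0) = (c [^] n \<otimes> d [^] k) \<otimes> inv (c [^] n0 \<otimes> d [^] k0)"
        using cd by (simp add: int_pow_diff int_pow_int inv_mult m_ac)
      also have "\<dots> = \<one>" unfolding e using cd by simp
      finally show ?thesis using indep by fastforce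
    qed
    then show ?thesis by (auto intro!: eventually_mono[OF eventually_gt_at_top[of n0]])
  qed auto
  then have "\<forall>\<^sub>F n::nat in sequentially. \<forall>x\<in>X. \<forall>k::int. g \<otimes> c [^] n \<otimes> d [^] k \<noteq> x"
    using X by (intro eventually_ball_finite) auto
  then show ?thesis by (rule eventually_mono) blast
qed

end

locale cayley = comm_group G for G (structure) +
  fixes S :: "'a set"
  assumes finS: "finite S" and S_sub: "S \<subseteq> carrier G" and S_inv: "s \<in> S \<Longrightarrow> inv s \<in> S"
    and S_gen: "generate G S = carrier G"
begin

abbreviation "\<Gamma> \<equiv> cayley_graph G S"

section \<open>Edges and translations of the Cayley graph\<close>

lemma S_carrier [simp]: "s \<in> S \<Longrightarrow> s \<in> carrier G" using S_sub by blast

lemma verts_cayley [simp]: "verts \<Gamma> = carrier G" by (simp add: cayley_graph_def)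

lemma edge_iff: "e \<in> edges \<Gamma> \<longleftrightarrow> (\<exists>g s. e = {g, g \<otimes> s} \<and> g \<in> carrier G \<and> s \<in> S \<and> s \<noteq> \<one>)"
  by (auto simp: cayley_graph_def)

sublocale cay: simple_graph \<Gamma>
proof
  fix e assume "e \<in> edges \<Gamma>"
  then obtain g s where "e = {g, g \<otimes> s}" "g \<in> carrier G" "s \<in> S" "s \<noteq> \<one>" by (auto simp: edge_iff)
  then show "\<exists>u v. u \<noteq> v \<and> u \<in> verts \<Gamma> \<and> v \<in> verts \<Gamma> \<and> e = {u, v}"
    by (intro exI[of _ g] exI[of _ "g \<otimes> s"]) auto
qed

lemma edgeI: "\<lbrakk>g \<in> carrier G; s \<in> S; s \<noteq> \<one>\<rbrakk> \<Longrightarrow> {g, g \<otimes> s} \<in> edges \<Gamma>"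
  by (auto simp: edge_iff)

text \<open>An edge is an unordered pair presented from one endpoint; symmetry of \<open>S\<close>
  allows it to be read from the other.\<close>

lemma edge_step:
  assumes "{x, y} \<in> edges \<Gamma>" obtains s where "s \<in> S" "s \<noteq> \<one>" "y = x \<otimes> s" "x \<in> carrier G"
proof -
  obtain g s where g: "{x, y} = {g, g \<otimes> s}" "g \<in> carrier G" "s \<in> S" "s \<noteq> \<one>"
    using assms by (auto simp: edge_iff)
  then consider "x = g" "y = g \<otimes> s" | "y = g" "x = g \<otimes> s" by (auto simp: doubleton_eq_iff)
  then show ?thesis
  proof cases
    case 1 then show ?thesis using that g by blast
  next
    case 2
    have "y = x \<otimes> inv s" using 2 g by (simp add: m_assoc)
    moreover have "inv s \<noteq> \<one>" using g by (simp add: inv_eq_1_iff)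
    ultimately show ?thesis using that[of "inv s"] g S_inv 2 by simp
  qed
qed

text \<open>Commutativity moves \<open>g\<close> past the generator. Consequently each row
  \<open>h i \<otimes> s [^] j\<close> with \<open>j\<close> fixed is a copy of the double ray
  \<open>h\<close>.\<close>

lemma edge_translate:
  assumes "{x, y} \<in> edges \<Gamma>" "g \<in> carrier G" shows "{x \<otimes> g, y \<otimes> g} \<in> edges \<Gamma>"
proof -
  obtain s where s: "s \<in> S" "s \<noteq> \<one>" "y = x \<otimes> s" "x \<in> carrier G" using edge_step[OF assms(1)] .
  then have "y \<otimes> g = (x \<otimes> g) \<otimes> s" using assms(2) by (simp add: m_ac)
  then show ?thesis using edgeI[of "x \<otimes> g" s] s assms(2) by simp
qed

text \<open>Sending \<open>(i, j)\<close> to \<open>h i \<otimes> s [^] j\<close> maps horizontal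
  grid edges to translates of edges of \<open>h\<close> and vertical ones to edges labelled
  \<open>s\<close>. A grid walk thus becomes a walk in the Cayley graph, and a double ray where the
  coordinates are unambiguous.\<close>

lemma double_ray_grid:
  assumes h: "cay.double_ray h" and s: "s \<in> S" "s \<noteq> \<one>"
    and q: "inj q" "\<And>k. grid_adj (q k) (q (k + 1))"
    and inj: "\<And>i j i' j'. \<lbrakk>(i, j) \<in> range q; (i', j') \<in> range q; h i \<otimes> s [^] j = h i' \<otimes> s [^] j'\<rbrakk>
      \<Longrightarrow> i = i' \<and> j = j'"
  shows "cay.double_ray (\<lambda>k. h (fst (q k)) \<otimes> s [^] snd (q k))"
  unfolding cay.double_ray_def
proof (intro conjI allI injI)
  fix k l assume "h (fst (q k)) \<otimes> s [^] snd (q k) = h (fst (q l)) \<otimes> s [^] snd (q l)"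
  then have "fst (q k) = fst (q l) \<and> snd (q k) = snd (q l)"
    using inj[of "fst (q k)" "snd (q k)" "fst (q l)" "snd (q l)"] by simp
  then have "q k = q l" by (simp add: prod_eq_iff)
  then show "k = l" using q(1) by (simp add: inj_eq)
next
  fix k
  define a b a' b' where ab: "a = fst (q k)" "b = snd (q k)" "a' = fst (q (k + 1))" "b' = snd (q (k + 1))"
  have hc: "h i \<in> carrier G" for i using cay.double_ray_vert[OF h, of i] by simp
  have he: "{h i, h (i + 1)} \<in> edges \<Gamma>" for i using h by (simp add: cay.double_ray_def)
  have up: "{h i \<otimes> s [^] j, h i \<otimes> s [^] (j + 1)} \<in> edges \<Gamma>" for i and j :: int
  proof -
    have "h i \<otimes> s [^] (j + 1) = (h i \<otimes> s [^] j) \<otimes> s" using hc s by (simp add: int_pow_mult m_assoc)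
    then show ?thesis using edgeI[of "h i \<otimes> s [^] j" s] s hc by simp
  qed
  have right: "{h i \<otimes> s [^] j, h (i + 1) \<otimes> s [^] j} \<in> edges \<Gamma>" for i and j :: int
    using edge_translate[OF he] s by simp
  consider "a' = a" "b' = b + 1" | "a' = a" "b = b' + 1" | "b' = b" "a' = a + 1" | "b' = b" "a = a' + 1"
    using q(2)[of k] unfolding grid_adj_def ab by linarith
  then show "{h (fst (q k)) \<otimes> s [^] snd (q k), h (fst (q (k + 1))) \<otimes> s [^] snd (q (k + 1))} \<in> edges \<Gamma>"
    unfolding ab[symmetric]
  proof cases
    case 1 then show "{h a \<otimes> s [^] b, h a' \<otimes> s [^] b'} \<in> edges \<Gamma>" using up by simp
  next
    case 2 then show "{h a \<otimes> s [^] b, h a' \<otimes> s [^] b'} \<in> edges \<Gamma>" using up[of a b'] by (simp add: insert_commute)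
  next
    case 3 then show "{h a \<otimes> s [^] b, h a' \<otimes> s [^] b'} \<in> edges \<Gamma>" using right by simp
  next
    case 4 then show "{h a \<otimes> s [^] b, h a' \<otimes> s [^] b'} \<in> edges \<Gamma>" using right[of a' b] by (simp add: insert_commute)
  qed
qed

text \<open>A snake through \<open>M\<close> consecutive rows from row \<open>L\<close> on; up to
  \<open>m\<close> such rows are distinct cosets. Two choices of \<open>(L, M)\<close> occur later:
  \<open>(0, m)\<close> for the whole larger group, and \<open>(1, m - 1)\<close> for all of it
  except \<open>H\<close>. The last conclusion keeps track of the sides.\<close>

lemma double_ray_strip:
  assumes H: "subgroup H G" and h: "cay.double_ray h" "range h = H" and s: "s \<in> S" "s \<notin> H"
    and m: "\<And>k::int. s [^] k \<in> H \<longleftrightarrow> int m dvd k" and M: "1 \<le> M" "M \<le> int m"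
  obtains h' where "cay.double_ray h'" "range h' = {x \<otimes> s [^] j | x j. x \<in> H \<and> j \<in> {L..<L + M}}"
    "\<And>k. \<exists>i j. h' k = h i \<otimes> s [^] j \<and> (i \<ge> 0 \<longleftrightarrow> k \<ge> 0) \<and> j \<in> {L..<L + M}"
proof -
  obtain q :: "int \<Rightarrow> int \<times> int" where q: "inj q" "range q = UNIV \<times> {L..<L + M}" "\<And>k. grid_adj (q k) (q (k + 1))"
    "\<And>k. fst (q k) \<ge> 0 \<longleftrightarrow> k \<ge> 0"
    using snake_exists[OF M(1), of L] by blast
  define h' where "h' k = h (fst (q k)) \<otimes> s [^] snd (q k)" for k
  have inj: "inj h" using h by (simp add: cay.double_ray_def)
  have "cay.double_ray h'"
    unfolding h'_def
  proof (rule double_ray_grid[OF h(1) s(1) _ q(1,3)])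
    show "s \<noteq> \<one>" using s subgroup.one_closed[OF H] by blast
    fix i j i' j' assume a: "(i, j) \<in> range q" "(i', j') \<in> range q" "h i \<otimes> s [^] j = h i' \<otimes> s [^] j'"
    have "m = 0 \<or> \<bar>j - j'\<bar> < int m" using a(1,2) M unfolding q(2) by auto
    then have "j = j' \<and> h i = h i'"
      using coset_power_unique[OF H _ m _ _ a(3)] s h(2) by auto
    then show "i = i' \<and> j = j'" using inj by (simp add: injD)
  qed
  moreover have "range h' = {x \<otimes> s [^] j | x j. x \<in> H \<and> j \<in> {L..<L + M}}"
  proof
    show "range h' \<subseteq> {x \<otimes> s [^] j | x j. x \<in> H \<and> j \<in> {L..<L + M}}"
    proof
      fix z assume "z \<in> range h'"
      then obtain k where k: "z = h' k" by blast
      have "q k \<in> UNIV \<times> {L..<L + M}" using q(2) by blast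
      then have "snd (q k) \<in> {L..<L + M}" by (simp add: mem_Times_iff)
      then show "z \<in> {x \<otimes> s [^] j | x j. x \<in> H \<and> j \<in> {L..<L + M}}" using k h(2) unfolding h'_def by blast
    qed
    show "{x \<otimes> s [^] j | x j. x \<in> H \<and> j \<in> {L..<L + M}} \<subseteq> range h'"
    proof
      fix z assume "z \<in> {x \<otimes> s [^] j | x j. x \<in> H \<and> j \<in> {L..<L + M}}"
      then obtain x j where "z = x \<otimes> s [^] j" "x \<in> range h" "j \<in> {L..<L + M}" unfolding h(2) by blast
      then obtain i where z: "z = h i \<otimes> s [^] j" "j \<in> {L..<L + M}" by blast
      then have "(i, j) \<in> range q" using q(2) by blast
      then obtain k where "q k = (i, j)" by (metis rangeE)
      then have "z = h' k" using z by (simp add: h'_def)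
      then show "z \<in> range h'" by blast
    qed
  qed
  moreover have "\<exists>i j. h' k = h i \<otimes> s [^] j \<and> (i \<ge> 0 \<longleftrightarrow> k \<ge> 0) \<and> j \<in> {L..<L + M}" for k
  proof -
    have "q k \<in> UNIV \<times> {L..<L + M}" using q(2) by blast
    then have "snd (q k) \<in> {L..<L + M}" by (simp add: mem_Times_iff)
    then show ?thesis using q(4)[of k] unfolding h'_def by blast
  qed
  ultimately show ?thesis using that by blast
qed

lemma double_ray_powers:
  assumes "a \<in> S" "\<And>k::int. a [^] k = \<one> \<Longrightarrow> k = 0"
  shows "cay.double_ray (\<lambda>i. a [^] (i::int))" "range (\<lambda>i. a [^] (i::int)) = generate G {a}"
proof -
  have a: "a \<in> carrier G" "a \<noteq> \<one>" using assms(1) assms(2)[of 1] by auto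
  have "i = j" if "a [^] (i::int) = a [^] j" for i j
  proof -
    have "a [^] (i - j) = \<one>" using that a by (simp add: int_pow_diff)
    then show ?thesis using assms(2) by fastforce
  qed
  moreover have "{a [^] (i::int), a [^] (i + 1)} \<in> edges \<Gamma>" for i
    using edgeI[of "a [^] i" a] a assms(1) by (simp add: int_pow_mult)
  ultimately show "cay.double_ray (\<lambda>i. a [^] (i::int))" unfolding cay.double_ray_def inj_def by blast
  show "range (\<lambda>i. a [^] (i::int)) = generate G {a}" using generate_pow[OF a(1)] by auto
qed

text \<open>Meant for the one-ended case: the induction does not record where the two halves go, and
  therefore can also pass through steps of infinite index.\<close>

lemma spanning_double_ray:
  assumes a: "a \<in> S" "\<And>k::int. a [^] k = \<one> \<Longrightarrow> k = 0"
  shows "\<exists>h. cay.double_ray h \<and> range h = carrier G"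
proof -
  have "\<exists>h. cay.double_ray h \<and> range h = generate G (insert a F)" if "finite F" "F \<subseteq> S" for F
    using that
  proof (induction F rule: finite_induct)
    case empty
    then show ?case using double_ray_powers[OF a] by blast
  next
    case (insert s F)
    let ?H = "generate G (insert a F)"
    obtain h where h: "cay.double_ray h" "range h = ?H" using insert by auto
    have F: "insert a F \<subseteq> carrier G" and s: "s \<in> S" using insert S_sub a by auto
    have H: "subgroup ?H G" by (rule generate_is_subgroup[OF F])
    have eq: "insert a (insert s F) = insert s (insert a F)" by blast
    show ?case
    proof (cases "s \<in> ?H")
      case True
      then show ?thesis using h generate_insert_absorb[OF True F] unfolding eq by auto
    next
      case False
      obtain m :: nat where m: "\<And>k::int. s [^] k \<in> ?H \<longleftrightarrow> int m dvd k"
        by (rule power_index[OF H S_carrier[OF s]]) blast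
      show ?thesis
      proof (cases "m = 0")
        case True
        \<comment> \<open>Only the trivial power of \<open>s\<close> lies in the subgroup, so there
          is one row for each integer and the grid is the whole plane.\<close>
        obtain q :: "int \<Rightarrow> int \<times> int" where q: "bij q" "\<And>k. grid_adj (q k) (q (k + 1))"
          using plane_double_ray_exists by blast
        define h' where "h' k = h (fst (q k)) \<otimes> s [^] snd (q k)" for k
        have inj: "inj h" using h by (simp add: cay.double_ray_def)
        have "cay.double_ray h'"
          unfolding h'_def
        proof (rule double_ray_grid[OF h(1) s(1) _ bij_is_inj[OF q(1)] q(2)])
          show "s \<noteq> \<one>" using False subgroup.one_closed[OF H] by blast
          fix i j i' j' assume "h i \<otimes> s [^] (j::int) = h i' \<otimes> s [^] (j'::int)"
          then have "j = j' \<and> h i = h i'"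
            using coset_power_unique[OF H _ m, of "h i" "h i'" j j'] s h(2) True by auto
          then show "i = i' \<and> j = j'" using inj by (simp add: injD)
        qed
        moreover have "range h' = generate G (insert s (insert a F))"
        proof -
          have "range h' = {x \<otimes> s [^] (k::int) | x k. x \<in> ?H}"
          proof
            show "range h' \<subseteq> {x \<otimes> s [^] (k::int) | x k. x \<in> ?H}" using h(2) unfolding h'_def by blast
            show "{x \<otimes> s [^] (k::int) | x k. x \<in> ?H} \<subseteq> range h'"
            proof
              fix z assume "z \<in> {x \<otimes> s [^] (k::int) | x k. x \<in> ?H}"
              then obtain x j where "z = x \<otimes> s [^] (j::int)" "x \<in> range h" unfolding h(2) by blast
              then obtain i where z: "z = h i \<otimes> s [^] j" by blast
              obtain k where "q k = (i, j)" using bij_is_surj[OF q(1)] by (metis surjD)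
              then have "z = h' k" using z by (simp add: h'_def)
              then show "z \<in> range h'" by blast
            qed
          qed
          then show ?thesis using generate_insert[OF _ F] s by simp
        qed
        ultimately show ?thesis unfolding eq by blast
      next
        case m0: False
        have "s [^] int m \<in> ?H" using m by simp
        then have g: "generate G (insert s (insert a F)) = {x \<otimes> s [^] j | x j. x \<in> ?H \<and> j \<in> {0..<int m}}"
          using generate_insert_finite_index[OF _ F] s m0 by simp
        obtain h' where "cay.double_ray h'" "range h' = {x \<otimes> s [^] j | x j. x \<in> ?H \<and> j \<in> {0..<0 + int m}}"
          by (rule double_ray_strip[OF H h s False m, of "int m" 0]) (use m0 in simp_all)
        then show ?thesis unfolding eq g by auto
      qed
    qed
  qed
  from this[OF finS] show ?thesis using S_gen a by (simp add: insert_absorb)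
qed

end

section \<open>Ends of Cayley graphs of abelian groups\<close>

context cayley
begin

text \<open>A path from \<open>g\<close> to \<open>g \<otimes> t\<close> spells a word in
  \<open>S\<close>. Translated by \<open>f n\<close>, its finitely many vertices eventually all
  avoid \<open>X\<close>, so the path then joins its endpoints outside \<open>X\<close>. The word is
  built up by induction over \<open>generate\<close>.\<close>

lemma component_of_translate:
  assumes f: "\<And>g. g \<in> carrier G \<Longrightarrow> \<forall>\<^sub>F n in F. f n \<otimes> g \<notin> X" "\<And>n. f n \<in> carrier G"
    and t: "t \<in> carrier G" and g: "g \<in> carrier G"
  shows "\<forall>\<^sub>F n in F. f n \<otimes> (g \<otimes> t) \<in> component_of_avoiding \<Gamma> X (f n \<otimes> g)"
proof -
  have step: "\<forall>\<^sub>F n in F. f n \<otimes> (g \<otimes> s) \<in> component_of_avoiding \<Gamma> X (f n \<otimes> g)"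
    if s: "s \<in> S" and g: "g \<in> carrier G" for s g
  proof (cases "s = \<one>")
    case True
    then show ?thesis using g by simp
  next
    case False
    have "\<forall>\<^sub>F n in F. f n \<otimes> g \<notin> X \<and> f n \<otimes> (g \<otimes> s) \<notin> X"
      using f(1)[OF g] f(1)[of "g \<otimes> s"] g s by (simp add: eventually_conj)
    then show ?thesis
    proof (rule eventually_mono)
      fix n assume n: "f n \<otimes> g \<notin> X \<and> f n \<otimes> (g \<otimes> s) \<notin> X"
      have "{f n \<otimes> g, f n \<otimes> (g \<otimes> s)} \<in> edges \<Gamma>"
        using edgeI[of "f n \<otimes> g" s] f(2)[of n] g s False by (simp add: m_assoc)
      then show "f n \<otimes> (g \<otimes> s) \<in> component_of_avoiding \<Gamma> X (f n \<otimes> g)"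
        using cay.component_of_edge n by blast
    qed
  qed
  have "t \<in> generate G S" using t S_gen by simp
  then have "\<forall>g\<in>carrier G. \<forall>\<^sub>F n in F. f n \<otimes> (g \<otimes> t) \<in> component_of_avoiding \<Gamma> X (f n \<otimes> g)"
  proof induction
    case (eng t1 t2)
    have t: "t1 \<in> carrier G" "t2 \<in> carrier G" using eng.hyps S_gen by auto
    show ?case
    proof
      fix g assume g: "g \<in> carrier G"
      have 1: "\<forall>\<^sub>F n in F. f n \<otimes> (g \<otimes> t1) \<in> component_of_avoiding \<Gamma> X (f n \<otimes> g)"
        using eng.IH(1) g by blast
      have 2: "\<forall>\<^sub>F n in F. f n \<otimes> ((g \<otimes> t1) \<otimes> t2) \<in> component_of_avoiding \<Gamma> X (f n \<otimes> (g \<otimes> t1))"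
        using eng.IH(2) g t by blast
      have e: "(g \<otimes> t1) \<otimes> t2 = g \<otimes> (t1 \<otimes> t2)" using g t by (simp add: m_assoc)
      show "\<forall>\<^sub>F n in F. f n \<otimes> (g \<otimes> (t1 \<otimes> t2)) \<in> component_of_avoiding \<Gamma> X (f n \<otimes> g)"
        using 1 2 unfolding e by (rule eventually_elim2) (rule cay.component_of_trans)
    qed
  qed (use step S_inv in auto)
  then show ?thesis using g by blast
qed

text \<open>Translation by large powers of \<open>a\<close> carries a path off \<open>X\<close>.
  This joins consecutive powers of \<open>a\<close>, so that the far ones share one component, and
  it joins each \<open>a [^] n \<otimes> t\<close> to \<open>a [^] n\<close>.\<close>

lemma far_component:
  assumes a: "a \<in> S" "\<And>k::int. a [^] k = \<one> \<Longrightarrow> k = 0" and X: "finite X"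
  shows "\<exists>C\<in>components_avoiding \<Gamma> X. \<forall>t\<in>carrier G. \<forall>\<^sub>F n in sequentially. a [^] (n::nat) \<otimes> t \<in> C"
proof -
  have ac: "a \<in> carrier G" using a by simp
  have av: "\<forall>\<^sub>F n in sequentially. a [^] (n::nat) \<otimes> g \<notin> X" if "g \<in> carrier G" for g
    using eventually_avoids[OF inj_nat_pow[OF ac a(2) that] X] ac that by (simp add: m_comm)
  have tr: "\<forall>\<^sub>F n in sequentially. a [^] (n::nat) \<otimes> (\<one> \<otimes> t) \<in> component_of_avoiding \<Gamma> X (a [^] n \<otimes> \<one>)"
    if "t \<in> carrier G" for t
    by (rule component_of_translate[OF av]) (use that ac in auto)
  have "\<forall>\<^sub>F n in sequentially. a [^] (n::nat) \<otimes> a \<in> component_of_avoiding \<Gamma> X (a [^] n) \<and> a [^] n \<notin> X"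
    using tr[OF ac] av[OF one_closed] ac by (simp add: eventually_conj)
  then obtain N where N: "\<And>n. n \<ge> N \<Longrightarrow> a [^] (Suc n) \<in> component_of_avoiding \<Gamma> X (a [^] n)" "a [^] N \<notin> X"
    unfolding eventually_sequentially by auto
  let ?C = "component_of_avoiding \<Gamma> X (a [^] N)"
  have C: "a [^] n \<in> ?C" if "n \<ge> N" for n
    using that
  proof (induction rule: dec_induct)
    case (step n)
    then show ?case using N(1)[of n] cay.component_of_trans by blast
  qed simp
  have "\<forall>\<^sub>F n in sequentially. a [^] (n::nat) \<otimes> t \<in> ?C" if t: "t \<in> carrier G" for t
  proof -
    have "\<forall>\<^sub>F n in sequentially. a [^] (n::nat) \<otimes> t \<in> component_of_avoiding \<Gamma> X (a [^] n)"
      using tr[OF t] t ac by simp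
    moreover have "\<forall>\<^sub>F n in sequentially. a [^] (n::nat) \<in> ?C"
      unfolding eventually_sequentially using C by blast
    ultimately show ?thesis
      by (rule eventually_elim2) (use cay.component_of_trans in blast)
  qed
  moreover have "?C \<in> components_avoiding \<Gamma> X" using N(2) ac by (intro cay.component_of_in) simp
  ultimately show ?thesis by blast
qed

text \<open>Finitely many translates of the nonnegative powers of \<open>a\<close> lie in the far
  component up to a finite set \<open>Y\<close>, and a ray, being injective, leaves \<open>Y\<close>
  for good.\<close>

lemma sector_rays_equiv:
  assumes a: "a \<in> S" "\<And>k::int. a [^] k = \<one> \<Longrightarrow> k = 0"
    and W: "finite W" "W \<subseteq> carrier G"
    and r: "is_ray \<Gamma> r" "\<And>n. \<exists>t\<in>W. \<exists>j::nat. r n = a [^] j \<otimes> t"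
    and r': "is_ray \<Gamma> r'" "\<And>n. \<exists>t\<in>W. \<exists>j::nat. r' n = a [^] j \<otimes> t"
  shows "(r, r') \<in> ray_equiv \<Gamma>"
proof -
  have "\<exists>C\<in>components_avoiding \<Gamma> X. tail_in r C \<and> tail_in r' C" if X: "finite X" for X
  proof -
    obtain C where C: "C \<in> components_avoiding \<Gamma> X"
      "\<And>t. t \<in> carrier G \<Longrightarrow> \<forall>\<^sub>F n in sequentially. a [^] (n::nat) \<otimes> t \<in> C"
      using far_component[OF a X] by blast
    have "\<forall>\<^sub>F n in sequentially. \<forall>t\<in>W. a [^] (n::nat) \<otimes> t \<in> C"
      using C(2) W by (intro eventually_ball_finite) auto
    then obtain N where N: "\<And>n t. n \<ge> N \<Longrightarrow> t \<in> W \<Longrightarrow> a [^] (n::nat) \<otimes> t \<in> C"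
      unfolding eventually_sequentially by blast
    define Y where "Y = (\<lambda>(n, t). a [^] (n::nat) \<otimes> t) ` ({..<N} \<times> W)"
    have Y: "finite Y" using W by (simp add: Y_def)
    have "tail_in \<rho> C" if \<rho>: "is_ray \<Gamma> \<rho>" "\<And>n. \<exists>t\<in>W. \<exists>j::nat. \<rho> n = a [^] j \<otimes> t" for \<rho>
    proof -
      have "\<forall>\<^sub>F n in sequentially. \<rho> n \<notin> Y"
        using eventually_avoids Y \<rho>(1) unfolding is_ray_def by blast
      then obtain M where M: "\<And>n. n \<ge> M \<Longrightarrow> \<rho> n \<notin> Y" unfolding eventually_sequentially by blast
      have "\<rho> n \<in> C" if "n \<ge> M" for n
      proof -
        obtain t j where tj: "t \<in> W" "\<rho> n = a [^] (j::nat) \<otimes> t" using \<rho>(2) by blast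
        have "\<not> j < N"
        proof
          assume "j < N"
          then have "\<rho> n \<in> Y" unfolding Y_def using tj by force
          then show False using M[OF that] by blast
        qed
        then show ?thesis using N[of j t] tj by simp
      qed
      then show ?thesis unfolding tail_in_def by blast
    qed
    then show ?thesis using C(1) r r' by blast
  qed
  then show ?thesis using r(1) r'(1) unfolding ray_equiv_def by blast
qed

text \<open>The invariant of the two-ended case. It places the two halves of \<open>h\<close> in
  sectors as in \<open>sector_rays_equiv\<close>, for \<open>a\<close> and for \<open>inv a\<close>,
  so double rays that are sided for the same \<open>W\<close> have the same ends. Passing to
  finitely many rows only enlarges \<open>W\<close>.\<close>

definition sided :: "'a \<Rightarrow> 'a set \<Rightarrow> (int \<Rightarrow> 'a) \<Rightarrow> bool" where
  "sided a W h \<longleftrightarrow> finite W \<and> W \<subseteq> carrier G \<and>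
     (\<forall>i. \<exists>t\<in>W. \<exists>k::int. h i = a [^] k \<otimes> t \<and> (if i \<ge> 0 then k \<ge> 0 else k \<le> 0))"

lemma sided_mono: "\<lbrakk>sided a W h; W \<subseteq> W'; finite W'; W' \<subseteq> carrier G\<rbrakk> \<Longrightarrow> sided a W' h"
  unfolding sided_def by blast

lemma sided_pos_equiv:
  assumes a: "a \<in> S" "\<And>k::int. a [^] k = \<one> \<Longrightarrow> k = 0"
    and h: "cay.double_ray h" "sided a W h" and h': "cay.double_ray h'" "sided a W h'"
  shows "(\<lambda>n. h (int n), \<lambda>n. h' (int n)) \<in> ray_equiv \<Gamma>"
proof (rule sector_rays_equiv[OF a])
  have *: "\<exists>t\<in>W. \<exists>j::nat. h (int n) = a [^] j \<otimes> t" if h: "sided a W h" for h n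
  proof -
    obtain t k where t: "t \<in> W" "h (int n) = a [^] (k::int) \<otimes> t" "k \<ge> 0"
      using h unfolding sided_def by (metis of_nat_0_le_iff)
    then have "h (int n) = a [^] (nat k) \<otimes> t" using int_pow_int[of G a "nat k"] by simp
    then show ?thesis using t by blast
  qed
  show "\<exists>t\<in>W. \<exists>j::nat. h (int n) = a [^] j \<otimes> t" for n using * h by blast
  show "\<exists>t\<in>W. \<exists>j::nat. h' (int n) = a [^] j \<otimes> t" for n using * h' by blast
qed (use h h' cay.is_ray_pos in \<open>auto simp: sided_def\<close>)

lemma sided_neg_equiv:
  assumes a: "a \<in> S" "\<And>k::int. a [^] k = \<one> \<Longrightarrow> k = 0"
    and h: "cay.double_ray h" "sided a W h" and h': "cay.double_ray h'" "sided a W h'"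
  shows "(\<lambda>n. h (- int n), \<lambda>n. h' (- int n)) \<in> ray_equiv \<Gamma>"
proof -
  \<comment> \<open>At index 0 \<open>sided\<close> gives a nonnegative exponent, but the negative
    half also starts there; so \<open>h 0\<close> and \<open>h' 0\<close> are added as translates
    with exponent 0.\<close>
  define W' where "W' = insert (h 0) (insert (h' 0) W)"
  have hc: "h 0 \<in> carrier G" "h' 0 \<in> carrier G"
    using cay.double_ray_vert[OF h(1), of 0] cay.double_ray_vert[OF h'(1), of 0] by simp_all
  show ?thesis
  proof (rule sector_rays_equiv[of "inv a" W'])
    show "inv a \<in> S" using S_inv a by simp
    show "k = 0" if "inv a [^] k = \<one>" for k :: int
      using that a(2)[of "- k"] a(1) by (simp add: int_pow_inv int_pow_neg)
    have *: "\<exists>t\<in>W'. \<exists>j::nat. h (- int n) = inv a [^] j \<otimes> t" if h: "sided a W h" "h 0 \<in> W'" "h 0 \<in> carrier G" for h n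
    proof (cases "n = 0")
      case True
      then have "h (- int n) = inv a [^] (0::nat) \<otimes> h 0" using h(3) by simp
      then show ?thesis using h(2) by blast
    next
      case False
      then have "\<not> - int n \<ge> 0" by simp
      then obtain t k where t: "t \<in> W" "h (- int n) = a [^] (k::int) \<otimes> t" "k \<le> 0"
        using h unfolding sided_def by (metis (full_types))
      have "a [^] k = inv a [^] (nat (- k))"
        using int_pow_int[of G "inv a" "nat (- k)"] t(3) a(1) by (simp add: int_pow_inv int_pow_neg)
      then have "h (- int n) = inv a [^] nat (- k) \<otimes> t" using t(2) by simp
      moreover have "t \<in> W'" using t(1) by (simp add: W'_def)
      ultimately show ?thesis by blast
    qed
    show "\<exists>t\<in>W'. \<exists>j::nat. h (- int n) = inv a [^] j \<otimes> t" for n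
      by (rule *) (use h hc in \<open>auto simp: W'_def\<close>)
    show "\<exists>t\<in>W'. \<exists>j::nat. h' (- int n) = inv a [^] j \<otimes> t" for n
      by (rule *) (use h' hc in \<open>auto simp: W'_def\<close>)
    show "finite W'" "W' \<subseteq> carrier G" using h(2) hc by (auto simp: W'_def sided_def)
  qed (use h h' cay.is_ray_neg in auto)
qed

text \<open>If every generator has a power in \<open>\<langle>a\<rangle>\<close>, then \<open>g\<^sup>K = a\<^bsup>f g\<^esup>\<close> for a homomorphism \<open>f\<close> to the integers.
  It changes by a bounded amount along edges and has finite level sets, so a large band
  \<open>\<bar>f\<bar> \<le> D\<close> separates the two ends.\<close>

lemma height_function:
  assumes a: "a \<in> S" "\<And>k::int. a [^] k = \<one> \<Longrightarrow> k = 0"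
    and tor: "\<And>s. s \<in> S \<Longrightarrow> \<exists>m::nat. m > 0 \<and> s [^] m \<in> generate G {a}"
  obtains f :: "'a \<Rightarrow> int" where "\<And>x y. \<lbrakk>x \<in> carrier G; y \<in> carrier G\<rbrakk> \<Longrightarrow> f (x \<otimes> y) = f x + f y" "f a > 0"
proof -
  have ac: "a \<in> carrier G" using a by simp
  have sub: "subgroup (generate G {a}) G" using generate_is_subgroup ac by simp
  have pw: "x [^] (n::nat) \<in> generate G {a}" if "x \<in> generate G {a}" for x n
    using subgroup_int_pow_closed[OF sub that, of "int n"] by (simp add: int_pow_int)
  have inj: "i = j" if "a [^] (i::int) = a [^] j" for i j
  proof -
    have "a [^] (i - j) = \<one>" using that ac by (simp add: int_pow_diff)
    then show ?thesis using a(2) by fastforce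
  qed
  \<comment> \<open>Multiplying the individual exponents gives one \<open>K\<close> for all
    generators, and commutativity extends it to all of \<open>G\<close>. The exponent of
    \<open>a\<close> read off by \<open>f\<close> is unique because \<open>a\<close> has infinite
    order.\<close>
  have "\<exists>K::nat. K > 0 \<and> (\<forall>s\<in>F. s [^] K \<in> generate G {a})" if "finite F" "F \<subseteq> S" for F
    using that
  proof (induction F rule: finite_induct)
    case empty then show ?case by auto
  next
    case (insert s F)
    then obtain K :: nat where K: "K > 0" "\<And>t. t \<in> F \<Longrightarrow> t [^] K \<in> generate G {a}" by auto
    obtain m :: nat where m: "m > 0" "s [^] m \<in> generate G {a}" using tor[of s] insert by auto
    have "t [^] (m * K) \<in> generate G {a}" if "t \<in> insert s F" for t
    proof (cases "t = s")
      case True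
      then show ?thesis using pw[OF m(2), of K] insert.prems by (simp add: nat_pow_pow)
    next
      case False
      then show ?thesis using pw[OF K(2)[of t], of m] insert.prems that by (auto simp: nat_pow_pow mult.commute)
    qed
    then show ?case using m(1) K(1) by (intro exI[of _ "m * K"]) simp
  qed
  from this[OF finS subset_refl]
  obtain K :: nat where K: "K > 0" "\<And>s. s \<in> S \<Longrightarrow> s [^] K \<in> generate G {a}" by blast
  have "x [^] K \<in> generate G {a}" if "x \<in> carrier G" for x
  proof -
    have "x \<in> generate G S" using that S_gen by simp
    then show ?thesis
    proof induction
      case one then show ?case using generate.one[of G "{a}"] by simp
    next
      case (eng x y)
      then have "x \<in> carrier G" "y \<in> carrier G" using S_gen by auto
      then have "(x \<otimes> y) [^] K = x [^] K \<otimes> y [^] K" by (simp add: nat_pow_distrib)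
      then show ?case using eng subgroup.m_closed[OF sub] by simp
    qed (use K S_inv in auto)
  qed
  then have "\<exists>k::int. x [^] K = a [^] k" if "x \<in> carrier G" for x
    using that unfolding generate_pow[OF ac] by auto
  then obtain f where f: "\<And>x. x \<in> carrier G \<Longrightarrow> x [^] K = a [^] (f x :: int)" by metis
  have hom: "f (x \<otimes> y) = f x + f y" if "x \<in> carrier G" "y \<in> carrier G" for x y
  proof (rule inj)
    show "a [^] f (x \<otimes> y) = a [^] (f x + f y)"
      using that f[of x] f[of y] f[of "x \<otimes> y"] ac by (simp add: nat_pow_distrib int_pow_mult)
  qed
  have "f a = int K" using f[OF ac] inj by (simp flip: int_pow_int)
  then show ?thesis using K(1) by (intro that[of f] hom) simp_all
qed

text \<open>Outside the band the positive half of \<open>h\<close> has heights above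
  \<open>D\<close> and the negative half heights below \<open>- D\<close>. An edge changes the
  height by at most \<open>D\<close>, so no walk off the band gets from one to the other.\<close>

lemma sided_ends_distinct:
  assumes a: "a \<in> S" "\<And>k::int. a [^] k = \<one> \<Longrightarrow> k = 0"
    and tor: "\<And>s. s \<in> S \<Longrightarrow> \<exists>m::nat. m > 0 \<and> s [^] m \<in> generate G {a}"
    and h: "cay.double_ray h" "sided a W h"
    and cover: "\<And>x. x \<in> carrier G \<Longrightarrow> \<exists>t\<in>W. \<exists>k::int. x = a [^] k \<otimes> t"
  shows "(\<lambda>n. h (int n), \<lambda>n. h (- int n)) \<notin> ray_equiv \<Gamma>"
proof
  assume eq: "(\<lambda>n. h (int n), \<lambda>n. h (- int n)) \<in> ray_equiv \<Gamma>"
  have ac: "a \<in> carrier G" using a by simp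
  have W: "finite W" "W \<subseteq> carrier G" using h(2) by (auto simp: sided_def)
  obtain f :: "'a \<Rightarrow> int" where f: "\<And>x y. \<lbrakk>x \<in> carrier G; y \<in> carrier G\<rbrakk> \<Longrightarrow> f (x \<otimes> y) = f x + f y" "f a > 0"
    using height_function[OF a tor] by blast
  have f1: "f \<one> = 0" using f(1)[of \<one> \<one>] by simp
  have fn: "f (a [^] (n::nat)) = int n * f a" for n
    by (induction n) (use f(1) f1 ac in \<open>auto simp: algebra_simps\<close>)
  have fk: "f (a [^] (k::int)) = k * f a" for k
  proof (cases "k \<ge> 0")
    case True
    then show ?thesis using fn[of "nat k"] by (simp flip: int_pow_int)
  next
    case False
    have "f (a [^] k) + f (a [^] (- k)) = 0"
      using f(1)[of "a [^] k" "a [^] (- k)"] f1 ac by (simp add: int_pow_neg)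
    moreover have "f (a [^] (- k)) = - k * f a" using fn[of "nat (- k)"] False by (simp flip: int_pow_int)
    ultimately show ?thesis by simp
  qed
  have ft: "f (a [^] (k::int) \<otimes> t) = k * f a + f t" if "t \<in> W" for k t
    using f(1)[of "a [^] k" t] fk ac that W by auto
  \<comment> \<open>One bound for two purposes: on \<open>S\<close> it limits the change of height
    along an edge, on \<open>W\<close> the offset of a translate, so that outside the band the sign
    of \<open>k\<close> decides the side.\<close>
  obtain D where D: "\<And>x. x \<in> S \<union> W \<Longrightarrow> \<bar>f x\<bar> \<le> D"
  proof -
    have "\<bar>f x\<bar> \<le> (\<Sum>y\<in>S \<union> W. \<bar>f y\<bar>)" if "x \<in> S \<union> W" for x
      using that finS W by (intro member_le_sum) auto
    then show ?thesis using that by blast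
  qed
  define X where "X = {g \<in> carrier G. \<bar>f g\<bar> \<le> D}"
  have "X \<subseteq> (\<lambda>(k, t). a [^] k \<otimes> t) ` ({- (2 * D)..2 * D} \<times> W)"
  proof
    fix x assume x: "x \<in> X"
    then obtain t k where tk: "t \<in> W" "x = a [^] (k::int) \<otimes> t" using cover unfolding X_def by blast
    have "\<bar>k * f a + f t\<bar> \<le> D" using x ft[OF tk(1)] tk(2) by (simp add: X_def)
    then have "\<bar>k * f a\<bar> \<le> 2 * D" using D[of t] tk(1) by simp
    \<comment> \<open>\<open>f a\<close> is at least 1, so the bound on \<open>k * f a\<close>
      bounds \<open>k\<close>, and the band is finite.\<close>
    moreover have "\<bar>k\<bar> * 1 \<le> \<bar>k\<bar> * f a" using f(2) by (intro mult_left_mono) auto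
    then have "\<bar>k\<bar> \<le> \<bar>k * f a\<bar>" using f(2) by (simp add: abs_mult)
    ultimately have "k \<in> {- (2 * D)..2 * D}" by auto
    then show "x \<in> (\<lambda>(k, t). a [^] k \<otimes> t) ` ({- (2 * D)..2 * D} \<times> W)" using tk by force
  qed
  then have finX: "finite X" by (rule finite_subset) (use W in auto)
  obtain C where C: "C \<in> components_avoiding \<Gamma> X" "tail_in (\<lambda>n. h (int n)) C" "tail_in (\<lambda>n. h (- int n)) C"
    using eq finX unfolding ray_equiv_def X_def by auto
  obtain m m' where mm: "\<And>n. n \<ge> m \<Longrightarrow> h (int n) \<in> C" "\<And>n. n \<ge> m' \<Longrightarrow> h (- int n) \<in> C"
    using C(2,3) unfolding tail_in_def by blast
  \<comment> \<open>\<open>Suc\<close> makes the index negative, as \<open>sided\<close> gives a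
    nonpositive exponent only there.\<close>
  have m: "h (int m) \<in> C" "h (- int (Suc m')) \<in> C" by (rule mm, simp)+
  have CX: "C \<subseteq> carrier G - X" using cay.component_subset[OF C(1)] by simp
  have out: "\<bar>f x\<bar> > D" if "x \<in> carrier G - X" for x using that by (auto simp: X_def)
  obtain t k where 1: "t \<in> W" "h (int m) = a [^] (k::int) \<otimes> t" "k \<ge> 0"
    using h(2) unfolding sided_def by (metis of_nat_0_le_iff)
  have "k * f a \<ge> 0" using 1(3) f(2) by simp
  \<comment> \<open>The height is at least \<open>- D\<close>, since \<open>k * f a\<close> is
    nonnegative and \<open>f t \<ge> - D\<close>; lying outside the band it must exceed
    \<open>D\<close>.\<close>
  then have p: "f (h (int m)) > D"
    using ft[OF 1(1), of k] 1 D[of t] out[of "h (int m)"] CX m(1) by auto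
  have "\<not> - int (Suc m') \<ge> 0" by simp
  then obtain t' k' where 2: "t' \<in> W" "h (- int (Suc m')) = a [^] (k'::int) \<otimes> t'" "k' \<le> 0"
    using h(2) unfolding sided_def by (metis (full_types))
  have "k' * f a \<le> 0" using 2(3) f(2) by (simp add: mult_le_0_iff)
  then have q: "f (h (- int (Suc m'))) < - D"
    using ft[OF 2(1), of k'] 2 D[of t'] out[of "h (- int (Suc m'))"] CX m(2) by auto
  have "f x > D" if "x \<in> component_of_avoiding \<Gamma> X (h (int m))" for x
    using that unfolding component_of_avoiding_def mem_Collect_eq
  proof (induction rule: rtrancl_induct)
    case base then show ?case by (rule p)
  next
    case (step y z)
    then have yz: "{y, z} \<in> edges \<Gamma>" "z \<in> carrier G - X" by auto
    obtain s where s: "s \<in> S" "z = y \<otimes> s" "y \<in> carrier G" using edge_step[OF yz(1)] by blast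
    then have "f z = f y + f s" using f(1) by simp
    \<comment> \<open>From above \<open>D\<close>, a step of size at most \<open>D\<close> stays
      positive, and outside the band positive means above \<open>D\<close>.\<close>
    then show ?case using step.IH D[of s] s out[OF yz(2)] by auto
  qed
  then have "f (h (- int (Suc m'))) > D"
    using cay.component_eq_component_of[OF C(1) m(1)] m(2) by blast
  then show False using q D[of a] a by auto
qed

section \<open>One end for two independent generators\<close>

lemma line_in_component:
  assumes c: "c \<in> S" "c \<noteq> \<one>" and g: "g \<in> carrier G" and X: "\<And>n::nat. g \<otimes> c [^] n \<notin> X"
  shows "g \<otimes> c [^] (n::nat) \<in> component_of_avoiding \<Gamma> X g"
proof (induction n)
  case 0
  then show ?case using g by simp
next
  case (Suc n)
  have "{g \<otimes> c [^] n, g \<otimes> c [^] Suc n} \<in> edges \<Gamma>"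
    using edgeI[of "g \<otimes> c [^] n" c] c g by (simp add: m_assoc)
  then have "g \<otimes> c [^] Suc n \<in> component_of_avoiding \<Gamma> X (g \<otimes> c [^] n)"
    using cay.component_of_edge X by blast
  then show ?case using Suc cay.component_of_trans by blast
qed

text \<open>For independent \<open>a\<close> and \<open>b\<close>, only finitely many vertices have both their \<open>a\<close>-line and their
  \<open>b\<close>-line meeting \<open>X\<close>. Any other two vertices \<open>g\<close>, \<open>g'\<close> are joined outside \<open>X\<close>: along such lines to
  \<open>g a\<^sup>n b\<^sup>m\<close> and \<open>g' a\<^sup>n b\<^sup>m\<close> for large \<open>n\<close> and \<open>m\<close>, and these by a far translate of a path from \<open>g\<close> to \<open>g'\<close>.\<close>

lemma one_ended:
  assumes a: "a \<in> S" and b: "b \<in> S"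
    and indep: "\<And>(i::int) (j::int). a [^] i \<otimes> b [^] j = \<one> \<Longrightarrow> i = 0 \<and> j = 0"
    and r: "is_ray \<Gamma> r" and r': "is_ray \<Gamma> r'"
  shows "(r, r') \<in> ray_equiv \<Gamma>"
proof -
  have ac: "a \<in> carrier G" and bc: "b \<in> carrier G" using a b by auto
  have a1: "a \<noteq> \<one>" using indep[of 1 0] by auto
  have b1: "b \<noteq> \<one>" using indep[of 0 1] by auto
  have infb: "k = 0" if "b [^] k = \<one>" for k :: int using indep[of 0 k] that bc by simp
  have "\<exists>C\<in>components_avoiding \<Gamma> X. tail_in r C \<and> tail_in r' C" if X: "finite X" "X \<subseteq> carrier G" for X
  proof -
    define B where "B = {g \<in> carrier G. (\<exists>k::int. g \<otimes> a [^] k \<in> X) \<and> (\<exists>k::int. g \<otimes> b [^] k \<in> X)}"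
    have "finite B"
    proof -
      \<comment> \<open>For fixed \<open>x\<close> and \<open>y\<close> there is at most one such
        \<open>g\<close>: two of them would differ both by a power of \<open>a\<close> and by a
        power of \<open>b\<close>, and independence makes these trivial.\<close>
      define Y where "Y x y = {g \<in> carrier G. (\<exists>k::int. g \<otimes> a [^] k = x) \<and> (\<exists>k::int. g \<otimes> b [^] k = y)}" for x y
      have "g = g'" if gY: "g \<in> Y x y" "g' \<in> Y x y" for g g' x y
      proof -
        obtain i i' j j' where e: "g \<otimes> a [^] (i::int) = x" "g' \<otimes> a [^] (i'::int) = x"
          "g \<otimes> b [^] (j::int) = y" "g' \<otimes> b [^] (j'::int) = y" and g: "g \<in> carrier G" "g' \<in> carrier G"
          using gY by (auto simp: Y_def)
        have A: "inv g' \<otimes> g = a [^] (i' - i)"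
        proof -
          have "g \<otimes> a [^] i \<otimes> (inv g' \<otimes> inv (a [^] i)) = g' \<otimes> a [^] i' \<otimes> (inv g' \<otimes> inv (a [^] i))"
            using e by simp
          moreover have "g \<otimes> a [^] i \<otimes> (inv g' \<otimes> inv (a [^] i)) = (inv g' \<otimes> g) \<otimes> (a [^] i \<otimes> inv (a [^] i))"
            using g ac by (simp only: m_ac inv_closed m_closed int_pow_closed)
          moreover have "g' \<otimes> a [^] i' \<otimes> (inv g' \<otimes> inv (a [^] i)) = (g' \<otimes> inv g') \<otimes> (a [^] i' \<otimes> inv (a [^] i))"
            using g ac by (simp only: m_ac inv_closed m_closed int_pow_closed)
          ultimately show ?thesis using g ac by (simp add: int_pow_diff)
        qed
        have Bq: "inv g' \<otimes> g = b [^] (j' - j)"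
        proof -
          have "g \<otimes> b [^] j \<otimes> (inv g' \<otimes> inv (b [^] j)) = g' \<otimes> b [^] j' \<otimes> (inv g' \<otimes> inv (b [^] j))"
            using e by simp
          moreover have "g \<otimes> b [^] j \<otimes> (inv g' \<otimes> inv (b [^] j)) = (inv g' \<otimes> g) \<otimes> (b [^] j \<otimes> inv (b [^] j))"
            using g bc by (simp only: m_ac inv_closed m_closed int_pow_closed)
          moreover have "g' \<otimes> b [^] j' \<otimes> (inv g' \<otimes> inv (b [^] j)) = (g' \<otimes> inv g') \<otimes> (b [^] j' \<otimes> inv (b [^] j))"
            using g bc by (simp only: m_ac inv_closed m_closed int_pow_closed)
          ultimately show ?thesis using g bc by (simp add: int_pow_diff)
        qed
        have "a [^] (i' - i) \<otimes> inv (b [^] (j' - j)) = \<one>"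
          using A Bq ac by (metis int_pow_closed r_inv)
        then have "a [^] (i' - i) \<otimes> b [^] (- (j' - j)) = \<one>"
          using bc by (simp only: int_pow_neg)
        then have "i' - i = 0" using indep by blast
        then have "g = g'" using A g by (metis int_pow_0 inv_equality inv_inv inv_closed)
        then show ?thesis .
      qed
      then have "finite (Y x y)" for x y
        by (cases "Y x y = {}") (metis finite.emptyI, metis finite.simps insertI1 is_singletonI' is_singleton_def)
      moreover have "B \<subseteq> (\<Union>x\<in>X. \<Union>y\<in>X. Y x y)" by (auto simp: B_def Y_def)
      ultimately show ?thesis using X(1) by (meson finite_UN_I finite_subset)
    qed
    \<comment> \<open>\<open>n\<close> is chosen first, and \<open>m\<close> may depend on it. A
      vertex outside \<open>B\<close> has its whole \<open>a\<close>-line or its whole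
      \<open>b\<close>-line off \<open>X\<close>; the walk follows that line until the crossing line
      avoids \<open>X\<close> as well, and then the crossing line.\<close>
    have reach: "\<forall>\<^sub>F n::nat in sequentially. \<forall>\<^sub>F m::nat in sequentially.
        g \<otimes> (a [^] n \<otimes> b [^] m) \<in> component_of_avoiding \<Gamma> X g"
      if g: "g \<in> carrier G" "g \<notin> B" for g
    proof (cases "\<forall>k::int. g \<otimes> a [^] k \<notin> X")
      case True
      then have 1: "g \<otimes> a [^] n \<in> component_of_avoiding \<Gamma> X g" for n :: nat
        by (intro line_in_component[OF a a1 g(1)]) (metis int_pow_int)
      have "\<forall>\<^sub>F n::nat in sequentially. \<forall>k::int. g \<otimes> a [^] n \<otimes> b [^] k \<notin> X"
        by (rule eventually_line_avoids[OF ac bc X(1) g(1)]) (use indep in blast)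
      then show ?thesis
      proof (rule eventually_mono)
        fix n :: nat assume n: "\<forall>k::int. g \<otimes> a [^] n \<otimes> b [^] k \<notin> X"
        have "g \<otimes> a [^] n \<otimes> b [^] m \<in> component_of_avoiding \<Gamma> X (g \<otimes> a [^] n)" for m :: nat
          by (intro line_in_component[OF b b1]) (use n g ac in \<open>auto simp flip: int_pow_int\<close>)
        then have "g \<otimes> (a [^] n \<otimes> b [^] m) \<in> component_of_avoiding \<Gamma> X g" for m :: nat
          using cay.component_of_trans[OF 1[of n]] g ac bc by (simp add: m_assoc)
        then show "\<forall>\<^sub>F m::nat in sequentially. g \<otimes> (a [^] n \<otimes> b [^] m) \<in> component_of_avoiding \<Gamma> X g"
          by simp
      qed
    next
      case False
      then have "\<forall>k::int. g \<otimes> b [^] k \<notin> X" using g by (auto simp: B_def)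
      then have 1: "g \<otimes> b [^] m \<in> component_of_avoiding \<Gamma> X g" for m :: nat
        by (intro line_in_component[OF b b1 g(1)]) (metis int_pow_int)
      have ev: "\<forall>\<^sub>F m::nat in sequentially. \<forall>k::int. g \<otimes> b [^] m \<otimes> a [^] k \<notin> X"
        by (rule eventually_line_avoids[OF bc ac X(1) g(1)]) (use indep ac bc in \<open>auto simp: m_comm\<close>)
      have "\<forall>\<^sub>F m::nat in sequentially. g \<otimes> (a [^] n \<otimes> b [^] m) \<in> component_of_avoiding \<Gamma> X g" for n :: nat
        using ev
      proof (rule eventually_mono)
        fix m :: nat assume m: "\<forall>k::int. g \<otimes> b [^] m \<otimes> a [^] k \<notin> X"
        have "g \<otimes> b [^] m \<otimes> a [^] n \<in> component_of_avoiding \<Gamma> X (g \<otimes> b [^] m)"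
          by (intro line_in_component[OF a a1]) (use m g bc in \<open>auto simp flip: int_pow_int\<close>)
        moreover have "g \<otimes> b [^] m \<otimes> a [^] n = g \<otimes> (a [^] n \<otimes> b [^] m)" using g ac bc by (simp add: m_ac)
        ultimately show "g \<otimes> (a [^] n \<otimes> b [^] m) \<in> component_of_avoiding \<Gamma> X g"
          using cay.component_of_trans[OF 1[of m]] by simp
      qed
      then show ?thesis by simp
    qed
    have conn: "g' \<in> component_of_avoiding \<Gamma> X g"
      if g: "g \<in> carrier G" "g \<notin> B" and g': "g' \<in> carrier G" "g' \<notin> B" for g g'
    proof -
      have "\<forall>\<^sub>F n::nat in sequentially.
          (\<forall>\<^sub>F m::nat in sequentially. g \<otimes> (a [^] n \<otimes> b [^] m) \<in> component_of_avoiding \<Gamma> X g) \<and>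
          (\<forall>\<^sub>F m::nat in sequentially. g' \<otimes> (a [^] n \<otimes> b [^] m) \<in> component_of_avoiding \<Gamma> X g')"
        by (intro eventually_conj reach g g')
      then obtain n :: nat where n:
        "\<forall>\<^sub>F m::nat in sequentially. g \<otimes> (a [^] n \<otimes> b [^] m) \<in> component_of_avoiding \<Gamma> X g"
        "\<forall>\<^sub>F m::nat in sequentially. g' \<otimes> (a [^] n \<otimes> b [^] m) \<in> component_of_avoiding \<Gamma> X g'"
        using eventually_happens'[OF sequentially_bot] by blast
      \<comment> \<open>With \<open>n\<close> fixed, the translates by
        \<open>a [^] n \<otimes> b [^] m\<close> still leave \<open>X\<close>, because
        \<open>b\<close> has infinite order.\<close>
      have av: "\<forall>\<^sub>F m::nat in sequentially. (a [^] n \<otimes> b [^] m) \<otimes> u \<notin> X" if u: "u \<in> carrier G" for u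
      proof -
        have "\<forall>\<^sub>F m::nat in sequentially. (u \<otimes> a [^] n) \<otimes> b [^] m \<notin> X"
          by (rule eventually_avoids[OF inj_nat_pow[OF bc infb] X(1)]) (use u ac in auto)
        moreover have "(u \<otimes> a [^] n) \<otimes> b [^] m = (a [^] n \<otimes> b [^] m) \<otimes> u" for m :: nat
          using u ac bc by (simp add: m_ac)
        ultimately show ?thesis by simp
      qed
      have "\<forall>\<^sub>F m::nat in sequentially. (a [^] n \<otimes> b [^] m) \<otimes> (g \<otimes> (inv g \<otimes> g')) \<in>
          component_of_avoiding \<Gamma> X ((a [^] n \<otimes> b [^] m) \<otimes> g)"
        by (rule component_of_translate[OF av]) (use g g' ac bc in auto)
      then have "\<forall>\<^sub>F m::nat in sequentially. g' \<otimes> (a [^] n \<otimes> b [^] m) \<in>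
          component_of_avoiding \<Gamma> X (g \<otimes> (a [^] n \<otimes> b [^] m))"
      proof -
        have 1: "g \<otimes> (inv g \<otimes> g') = g'" using g g' by (simp flip: m_assoc)
        have 2: "(a [^] n \<otimes> b [^] m) \<otimes> u = u \<otimes> (a [^] n \<otimes> b [^] m)" if "u \<in> carrier G" for u and m :: nat
          using that ac bc by (intro m_comm) auto
        assume "\<forall>\<^sub>F m::nat in sequentially. (a [^] n \<otimes> b [^] m) \<otimes> (g \<otimes> (inv g \<otimes> g')) \<in>
          component_of_avoiding \<Gamma> X ((a [^] n \<otimes> b [^] m) \<otimes> g)"
        then show ?thesis unfolding 1 2[OF g(1)] 2[OF g'(1)] .
      qed
      then have "\<forall>\<^sub>F m::nat in sequentially. g' \<in> component_of_avoiding \<Gamma> X g"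
        using n
      proof eventually_elim
        case (elim m)
        then show ?case using cay.component_of_sym cay.component_of_trans by metis
      qed
      then show ?thesis by simp
    qed
    have av: "\<forall>\<^sub>F n in sequentially. \<rho> n \<notin> B \<union> X" if "is_ray \<Gamma> \<rho>" for \<rho>
      using eventually_avoids[of \<rho> "B \<union> X"] that \<open>finite B\<close> X(1) by (auto simp: is_ray_def)
    obtain N where N: "\<And>n. n \<ge> N \<Longrightarrow> r n \<notin> B \<union> X" using av[OF r] unfolding eventually_sequentially by blast
    obtain N' where N': "\<And>n. n \<ge> N' \<Longrightarrow> r' n \<notin> B \<union> X" using av[OF r'] unfolding eventually_sequentially by blast
    have rc: "r n \<in> carrier G" "r' n \<in> carrier G" for n using r r' by (auto simp: is_ray_def)
    let ?C = "component_of_avoiding \<Gamma> X (r N)"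
    have "?C \<in> components_avoiding \<Gamma> X" using N[of N] rc by (intro cay.component_of_in) simp
    moreover have "tail_in r ?C" unfolding tail_in_def using conn N rc by (metis UnCI order_refl)
    moreover have "tail_in r' ?C" unfolding tail_in_def using conn N N' rc by (metis UnCI order_refl)
    ultimately show ?thesis by blast
  qed
  then show ?thesis using r r' by (auto simp: ray_equiv_def)
qed

section \<open>Two disjoint double rays in the two-ended case\<close>

lemma sided_strip:
  assumes h: "sided a W h" "a \<in> carrier G" and s: "s \<in> carrier G" and J: "finite J"
    and h': "\<And>k. \<exists>i j. h' k = h i \<otimes> s [^] (j::int) \<and> (i \<ge> 0 \<longleftrightarrow> k \<ge> 0) \<and> j \<in> J"
  shows "sided a ((\<lambda>(t, j). t \<otimes> s [^] j) ` (W \<times> J)) h'"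
  unfolding sided_def
proof (intro conjI allI)
  have W: "finite W" "W \<subseteq> carrier G" using h by (auto simp: sided_def)
  show "finite ((\<lambda>(t, j). t \<otimes> s [^] j) ` (W \<times> J))" using W J by simp
  show "(\<lambda>(t, j). t \<otimes> s [^] j) ` (W \<times> J) \<subseteq> carrier G" using W s by auto
  fix k
  obtain i j where ij: "h' k = h i \<otimes> s [^] (j::int)" "i \<ge> 0 \<longleftrightarrow> k \<ge> 0" "j \<in> J" using h' by blast
  obtain t l where t: "t \<in> W" "h i = a [^] (l::int) \<otimes> t" "if i \<ge> 0 then l \<ge> 0 else l \<le> 0"
    using h(1) unfolding sided_def by meson
  have "h' k = a [^] l \<otimes> (t \<otimes> s [^] j)" using ij t W h(2) s by (auto simp: m_assoc)
  moreover have "t \<otimes> s [^] j \<in> (\<lambda>(t, j). t \<otimes> s [^] j) ` (W \<times> J)" using t ij by force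
  ultimately show "\<exists>t\<in>(\<lambda>(t, j). t \<otimes> s [^] j) ` (W \<times> J). \<exists>l::int. h' k = a [^] l \<otimes> t \<and> (if k \<ge> 0 then l \<ge> 0 else l \<le> 0)"
    using t(3) ij(2) by (intro bexI[of _ "t \<otimes> s [^] j"] exI[of _ l]) simp_all
qed

text \<open>The induction carries a sided spanning double ray, from which the next step starts, and,
  once the group is larger than that of \<open>a\<close>, the pair. At a proper step the pair
  consists of the old spanning double ray, as row 0, and a snake through rows 1 to
  \<open>m - 1\<close>.\<close>

lemma two_sided_double_rays:
  assumes a: "a \<in> S" "\<And>k::int. a [^] k = \<one> \<Longrightarrow> k = 0"
    and tor: "\<And>s. s \<in> S \<Longrightarrow> \<exists>m::nat. m > 0 \<and> s [^] m \<in> generate G {a}"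
    and ne: "generate G {a} \<noteq> carrier G"
  shows "\<exists>h h' W. cay.double_ray h \<and> cay.double_ray h' \<and> sided a W h \<and> sided a W h' \<and>
           range h \<inter> range h' = {} \<and> range h \<union> range h' = carrier G"
proof -
  have ac: "a \<in> carrier G" using a by simp
  have "(\<exists>h W. cay.double_ray h \<and> sided a W h \<and> range h = generate G (insert a F)) \<and>
    (generate G (insert a F) = generate G {a} \<or>
     (\<exists>h h' W. cay.double_ray h \<and> cay.double_ray h' \<and> sided a W h \<and> sided a W h' \<and>
           range h \<inter> range h' = {} \<and> range h \<union> range h' = generate G (insert a F)))"
    if "finite F" "F \<subseteq> S" for F
    using that
  proof (induction F rule: finite_induct)
    case empty
    have "sided a {\<one>} (\<lambda>i. a [^] (i::int))" using ac by (auto simp: sided_def)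
    then show ?case using double_ray_powers[OF a] by blast
  next
    case (insert s F)
    let ?H = "generate G (insert a F)"
    have F: "insert a F \<subseteq> carrier G" and s: "s \<in> S" "s \<in> carrier G" using insert S_sub a by auto
    have H: "subgroup ?H G" by (rule generate_is_subgroup[OF F])
    have eq: "insert a (insert s F) = insert s (insert a F)" by blast
    show ?case
    proof (cases "s \<in> ?H")
      case True
      then show ?thesis using insert generate_insert_absorb[OF True F] unfolding eq by auto
    next
      case False
      obtain h W where h: "cay.double_ray h" "sided a W h" "range h = ?H" using insert by auto
      obtain m :: nat where m: "\<And>k::int. s [^] k \<in> ?H \<longleftrightarrow> int m dvd k"
        by (rule power_index[OF H s(2)]) blast
      have "m \<noteq> 1" using m[of 1] False s by auto
      \<comment> \<open>\<open>tor\<close> excludes infinite index. As \<open>s\<close> lies outside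
        the subgroup, there are at least two rows, so some remain for the second double ray.\<close>
      moreover have "m \<noteq> 0"
      proof -
        obtain k :: nat where k: "k > 0" "s [^] k \<in> generate G {a}" using tor s by blast
        then have "s [^] int k \<in> ?H" using mono_generate[of "{a}" "insert a F"] by (auto simp: int_pow_int)
        then show ?thesis using m k(1) by auto
      qed
      ultimately have m2: "m \<ge> 2" by simp
      have "s [^] int m \<in> ?H" using m by simp
      then have g: "generate G (insert s (insert a F)) = {x \<otimes> s [^] j | x j. x \<in> ?H \<and> j \<in> {0..<int m}}"
        using generate_insert_finite_index[OF s(2) F] m2 by simp
      obtain h1 where h1: "cay.double_ray h1" "range h1 = {x \<otimes> s [^] j | x j. x \<in> ?H \<and> j \<in> {0..<0 + int m}}"
        "\<And>k. \<exists>i j. h1 k = h i \<otimes> s [^] j \<and> (i \<ge> 0 \<longleftrightarrow> k \<ge> 0) \<and> j \<in> {0..<0 + int m}"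
        by (rule double_ray_strip[OF H h(1,3) s(1) False m, of "int m" 0]) (use m2 in simp_all)
      obtain h2 where h2: "cay.double_ray h2" "range h2 = {x \<otimes> s [^] j | x j. x \<in> ?H \<and> j \<in> {1..<1 + (int m - 1)}}"
        "\<And>k. \<exists>i j. h2 k = h i \<otimes> s [^] j \<and> (i \<ge> 0 \<longleftrightarrow> k \<ge> 0) \<and> j \<in> {1..<1 + (int m - 1)}"
        by (rule double_ray_strip[OF H h(1,3) s(1) False m, of "int m - 1" 1]) (use m2 in simp_all)
      define W1 where "W1 = (\<lambda>(t, j). t \<otimes> s [^] j) ` (W \<times> {0..<0 + int m})"
      define W2 where "W2 = (\<lambda>(t, j). t \<otimes> s [^] j) ` (W \<times> {1..<1 + (int m - 1)})"
      have S1: "sided a W1 h1" unfolding W1_def by (rule sided_strip[OF h(2) ac s(2) _ h1(3)]) simp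
      have S2: "sided a W2 h2" unfolding W2_def by (rule sided_strip[OF h(2) ac s(2) _ h2(3)]) simp
      \<comment> \<open>The comparison of ends needs one finite set serving both double
        rays.\<close>
      have WW: "finite (W \<union> W2)" "W \<union> W2 \<subseteq> carrier G" using h(2) S2 by (auto simp: sided_def)
      have S: "sided a (W \<union> W2) h" "sided a (W \<union> W2) h2"
        using sided_mono[OF h(2) _ WW] sided_mono[OF S2 _ WW] by auto
      have disj: "range h \<inter> range h2 = {}"
      proof -
        have False if xy: "x \<in> ?H" "y \<in> ?H" "j \<in> {1..<1 + (int m - 1)}" "x = y \<otimes> s [^] j" for x y j
        proof -
          have x: "x \<in> carrier G" using subgroup.mem_carrier[OF H xy(1)] .
          have "x \<otimes> s [^] (0::int) = y \<otimes> s [^] j" using xy(4) x by simp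
          then have "0 = j" using coset_power_unique[OF H s(2) m xy(1,2), of 0 j] xy(3) by auto
          then show False using xy(3) by simp
        qed
        then show ?thesis unfolding h(3) h2(2) by blast
      qed
      have union: "range h \<union> range h2 = {x \<otimes> s [^] j | x j. x \<in> ?H \<and> j \<in> {0..<int m}}"
      proof
        show "range h \<union> range h2 \<subseteq> {x \<otimes> s [^] j | x j. x \<in> ?H \<and> j \<in> {0..<int m}}"
        proof
          fix z assume "z \<in> range h \<union> range h2"
          then consider "z \<in> ?H" | x j where "z = x \<otimes> s [^] j" "x \<in> ?H" "j \<in> {1..<1 + (int m - 1)}"
            unfolding h(3) h2(2) by blast
          then show "z \<in> {x \<otimes> s [^] j | x j. x \<in> ?H \<and> j \<in> {0..<int m}}"
          proof cases
            case 1
            then have "z = z \<otimes> s [^] (0::int)" using subgroup.mem_carrier[OF H] by simp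
            moreover have "(0::int) \<in> {0..<int m}" using m2 by simp
            ultimately show ?thesis using 1 by blast
          next
            case 2
            then have "j \<in> {0..<int m}" by simp
            then show ?thesis using 2 by blast
          qed
        qed
        show "{x \<otimes> s [^] j | x j. x \<in> ?H \<and> j \<in> {0..<int m}} \<subseteq> range h \<union> range h2"
        proof
          fix z assume "z \<in> {x \<otimes> s [^] j | x j. x \<in> ?H \<and> j \<in> {0..<int m}}"
          then obtain x j where z: "z = x \<otimes> s [^] j" "x \<in> ?H" "j \<in> {0..<int m}" by blast
          show "z \<in> range h \<union> range h2"
          proof (cases "j = 0")
            case True
            then have "z = x" using z subgroup.mem_carrier[OF H] by simp
            then show ?thesis using z(2) h(3) by blast
          next
            case False
            then have "j \<in> {1..<1 + (int m - 1)}" using z(3) by simp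
            then show ?thesis unfolding h2(2) using z by blast
          qed
        qed
      qed
      have "\<exists>h W. cay.double_ray h \<and> sided a W h \<and> range h = generate G (insert a (insert s F))"
        using h1(1,2) S1 unfolding eq g by (intro exI[of _ h1] exI[of _ W1]) simp
      moreover have "\<exists>h h' W. cay.double_ray h \<and> cay.double_ray h' \<and> sided a W h \<and> sided a W h' \<and>
           range h \<inter> range h' = {} \<and> range h \<union> range h' = generate G (insert a (insert s F))"
        using h(1) h2(1) S disj union unfolding eq g
        by (intro exI[of _ h] exI[of _ h2] exI[of _ "W \<union> W2"]) simp
      ultimately show ?thesis by blast
    qed
  qed
  from this[OF finS subset_refl] show ?thesis using ne S_gen a(1) by (simp add: insert_absorb)
qed

section \<open>Existence of the circle\<close>

theorem circle_if_proper_generator: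
  assumes a: "a \<in> S" "\<And>k::int. a [^] k = \<one> \<Longrightarrow> k = 0" and ne: "generate G {a} \<noteq> carrier G"
  shows "\<exists>H. hamilton_circle \<Gamma> H"
proof (cases "\<exists>b\<in>S. \<forall>m::nat. m > 0 \<longrightarrow> b [^] m \<notin> generate G {a}")
  case True
  then obtain b where b: "b \<in> S" "\<And>m::nat. m > 0 \<Longrightarrow> b [^] m \<notin> generate G {a}" by blast
  have ac: "a \<in> carrier G" and bc: "b \<in> carrier G" using a b by auto
  obtain h where h: "cay.double_ray h" "range h = carrier G" using spanning_double_ray[OF a] by blast
  have gen: "a [^] (k::int) \<in> generate G {a}" for k using generate_pow[OF ac] by blast
  \<comment> \<open>If \<open>j\<close> were not 0, the relation would put a positive power of
    \<open>b\<close> into the group generated by \<open>a\<close>, against the choice of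
    \<open>b\<close>; then \<open>i = 0\<close> by the infinite order of \<open>a\<close>.\<close>
  have "i = 0 \<and> j = 0" if "a [^] i \<otimes> b [^] j = \<one>" for i j :: int
  proof -
    have 1: "b [^] j = a [^] (- i)"
      using that ac bc by (simp add: int_pow_neg inv_equality m_comm) (metis inv_equality m_comm int_pow_closed)
    have 2: "b [^] (- j) = a [^] i" using 1 ac bc by (simp add: int_pow_neg)
    have "j = 0"
    proof (rule ccontr)
      assume "j \<noteq> 0"
      have "b [^] (int (nat \<bar>j\<bar>)) \<in> generate G {a}"
        using 1 2 gen by (cases "j \<ge> 0") auto
      then show False using b(2)[of "nat \<bar>j\<bar>"] \<open>j \<noteq> 0\<close> by (simp add: int_pow_int)
    qed
    then show ?thesis using 1 a(2)[of "- i"] by simp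
  qed
  then have "(\<lambda>n. h (int n), \<lambda>n. h (- int n)) \<in> ray_equiv \<Gamma>"
    using one_ended[OF a(1) b(1)] cay.is_ray_pos[OF h(1)] cay.is_ray_neg[OF h(1)] by blast
  then show ?thesis using cay.one_double_ray_circle[OF h(1)] h(2) by simp
next
  case False
  then have tor: "\<And>s. s \<in> S \<Longrightarrow> \<exists>m::nat. m > 0 \<and> s [^] m \<in> generate G {a}" by blast
  obtain h h' W where h: "cay.double_ray h" "cay.double_ray h'" "sided a W h" "sided a W h'"
    "range h \<inter> range h' = {}" "range h \<union> range h' = carrier G"
    using two_sided_double_rays[OF a tor ne] by blast
  have cover: "\<exists>t\<in>W. \<exists>k::int. x = a [^] k \<otimes> t" if "x \<in> carrier G" for x
    using that h(3,4) unfolding h(6)[symmetric] sided_def by (metis UnE rangeE)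
  show ?thesis
    using cay.two_double_rays_circle[OF h(1,2,5)] h(6) sided_pos_equiv[OF a h(1,3) h(2,4)]
      sided_neg_equiv[OF a h(1,3) h(2,4)] sided_ends_distinct[OF a tor h(1,3) cover] by simp
qed

text \<open>The inverse of \<open>\<phi>\<close> enumerates the group so that multiplication by a
  nontrivial generator moves the index by one; the Cayley graph is then exactly the two-way infinite
  path.\<close>

lemma no_circle_integers:
  assumes \<phi>: "\<phi> \<in> iso G integer_group" and img: "\<phi> ` (S - {\<one>}) = {1, - 1}"
  shows "\<not> hamilton_circle \<Gamma> H"
proof -
  define h where "h = inv_into (carrier G) \<phi>"
  have bij: "bij_betw \<phi> (carrier G) UNIV" and hom: "\<And>x y. \<lbrakk>x \<in> carrier G; y \<in> carrier G\<rbrakk> \<Longrightarrow> \<phi> (x \<otimes> y) = \<phi> x + \<phi> y"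
    using \<phi> by (auto simp: iso_def hom_def integer_group_def)
  have ph: "\<phi> (h i) = i" for i unfolding h_def by (rule bij_betw_inv_into_right[OF bij UNIV_I])
  have hc: "h i \<in> carrier G" for i
    unfolding h_def by (rule inv_into_into) (simp add: bij_betw_imp_surj_on[OF bij])
  have hp: "h (\<phi> x) = x" if "x \<in> carrier G" for x
    unfolding h_def by (rule bij_betw_inv_into_left[OF bij that])
  have dr: "cay.double_ray h"
    unfolding cay.double_ray_def
  proof (intro conjI allI injI)
    fix i j assume "h i = h j" then show "i = j" by (metis ph)
  next
    fix i
    have "1 \<in> \<phi> ` (S - {\<one>})" unfolding img by simp
    then obtain s where s: "s \<in> S" "s \<noteq> \<one>" "\<phi> s = 1" by (metis DiffD1 DiffD2 imageE singletonI)
    have "h (i + 1) = h i \<otimes> s" using hp[of "h i \<otimes> s"] hom[of "h i" s] hc s ph by simp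
    then show "{h i, h (i + 1)} \<in> edges \<Gamma>" using edgeI[OF hc s(1,2)] by simp
  qed
  have rg: "range h = carrier G"
  proof
    show "carrier G \<subseteq> range h" using hp by (metis rangeI subsetI)
  qed (use hc in blast)
  have "\<exists>i. e = {h i, h (i + 1)}" if e: "e \<in> edges \<Gamma>" for e
  proof -
    obtain g s where g: "e = {g, g \<otimes> s}" "g \<in> carrier G" "s \<in> S" "s \<noteq> \<one>"
      using e unfolding edge_iff by blast
    have "\<phi> s = 1 \<or> \<phi> s = - 1" using g img by blast
    moreover have "g \<otimes> s = h (\<phi> g + \<phi> s)" using hp[of "g \<otimes> s"] hom g by simp
    moreover have "g = h (\<phi> g)" using hp g by simp
    ultimately have "e = {h (\<phi> g), h (\<phi> g + 1)} \<or> e = {h (\<phi> g - 1), h (\<phi> g - 1 + 1)}"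
      using g(1) by auto
    then show ?thesis by blast
  qed
  then show ?thesis using cay.no_hamilton_circle_path[OF dr] rg by simp
qed

text \<open>\<open>circle_if_proper_generator\<close> is applied to every generator of infinite
  order, not to one fixed \<open>a\<close>: without a Hamilton circle each of them generates
  \<open>G\<close>.\<close>

lemma integers_if_no_circle:
  assumes inf: "infinite (carrier G)" and no: "\<not> (\<exists>H. hamilton_circle \<Gamma> H)"
  shows "\<exists>\<phi>\<in>iso G integer_group. \<phi> ` (S - {\<one>}) = {1, - 1}"
proof -
  have gen: "generate G {a} = carrier G" if "a \<in> S" "\<And>k::int. a [^] k = \<one> \<Longrightarrow> k = 0" for a
    using circle_if_proper_generator[OF that] no by blast
  have "\<exists>a\<in>S. \<forall>k::int. a [^] k = \<one> \<longrightarrow> k = 0"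
  proof (rule ccontr)
    assume "\<not> ?thesis"
    then have "\<exists>k::int. k \<noteq> 0 \<and> s [^] k = \<one>" if "s \<in> S" for s using that by blast
    then have "finite (generate G S)" by (rule finite_generate_torsion[OF finS S_sub])
    then show False using S_gen inf by simp
  qed
  then obtain a where a: "a \<in> S" "\<And>k::int. a [^] k = \<one> \<Longrightarrow> k = 0" by blast
  have ac: "a \<in> carrier G" using a by simp
  have inj: "i = j" if "a [^] (i::int) = a [^] j" for i j
  proof -
    have "a [^] (i - j) = \<one>" using that ac by (simp add: int_pow_diff)
    then show ?thesis using a(2) by fastforce
  qed
  have sur: "range (\<lambda>k::int. a [^] k) = carrier G" using double_ray_powers(2)[OF a] gen[OF a] by simp
  define f where "f = (\<lambda>k::int. a [^] k)"
  have f: "f \<in> iso integer_group G"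
    unfolding iso_def hom_def f_def
    using ac inj sur by (auto simp: integer_group_def int_pow_mult bij_betw_def inj_on_def)
  define \<phi> where "\<phi> = inv_into UNIV f"
  have "\<phi> \<in> iso G integer_group"
    using group.iso_set_sym[OF group_integer_group f] by (simp add: \<phi>_def integer_group_def)
  moreover have ph: "\<phi> (a [^] (k::int)) = k" for k
    unfolding \<phi>_def using inj by (metis f_def injI inv_into_f_f UNIV_I)
  have "\<phi> ` (S - {\<one>}) = {1, - 1}"
  proof
    show "\<phi> ` (S - {\<one>}) \<subseteq> {1, - 1}"
    proof (rule image_subsetI)
      fix s assume "s \<in> S - {\<one>}"
      then have s: "s \<in> S" "s \<noteq> \<one>" by auto
      obtain k :: int where k: "s = a [^] k" using sur s(1) S_carrier by (metis imageE)
      have "k \<noteq> 0" using s k by auto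
      \<comment> \<open>Nontrivial elements of an infinite cyclic group have infinite order, so
        \<open>s\<close> generates \<open>G\<close> too; then \<open>a\<close> is a power of
        \<open>s\<close>, and the exponents multiply to 1.\<close>
      have "j = 0" if "s [^] j = \<one>" for j :: int
        using that a(2)[of "k * j"] \<open>k \<noteq> 0\<close> ac by (simp add: k int_pow_pow)
      then have "generate G {s} = carrier G" by (rule gen[OF s(1)])
      then have "a \<in> generate G {s}" using ac by simp
      then obtain j :: int where "a = s [^] j" using generate_pow[of s] s by auto
      then have "a [^] (1::int) = a [^] (k * j)" using ac by (simp add: k int_pow_pow)
      then have "k * j = 1" using inj by metis
      then have "k = 1 \<or> k = - 1" using zmult_eq_1_iff by blast
      then show "\<phi> s \<in> {1, - 1}" using ph k by auto
    qed
    have "a \<in> S - {\<one>}" "inv a \<in> S - {\<one>}"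
      using a(1) a(2)[of 1] S_inv ac inv_eq_1_iff by auto
    moreover have "\<phi> a = 1" "\<phi> (inv a) = - 1" using ph[of 1] ph[of "- 1"] ac by (simp_all add: int_pow_neg)
    ultimately show "{1, - 1} \<subseteq> \<phi> ` (S - {\<one>})" by (metis empty_subsetI image_eqI insert_subset)
  qed
  ultimately show ?thesis by blast
qed

end

text \<open>The exceptional pair is described up to isomorphism, with the identity removed from
  \<open>S\<close> because it contributes no edges. The equivalence also records that the
  exceptional graph has no Hamilton circle.\<close>

theorem theorem3p3:
  fixes G :: "('a, 'b) monoid_scheme" and S :: "'a set"
  assumes "comm_group G"
    and "infinite (carrier G)"
    and "finite S"
    and "S \<subseteq> carrier G"
    and "\<And>s. s \<in> S \<Longrightarrow> inv\<^bsub>G\<^esub> s \<in> S"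
    and "generate G S = carrier G"
  shows "(\<exists>H. hamilton_circle (cayley_graph G S) H) \<longleftrightarrow>
         \<not> (\<exists>\<phi>\<in>iso G integer_group. \<phi> ` (S - {\<one>\<^bsub>G\<^esub>}) = {1, -1})"
proof -
  interpret comm_group G by (rule assms(1))
  interpret cayley G S by unfold_locales (use assms in auto)
  show ?thesis using no_circle_integers integers_if_no_circle[OF assms(2)] by blast
qed

end
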